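(* Let $n\ge1$, $\alpha\in(0,1)$, and let $p\in\left[1,\frac{n}{n-\alpha}\right)$ and $q\in\left(\frac{n}{\alpha},+\infty\right]$ be such that $\frac1p+\frac1q=1$. Let $\eta\in B^\alpha_{q,1}(\mathbb{R}^n)$ have compact support and set $\eta_R(x)=\eta\left(\frac{x}{R}\right)$ for $x\in\mathbb{R}^n$ and $R>0$. If $f\in BV^{\alpha,p}(\mathbb{R}^n)\cap L^\infty(\mathbb{R}^n)$ and $g\in W^{\alpha,1}_{\mathrm{loc}}(\mathbb{R}^n)\cap L^\infty(\mathbb{R}^n)$ with $\nabla^\alpha g\in L^1_{\mathrm{loc}}(\mathbb{R}^n;\mathbb{R}^n)$, then $$\lim_{R\to+\infty}\int_{\mathbb{R}^n}\eta_R\,f\,\nabla^\alpha g\,dx=-\eta(0)\int_{\mathbb{R}^n}g^\star\,dD^\alpha f,$$ where the limit $\lim_{r\to0^+}\frac{1}{|B_r(x)|}\int_{B_r(x)}g(y)\,dy$ defining $g^\star(x)$ exists for $|D^\alpha f|$-a.e. $x\in\mathbb{R}^n$.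
   Context: Let $\mu_{n,\alpha}=2^{\alpha}\pi^{-n/2}\,\Gamma\left(\frac{n+\alpha+1}{2}\right)/\Gamma\left(\frac{1-\alpha}{2}\right)$. For $\varphi\in \mathrm{Lip}_c(\mathbb{R}^n;\mathbb{R}^n)$ (compactly supported Lipschitz), the fractional $\alpha$-divergence is $$\mathrm{div}^\alpha\varphi(x)=\mu_{n,\alpha}\int_{\mathbb{R}^n}\frac{(y-x)\cdot(\varphi(y)-\varphi(x))}{|y-x|^{n+\alpha+1}}\,dy,\quad x\in\mathbb{R}^n.$$ For $p\in[1,+\infty]$ and $f\in L^p(\mathbb{R}^n)$ let $$|D^\alpha f|(\mathbb{R}^n)=\sup\left\{\int_{\mathbb{R}^n} f\,\mathrm{div}^\alpha\varphi\,dx:\varphi\in C^\infty_c(\mathbb{R}^n;\mathbb{R}^n),\ \|\varphi\|_{L^\infty(\mathbb{R}^n;\mathbb{R}^n)}\le1\right\},$$ and $BV^{\alpha,p}(\mathbb{R}^n)=\{f\in L^p(\mathbb{R}^n):|D^\alpha f|(\mathbb{R}^n)<+\infty\}$. A function $f\in L^p(\mathbb{R}^n)$ belongs to $BV^{\alpha,p}(\mathbb{R}^n)$ if and only if there is a (unique) finite $\mathbb{R}^n$-valued Radon measure $D^\alpha f$ on $\mathbb{R}^n$ with $\int_{\mathbb{R}^n} f\,\mathrm{div}^\alpha\varphi\,dx=-\int_{\mathbb{R}^n}\varphi\cdot dD^\alpha f$ for all $\varphi\in \mathrm{Lip}_c(\mathbb{R}^n;\mathbb{R}^n)$; $|D^\alpha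 f|$ denotes its total variation measure. For $g\in L^\infty(\mathbb{R}^n)$, $\nabla^\alpha g\in L^1_{\mathrm{loc}}(\mathbb{R}^n;\mathbb{R}^n)$ denotes the distributional (weak) fractional $\alpha$-gradient, i.e. the function satisfying $\int_{\mathbb{R}^n}g\,\mathrm{div}^\alpha\varphi\,dx=-\int_{\mathbb{R}^n}\varphi\cdot\nabla^\alpha g\,dx$ for all $\varphi\in C^\infty_c(\mathbb{R}^n;\mathbb{R}^n)$. $W^{\alpha,1}_{\mathrm{loc}}(\mathbb{R}^n)$ is the space of $g\in L^1_{\mathrm{loc}}(\mathbb{R}^n)$ with $\int_U\int_U\frac{|g(x)-g(y)|}{|x-y|^{n+\alpha}}\,dx\,dy<+\infty$ for every bounded open $U\subset\mathbb{R}^n$. The precise representative of $g\in L^1_{\mathrm{loc}}(\mathbb{R}^n)$ is $g^\star(x)=\lim_{r\to0^+}\frac{1}{|B_r(x)|}\int_{B_r(x)}g(y)\,dy$ if the limit exists, and $g^\star(x)=0$ otherwise. The Besov space $B^\alpha_{q,1}(\mathbb{R}^n)$ is the set of $u\in L^q(\mathbb{R}^n)$ with $[u]_{B^\alpha_{q,1}(\mathbb{R}^n)}=\int_{\mathbb{R}^n}\frac{\|u(\cdot+h)-u\|_{L^q(\mathbb{R}^n)}}{|h|^{n+\alpha}}\,dh<+\infty$; since $q>n/\alpha$, its elements have a bounded continuous representative, which is the one used to define $\eta(0)$. *)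

theory Defs
  imports "HOL-Analysis.Analysis" "HOL-Probability.Essential_Supremum"
begin

text \<open>Euclidean space is \<^typ>\<open>real^'n\<close> with dimension \<^term>\<open>CARD('n)\<close>. Elements of Lebesgue
  spaces are represented by arbitrary Lebesgue measurable functions, and all integrals with
  respect to Lebesgue measure use the completed measure \<^term>\<open>lebesgue\<close>.\<close>


section \<open>Function spaces\<close>

definition Lp_norm :: "ennreal \<Rightarrow> (real^'n \<Rightarrow> 'b::real_normed_vector) \<Rightarrow> ennreal" where
  "Lp_norm p f =
     (if p = \<infinity> then esssup lebesgue (\<lambda>x. ennreal (norm (f x)))
      else let I = (\<integral>\<^sup>+x. ennreal (norm (f x) powr enn2real p) \<partial>lebesgue)
           in if I = \<infinity> then \<infinity> else ennreal (enn2real I powr (1 / enn2real p)))"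

definition Lp :: "ennreal \<Rightarrow> (real^'n \<Rightarrow> 'b::real_normed_vector) set" where
  "Lp p = {f \<in> borel_measurable lebesgue. Lp_norm p f < \<infinity>}"

definition L1_loc :: "(real^'n \<Rightarrow> 'b::{banach, second_countable_topology}) set" where
  "L1_loc = {g. \<forall>K. compact K \<longrightarrow> set_integrable lebesgue K g}"

definition compact_support :: "('a::topological_space \<Rightarrow> 'b::zero) \<Rightarrow> bool" where
  "compact_support \<phi> \<longleftrightarrow> compact (closure {x. \<phi> x \<noteq> 0})"

text \<open>Compactness of the support for an almost-everywhere equivalence class.\<close>

definition ess_compact_support :: "(real^'n \<Rightarrow> real) \<Rightarrow> bool" where
  "ess_compact_support u \<longleftrightarrow> (\<exists>K. compact K \<and> (AE x in lebesgue. x \<notin> K \<longrightarrow> u x = 0))"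

definition Lip_c :: "(real^'n \<Rightarrow> real^'n) set" where
  "Lip_c = {\<phi>. (\<exists>C. C-lipschitz_on UNIV \<phi>) \<and> compact_support \<phi>}"

primrec C_k :: "nat \<Rightarrow> ('a::real_normed_vector \<Rightarrow> 'b::real_normed_vector) \<Rightarrow> bool" where
  "C_k 0 f \<longleftrightarrow> continuous_on UNIV f"
| "C_k (Suc k) f \<longleftrightarrow>
     (\<forall>x. f differentiable (at x)) \<and> (\<forall>v. C_k k (\<lambda>x. frechet_derivative f (at x) v))"

definition Cc_infinity :: "(real^'n \<Rightarrow> real^'n) set" where
  "Cc_infinity = {\<phi>. (\<forall>k. C_k k \<phi>) \<and> compact_support \<phi>}"

definition besov :: "real \<Rightarrow> ennreal \<Rightarrow> (real^'n \<Rightarrow> real) set" where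
  "besov \<alpha> q = {u \<in> Lp q.
     (\<integral>\<^sup>+h. Lp_norm q (\<lambda>x. u (x + h) - u x) / ennreal (norm h powr (real CARD('n) + \<alpha>)) \<partial>lebesgue) < \<infinity>}"

definition W1_loc :: "real \<Rightarrow> (real^'n \<Rightarrow> real) set" where
  "W1_loc \<alpha> = {g \<in> L1_loc. \<forall>U. bounded U \<and> open U \<longrightarrow>
     (\<integral>\<^sup>+x\<in>U. (\<integral>\<^sup>+y\<in>U. ennreal (\<bar>g x - g y\<bar> / norm (x - y) powr (real CARD('n) + \<alpha>)) \<partial>lebesgue) \<partial>lebesgue) < \<infinity>}"

text \<open>The continuous representative of an almost-everywhere class. It is unique when it exists;
  it exists in particular for every element of \<^term>\<open>besov \<alpha> q\<close> with \<open>q > n / \<alpha>\<close>.\<close>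

definition continuous_rep :: "(real^'n \<Rightarrow> real) \<Rightarrow> real^'n \<Rightarrow> real" where
  "continuous_rep u = (THE v. continuous_on UNIV v \<and> (AE x in lebesgue. v x = u x))"

definition ball_average :: "(real^'n \<Rightarrow> real) \<Rightarrow> real^'n \<Rightarrow> real \<Rightarrow> real" where
  "ball_average g x r = (LINT y:ball x r|lebesgue. g y) / measure lebesgue (ball x r)"

definition has_precise_value :: "(real^'n \<Rightarrow> real) \<Rightarrow> real^'n \<Rightarrow> bool" where
  "has_precise_value g x \<longleftrightarrow> (\<exists>l. (ball_average g x \<longlongrightarrow> l) (at_right 0))"

definition precise_rep :: "(real^'n \<Rightarrow> real) \<Rightarrow> real^'n \<Rightarrow> real" where
  "precise_rep g x = (if has_precise_value g x then Lim (at_right 0) (ball_average g x) else 0)"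


section \<open>Vector-valued Borel measures\<close>

text \<open>A finite vector-valued Radon measure on \<^typ>\<open>real^'n\<close> is a countably additive
  set function on the Borel sets; its values on other sets are irrelevant.\<close>

definition vector_measure :: "((real^'n) set \<Rightarrow> 'b::real_normed_vector) \<Rightarrow> bool" where
  "vector_measure \<nu> \<longleftrightarrow>
     (\<forall>A::nat \<Rightarrow> (real^'n) set. range A \<subseteq> sets borel \<and> disjoint_family A \<longrightarrow>
        (\<lambda>i. \<nu> (A i)) sums \<nu> (\<Union>i. A i))"

definition total_variation :: "((real^'n) set \<Rightarrow> 'b::real_normed_vector) \<Rightarrow> (real^'n) measure" where
  "total_variation \<nu> = measure_of UNIV (sets borel)
     (\<lambda>B. SUP P\<in>{P::nat \<Rightarrow> (real^'n) set. range P \<subseteq> sets borel \<and> disjoint_family P \<and> (\<Union>i. P i) = B}.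
        \<Sum>i. ennreal (norm (\<nu> (P i))))"

text \<open>Positive part in the Jordan decomposition \<open>m = m\<^sup>+ - m\<^sup>-\<close> of a finite signed measure.
  As \<^const>\<open>ennreal\<close> truncates negative numbers to \<open>0\<close>, which is also the value at the
  empty set, this is the supremum of \<open>m\<close> over the Borel subsets.\<close>

definition positive_part :: "((real^'n) set \<Rightarrow> real) \<Rightarrow> (real^'n) measure" where
  "positive_part m = measure_of UNIV (sets borel)
     (\<lambda>B. SUP A\<in>{A \<in> sets borel. A \<subseteq> B}. ennreal (m A))"

definition negative_part :: "((real^'n) set \<Rightarrow> real) \<Rightarrow> (real^'n) measure" where
  "negative_part m = positive_part (\<lambda>A. - m A)"

definition signed_integral :: "((real^'n) set \<Rightarrow> real) \<Rightarrow> (real^'n \<Rightarrow> real) \<Rightarrow> real" where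
  "signed_integral m u = (LINT x|positive_part m. u x) - (LINT x|negative_part m. u x)"

definition vector_integral :: "((real^'n) set \<Rightarrow> real^'n) \<Rightarrow> (real^'n \<Rightarrow> real) \<Rightarrow> real^'n" where
  "vector_integral \<nu> u = (\<chi> i. signed_integral (\<lambda>A. \<nu> A $ i) u)"

definition vector_dot_integral :: "((real^'n) set \<Rightarrow> real^'n) \<Rightarrow> (real^'n \<Rightarrow> real^'n) \<Rightarrow> real" where
  "vector_dot_integral \<nu> \<phi> = (\<Sum>i\<in>UNIV. signed_integral (\<lambda>A. \<nu> A $ i) (\<lambda>x. \<phi> x $ i))"


section \<open>Fractional divergence, variation and gradient\<close>

definition frac_const :: "nat \<Rightarrow> real \<Rightarrow> real" where
  "frac_const n \<alpha> =
     2 powr \<alpha> * pi powr (- real n / 2) * Gamma ((real n + \<alpha> + 1) / 2) / Gamma ((1 - \<alpha>) / 2)"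

definition frac_div :: "real \<Rightarrow> (real^'n \<Rightarrow> real^'n) \<Rightarrow> real^'n \<Rightarrow> real" where
  "frac_div \<alpha> \<phi> x = frac_const CARD('n) \<alpha> *
     (LINT y|lebesgue. ((y - x) \<bullet> (\<phi> y - \<phi> x)) / norm (y - x) powr (real CARD('n) + \<alpha> + 1))"

definition frac_variation :: "real \<Rightarrow> (real^'n \<Rightarrow> real) \<Rightarrow> ereal" where
  "frac_variation \<alpha> f =
     (SUP \<phi>\<in>{\<phi> \<in> Cc_infinity. Lp_norm \<infinity> \<phi> \<le> 1}. ereal (LINT x|lebesgue. f x * frac_div \<alpha> \<phi> x))"

definition BV_frac :: "real \<Rightarrow> ennreal \<Rightarrow> (real^'n \<Rightarrow> real) set" where
  "BV_frac \<alpha> p = {f \<in> Lp p. frac_variation \<alpha> f < \<infinity>}"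

text \<open>\<open>\<nu>\<close> is the measure \<open>D\<^sup>\<alpha> f\<close>. For \<open>f\<close> in \<^term>\<open>BV_frac \<alpha> p\<close> it exists and
  is unique as a function on the Borel sets.\<close>

definition is_frac_variation_measure ::
    "real \<Rightarrow> (real^'n \<Rightarrow> real) \<Rightarrow> ((real^'n) set \<Rightarrow> real^'n) \<Rightarrow> bool" where
  "is_frac_variation_measure \<alpha> f \<nu> \<longleftrightarrow>
     vector_measure \<nu> \<and>
     (\<forall>\<phi>\<in>Lip_c. (LINT x|lebesgue. f x * frac_div \<alpha> \<phi> x) = - vector_dot_integral \<nu> \<phi>)"

text \<open>\<open>G\<close> is the weak fractional gradient of \<open>g\<close>; it is unique up to null sets.\<close>

definition is_weak_frac_gradient ::
    "real \<Rightarrow> (real^'n \<Rightarrow> real) \<Rightarrow> (real^'n \<Rightarrow> real^'n) \<Rightarrow> bool" where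
  "is_weak_frac_gradient \<alpha> g G \<longleftrightarrow>
     G \<in> L1_loc \<and>
     (\<forall>\<phi>\<in>Cc_infinity. (LINT x|lebesgue. g x * frac_div \<alpha> \<phi> x) = - (LINT x|lebesgue. \<phi> x \<bullet> G x))"

end

theory Submission
  imports Defs
begin

text \<open>Write \<open>J(f, u) = \<integral>\<integral> f(x) k(h) (u(x + h) - u(x)) dh dx\<close> with the vector kernel \<open>k(h) = h / |h|^(n+\<alpha>+1)\<close>. Testing
  \<open>D\<close> with ball averages of \<open>g \<eta>(\<cdot>/R)\<close> and shrinking the balls gives \<open>\<mu> J(f, g \<eta>(\<cdot>/R)) = - \<integral> g\<^sup>\<star> \<eta>(\<cdot>/R) dD\<close>. The
  identity \<open>(g v)(x + h) - (g v)(x) = v(x) (g(x + h) - g(x)) + g(x + h) (v(x + h) - v(x))\<close> splits the left side into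
  \<open>\<integral> f \<eta>(\<cdot>/R) G dx\<close>, because the weak gradient \<open>G\<close> is the absolutely convergent singular integral of \<open>g\<close>, and a
  remainder that Hoelder's inequality and scaling bound by a multiple of \<open>R powr (n/q - \<alpha>)\<close>.

  Ball averages of \<open>g\<close> converge almost everywhere for \<open>D\<close> because \<open>|D|(B(x, r)) = O(r powr (n - \<alpha>))\<close> at almost every
  \<open>x\<close>: a set where this fails could be covered by balls whose cutoff functions have small total energy, while
  \<open>f\<close> is bounded. Integrating the energy of \<open>g\<close> over dyadic shells against the part of \<open>|D|\<close> with such a uniform
  bound makes the oscillations of the averages summable.\<close>

section \<open>The Riesz kernel\<close>

text \<open>Since \<open>1/p + 1/q = 1\<close>, the bound \<open>p < n / (n - \<alpha>)\<close> says
  \<open>n/q < \<alpha>\<close>. This acts twice: it makes dyadic averages of a Besov function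
  converge uniformly, which gives the continuous representative behind \<open>\<eta>(0)\<close>, and
  it makes the exponent of the remainder negative. The obstacle is that \<open>D\<close> pairs only
  with Lipschitz fields, whereas \<open>g \<eta>(\<cdot>/R)\<close> is merely bounded with finite
  energy, and that \<open>D\<close> may be singular to Lebesgue measure, so Lebesgue almost
  everywhere convergence of mollifications says nothing about \<open>D\<close>. Ball averages serve
  both sides: they are Lipschitz, they converge in the energy that controls
  \<open>J(f, \<cdot>)\<close> for bounded \<open>f\<close>, and their pointwise limit is by
  definition the precise representative. All test fields point along one axis, so \<open>D\<close>
  is treated as one scalar signed measure per component, through its two Jordan parts; the negative
  part is the positive part of the negated measure. The functions \<open>f\<close> and
  \<open>g\<close> are replaced once by everywhere bounded Borel functions; for \<open>g\<close>
  this leaves every ball average, hence every precise value, unchanged.\<close>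

definition riesz_kernel :: "real \<Rightarrow> real^'n \<Rightarrow> real" where
  "riesz_kernel s h = norm h powr (- (real CARD('n) + s))"

lemma riesz_kernel_measurable [measurable]: "riesz_kernel s \<in> borel_measurable borel"
  unfolding riesz_kernel_def by measurable

lemma riesz_kernel_nonneg [simp]: "0 \<le> riesz_kernel s h"
  by (simp add: riesz_kernel_def)

lemma dyadic_bracket:
  assumes "1 \<le> (x::real)"
  obtains k :: nat where "2 ^ k \<le> x" "x < 2 ^ Suc k"
proof -
  obtain m where "x < 2 ^ m"
    using real_arch_pow[of 2 x] by auto
  moreover define k where "k = (LEAST m. x < 2 ^ m)"
  ultimately have k: "x < 2 ^ k" and min: "\<And>j. j < k \<Longrightarrow> \<not> x < 2 ^ j"
    by (auto intro: LeastI dest: not_less_Least)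
  have "k \<noteq> 0" using k assms by (cases k) auto
  then obtain j where "k = Suc j" by (cases k) auto
  with k min[of j] show ?thesis by (intro that[of j]) auto
qed

text \<open>Where \<open>F\<close> is nonzero, the series with terms \<open>a k\<close> on
  \<open>cball 0 (\<rho> k)\<close> contains a single term that already dominates it; integrating
  the series costs only the volumes of the balls. It serves growing radii for the tail of a kernel
  and shrinking radii for its singularity.\<close>

lemma nn_integral_dyadic_bound:
  fixes F :: "real^'n \<Rightarrow> ennreal" and a \<rho> :: "nat \<Rightarrow> real"
  assumes F: "\<And>h. F h \<noteq> 0 \<Longrightarrow> \<exists>k. norm h \<le> \<rho> k \<and> F h \<le> ennreal (a k)"
    and nonneg: "\<And>k. 0 \<le> a k" "\<And>k. 0 \<le> \<rho> k"
    and sums: "(\<lambda>k. a k * \<rho> k ^ CARD('n)) sums s"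
  shows "(\<integral>\<^sup>+h. F h \<partial>lborel) \<le> ennreal (unit_ball_vol (real CARD('n)) * s)"
proof -
  have *: "F h \<le> (\<Sum>k. ennreal (a k) * indicator (cball 0 (\<rho> k)) h)" for h
  proof (cases "F h = 0")
    case False
    then obtain k where k: "norm h \<le> \<rho> k" "F h \<le> ennreal (a k)" using F by blast
    have "ennreal (a k) = (\<Sum>j\<in>{k}. ennreal (a j) * indicator (cball 0 (\<rho> j)) h)"
      using k by simp
    also have "\<dots> \<le> (\<Sum>k. ennreal (a k) * indicator (cball 0 (\<rho> k)) h)"
      by (rule sum_le_suminf) auto
    finally show ?thesis using k(2) by simp
  qed simp
  have "(\<integral>\<^sup>+h. F h \<partial>lborel) \<le> (\<integral>\<^sup>+h. (\<Sum>k. ennreal (a k) * indicator (cball 0 (\<rho> k)) h) \<partial>(lborel :: (real^'n) measure))"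
    by (intro nn_integral_mono *)
  also have "\<dots> = (\<Sum>k. ennreal (a k) * emeasure lborel (cball (0::real^'n) (\<rho> k)))"
    by (subst nn_integral_suminf) (auto intro!: borel_measurable_times_ennreal borel_measurable_indicator suminf_cong nn_integral_cmult_indicator)
  also have "\<dots> = (\<Sum>k. ennreal (unit_ball_vol (real CARD('n)) * (a k * \<rho> k ^ CARD('n))))"
    using nonneg by (simp add: emeasure_cball ennreal_mult'[symmetric] mult_ac)
  also have "\<dots> = ennreal (\<Sum>k. unit_ball_vol (real CARD('n)) * (a k * \<rho> k ^ CARD('n)))"
    using nonneg sums by (intro suminf_ennreal2) (auto intro!: summable_mult simp: sums_iff)
  also have "\<dots> = ennreal (unit_ball_vol (real CARD('n)) * s)"
    using sums by (simp add: suminf_mult sums_iff)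
  finally show ?thesis .
qed

lemma riesz_kernel_far:
  assumes "0 < s"
  obtains C where "0 < C" "\<And>r. 0 < r \<Longrightarrow>
    (\<integral>\<^sup>+h. ennreal (riesz_kernel s (h::real^'n)) * indicator (- ball 0 r) h \<partial>lborel) \<le> ennreal (C * r powr (- s))"
proof -
  define n where "n = CARD('n)"
  define q where "q = 2 powr (- s)"
  have q: "0 < q" "q < 1" using assms by (auto simp: q_def powr_less_one)
  define C where "C = unit_ball_vol (real n) * (2 ^ n * (1 / (1 - q)))"
  have "(\<integral>\<^sup>+h. ennreal (riesz_kernel s (h::real^'n)) * indicator (- ball 0 r) h \<partial>lborel) \<le> ennreal (C * r powr (- s))"
    if r: "0 < r" for r
  proof -
    have "(\<integral>\<^sup>+h. ennreal (riesz_kernel s (h::real^'n)) * indicator (- ball 0 r) h \<partial>lborel)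
       \<le> ennreal (unit_ball_vol (real CARD('n)) * (2 ^ n * r powr (- s) * (1 / (1 - q))))"
    proof (rule nn_integral_dyadic_bound)
      \<comment> \<open>On the shell between \<open>2 ^ k * r\<close> and
        \<open>2 ^ Suc k * r\<close> the kernel is at most its value at the inner radius, while the
        volume is that of the outer ball; the product decays like \<open>q ^ k\<close>.\<close>
      let ?a = "\<lambda>k. (2 ^ k * r) powr (- (real n + s))" and ?\<rho> = "\<lambda>k. 2 ^ Suc k * r"
      show "\<exists>k. norm h \<le> ?\<rho> k \<and> ennreal (riesz_kernel s h) * indicator (- ball 0 r) h \<le> ennreal (?a k)"
        if "ennreal (riesz_kernel s h) * indicator (- ball 0 r) h \<noteq> 0" for h :: "real^'n"
      proof -
        have h: "r \<le> norm h" using that by (auto simp: indicator_def split: if_splits)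
        then have "1 \<le> norm h / r" using r by simp
        from dyadic_bracket[OF this] obtain k where k: "2 ^ k \<le> norm h / r" "norm h / r < 2 ^ Suc k" .
        then have k': "2 ^ k * r \<le> norm h" "norm h < 2 ^ Suc k * r" using r by (auto simp: field_simps)
        have "norm h powr (- (real n + s)) \<le> ?a k"
          using k' r assms by (intro powr_mono2') auto
        then show ?thesis using k' by (intro exI[of _ k]) (auto simp: riesz_kernel_def n_def indicator_def)
      qed
      have eq: "?a k * ?\<rho> k ^ CARD('n) = 2 ^ n * r powr (- s) * q ^ k" for k
      proof -
        have "?a k * ?\<rho> k ^ n = 2 ^ n * ((2 ^ k * r) powr (- (real n + s)) * (2 ^ k * r) powr (real n))"
          using r by (simp add: powr_realpow power_mult_distrib)
        also have "\<dots> = 2 ^ n * (2 ^ k * r) powr (- s)"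
          by (simp add: powr_add[symmetric])
        also have "\<dots> = 2 ^ n * r powr (- s) * q ^ k"
          using r by (simp add: powr_mult q_def powr_realpow[symmetric] powr_powr mult.commute)
        finally show ?thesis by (simp add: n_def)
      qed
      show "(\<lambda>k. ?a k * ?\<rho> k ^ CARD('n)) sums (2 ^ n * r powr (- s) * (1 / (1 - q)))"
        unfolding eq using q by (intro sums_mult geometric_sums) auto
    qed (use r in auto)
    then show ?thesis by (simp add: C_def n_def mult_ac)
  qed
  moreover have "0 < C" using q by (simp add: C_def)
  ultimately show ?thesis using that by blast
qed

lemma riesz_kernel_near:
  assumes "0 < s" "s < 1"
  obtains C where "0 < C" "\<And>r. 0 < r \<Longrightarrow>
    (\<integral>\<^sup>+h. ennreal (riesz_kernel (- s) (h::real^'n)) * indicator (ball 0 r) h \<partial>lborel) \<le> ennreal (C * r powr s)"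
proof -
  define n where "n = CARD('n)"
  have n1: "1 \<le> n" by (simp add: n_def Suc_leI)
  define q where "q = (1/2) powr s"
  have q: "0 < q" "q < 1" using assms using powr_less_mono2[of s "1/2" 1] by (auto simp: q_def)
  define C where "C = unit_ball_vol (real n) * (2 ^ n * (1 / (1 - q)))"
  have "(\<integral>\<^sup>+h. ennreal (riesz_kernel (- s) (h::real^'n)) * indicator (ball 0 r) h \<partial>lborel) \<le> ennreal (C * r powr s)"
    if r: "0 < r" for r
  proof -
    have "(\<integral>\<^sup>+h. ennreal (riesz_kernel (- s) (h::real^'n)) * indicator (ball 0 r) h \<partial>lborel)
       \<le> ennreal (unit_ball_vol (real CARD('n)) * (2 ^ n * ((1/2) * r) powr s * (1 / (1 - q))))"
    proof (rule nn_integral_dyadic_bound)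
      \<comment> \<open>\<open>(1/2) ^ Suc k * r\<close> is the inner radius of the shell with outer
        radius \<open>?\<rho> k\<close>. Since \<open>s < 1 \<le> n\<close>, the exponent
        \<open>s - n\<close> is negative and the kernel is largest at the inner radius.\<close>
      let ?a = "\<lambda>k. ((1/2) ^ Suc k * r) powr (s - real n)" and ?\<rho> = "\<lambda>k. (1/2) ^ k * r"
      show "\<exists>k. norm h \<le> ?\<rho> k \<and> ennreal (riesz_kernel (- s) h) * indicator (ball 0 r) h \<le> ennreal (?a k)"
        if "ennreal (riesz_kernel (- s) h) * indicator (ball 0 r) h \<noteq> 0" for h :: "real^'n"
      proof -
        have h: "norm h < r" "h \<noteq> 0" using that by (auto simp: indicator_def riesz_kernel_def split: if_splits)
        then have "1 \<le> r / norm h" by simp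
        from dyadic_bracket[OF this] obtain k where k: "2 ^ k \<le> r / norm h" "r / norm h < 2 ^ Suc k" .
        then have k': "norm h \<le> (1/2) ^ k * r" "(1/2) ^ Suc k * r < norm h"
          using r h by (auto simp: field_simps)
        have "norm h powr (s - real n) \<le> ?a k"
          using k' r assms n1 by (intro powr_mono2') auto
        then show ?thesis using k' by (intro exI[of _ k]) (auto simp: riesz_kernel_def n_def indicator_def)
      qed
      have eq: "?a k * ?\<rho> k ^ CARD('n) = 2 ^ n * ((1/2) * r) powr s * q ^ k" for k
      proof -
        have "?\<rho> k = 2 * ((1/2) ^ Suc k * r)" by simp
        then have "?\<rho> k ^ n = 2 ^ n * ((1/2) ^ Suc k * r) ^ n" by (simp only: power_mult_distrib)
        then have "?a k * ?\<rho> k ^ n = 2 ^ n * (((1/2) ^ Suc k * r) powr (s - real n) * ((1/2) ^ Suc k * r) powr (real n))"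
          using r by (simp add: powr_realpow)
        also have "\<dots> = 2 ^ n * ((1/2) ^ k * ((1/2) * r)) powr s"
          by (simp add: powr_add[symmetric] mult_ac)
        also have "\<dots> = 2 ^ n * ((1/2) * r) powr s * ((1/2) ^ k) powr s"
          using r by (subst powr_mult) auto
        also have "((1/2::real) ^ k) powr s = q ^ k"
          by (simp add: q_def powr_realpow[symmetric] powr_powr mult.commute)
        finally show ?thesis by (simp add: n_def)
      qed
      show "(\<lambda>k. ?a k * ?\<rho> k ^ CARD('n)) sums (2 ^ n * ((1/2) * r) powr s * (1 / (1 - q)))"
        unfolding eq using q by (intro sums_mult geometric_sums) auto
    qed (use r in auto)
    also have "\<dots> \<le> ennreal (C * r powr s)"
    proof (rule ennreal_leI)
      have "((1/2) * r) powr s \<le> r powr s" using r assms by (intro powr_mono2) auto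
      then have "unit_ball_vol (real n) * (2 ^ n * (1 / (1 - q))) * ((1/2) * r) powr s
          \<le> unit_ball_vol (real n) * (2 ^ n * (1 / (1 - q))) * r powr s"
        using q by (intro mult_left_mono) auto
      then show "unit_ball_vol (real CARD('n)) * (2 ^ n * ((1/2) * r) powr s * (1 / (1 - q))) \<le> C * r powr s"
        by (simp add: C_def n_def mult_ac)
    qed
    finally show ?thesis .
  qed
  moreover have "0 < C" using q by (simp add: C_def)
  ultimately show ?thesis using that by blast
qed

section \<open>Lebesgue integrals under translation, dilation and reflection\<close>

lemma nn_integral_lborel_shift:
  fixes f :: "'a::euclidean_space \<Rightarrow> ennreal"
  assumes [measurable]: "f \<in> borel_measurable borel"
  shows "(\<integral>\<^sup>+x. f (x + h) \<partial>lborel) = (\<integral>\<^sup>+x. f x \<partial>lborel)"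
proof -
  have "(\<integral>\<^sup>+x. f x \<partial>lborel) = (\<integral>\<^sup>+x. f x \<partial>distr lborel borel ((+) h))"
    by (simp add: lborel_distr_plus)
  also have "\<dots> = (\<integral>\<^sup>+x. f (x + h) \<partial>lborel)"
    by (subst nn_integral_distr) (auto simp: add.commute)
  finally show ?thesis by simp
qed

lemma integral_lborel_shift:
  fixes f :: "'a::euclidean_space \<Rightarrow> real"
  assumes [measurable]: "f \<in> borel_measurable borel"
  shows "(LINT x|lborel. f (x + h)) = (LINT x|lborel. f x)"
proof -
  have "(LINT x|lborel. f x) = (LINT x|distr lborel borel ((+) h). f x)"
    by (simp add: lborel_distr_plus)
  also have "\<dots> = (LINT x|lborel. f (x + h))"
    by (subst integral_distr) (auto simp: add.commute)
  finally show ?thesis by simp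
qed

text \<open>\<open>lborel_affine\<close> expresses \<open>lborel\<close> as a density over the image
  measure; multiplying by the reciprocal constant inverts this relation.\<close>

lemma lborel_distr_scaleR:
  assumes "c \<noteq> 0"
  shows "distr lborel borel ((*\<^sub>R) c :: 'a::euclidean_space \<Rightarrow> 'a) = density lborel (\<lambda>_. ennreal (inverse (\<bar>c\<bar> ^ DIM('a))))"
proof -
  have *: "(lborel :: 'a measure) = density (distr lborel borel ((*\<^sub>R) c)) (\<lambda>_. ennreal (\<bar>c\<bar> ^ DIM('a)))"
    using lborel_affine[OF assms, of "0::'a"] by (simp add: scaleR_conv_of_real[abs_def])
  have "density lborel (\<lambda>_. ennreal (inverse (\<bar>c\<bar> ^ DIM('a)))) =
     density (distr lborel borel ((*\<^sub>R) c)) (\<lambda>_::'a. ennreal (\<bar>c\<bar> ^ DIM('a)) * ennreal (inverse (\<bar>c\<bar> ^ DIM('a))))"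
    by (subst *, subst density_density_eq) auto
  also have "(\<lambda>_::'a. ennreal (\<bar>c\<bar> ^ DIM('a)) * ennreal (inverse (\<bar>c\<bar> ^ DIM('a)))) = (\<lambda>_. 1)"
    using assms by (simp add: ennreal_mult''[symmetric])
  finally show ?thesis by (simp add: density_1)
qed

lemma nn_integral_lborel_scaleR:
  fixes f :: "'a::euclidean_space \<Rightarrow> ennreal"
  assumes [measurable]: "f \<in> borel_measurable borel" and c: "c \<noteq> 0"
  shows "(\<integral>\<^sup>+x. f (c *\<^sub>R x) \<partial>lborel) = ennreal (inverse (\<bar>c\<bar> ^ DIM('a))) * (\<integral>\<^sup>+x. f x \<partial>lborel)"
proof -
  have "(\<integral>\<^sup>+x. f (c *\<^sub>R x) \<partial>lborel) = (\<integral>\<^sup>+x. f x \<partial>distr lborel borel ((*\<^sub>R) c))"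
    by (subst nn_integral_distr) auto
  also have "\<dots> = ennreal (inverse (\<bar>c\<bar> ^ DIM('a))) * (\<integral>\<^sup>+x. f x \<partial>lborel)"
    by (simp add: lborel_distr_scaleR[OF c] nn_integral_density nn_integral_cmult)
  finally show ?thesis .
qed

lemma integral_lborel_uminus:
  fixes f :: "'a::euclidean_space \<Rightarrow> real"
  assumes [measurable]: "f \<in> borel_measurable borel"
  shows "(LINT x|lborel. f (- x)) = (LINT x|lborel. f x)"
proof -
  have "(LINT x|lborel. f (- x)) = (LINT x|distr lborel borel ((*\<^sub>R) (-1)). f x)"
    by (subst integral_distr) auto
  also have "\<dots> = (LINT x|lborel. f x)"
    by (simp add: lborel_distr_scaleR density_1)
  finally show ?thesis .
qed

section \<open>Jordan decomposition\<close>

lemma vector_measure_empty: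
  assumes "vector_measure \<nu>" shows "\<nu> {} = 0"
proof -
  have "(\<lambda>i::nat. \<nu> {}) sums \<nu> {}"
    using assms[unfolded vector_measure_def, rule_format, of "\<lambda>_. {}"] by (auto simp: disjoint_family_on_def)
  then have "(\<lambda>i::nat. \<nu> {}) \<longlonglongrightarrow> 0" by (auto dest: sums_summable summable_LIMSEQ_zero)
  then show ?thesis by (simp add: LIMSEQ_const_iff)
qed

lemma vector_measure_Un:
  assumes \<nu>: "vector_measure \<nu>" and "A \<in> sets borel" "B \<in> sets borel" "A \<inter> B = {}"
  shows "\<nu> (A \<union> B) = \<nu> A + \<nu> B"
proof -
  have "(\<lambda>i. \<nu> (binaryset A B i)) sums \<nu> (\<Union>i. binaryset A B i)"
    using assms unfolding vector_measure_def
    by (intro \<nu>[unfolded vector_measure_def, rule_format]) (auto simp: range_binaryset_eq disjoint_family_on_def binaryset_def)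
  moreover have "(\<lambda>i. \<nu> (binaryset A B i)) sums (\<nu> A + \<nu> B)"
    by (rule binaryset_sums) (rule vector_measure_empty[OF \<nu>])
  ultimately show ?thesis by (metis UN_binaryset_eq sums_unique2)
qed

lemma vector_measure_Diff:
  assumes \<nu>: "vector_measure \<nu>" and "A \<in> sets borel" "B \<in> sets borel" "A \<subseteq> B"
  shows "\<nu> (B - A) = \<nu> B - \<nu> A"
proof -
  have "\<nu> B = \<nu> A + \<nu> (B - A)"
    using vector_measure_Un[OF \<nu>, of A "B - A"] assms by (auto simp: Un_absorb1)
  then show ?thesis by simp
qed

lemma vector_measure_uminus: "vector_measure \<nu> \<Longrightarrow> vector_measure (\<lambda>A. - \<nu> A)"
  unfolding vector_measure_def by (auto intro: sums_minus)

lemma vector_measure_component: "vector_measure \<nu> \<Longrightarrow> vector_measure (\<lambda>A. \<nu> A $ i)"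
  unfolding vector_measure_def
  by (auto intro: bounded_linear.sums[OF bounded_linear_vec_nth])

text \<open>The set function from which \<open>positive_part\<close> is built, named separately so
  that its additivity can be proved before it is known to be a measure.\<close>

definition upper_var :: "((real^'n) set \<Rightarrow> real) \<Rightarrow> (real^'n) set \<Rightarrow> ennreal" where
  "upper_var m B = (SUP A\<in>{A \<in> sets borel. A \<subseteq> B}. ennreal (m A))"

lemma upper_var_upper: "A \<in> sets borel \<Longrightarrow> A \<subseteq> B \<Longrightarrow> ennreal (m A) \<le> upper_var m B"
  unfolding upper_var_def by (intro SUP_upper) auto

lemma upper_var_mono: "B \<subseteq> C \<Longrightarrow> upper_var m B \<le> upper_var m C"
  unfolding upper_var_def by (intro SUP_subset_mono) auto

text \<open>Borel subsets of the disjoint sets \<open>B\<close> and \<open>C\<close> can be united,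
  and \<open>m\<close> adds up on them. If one of the two has nonpositive measure, it contributes 0
  after truncation and the other is used alone.\<close>

lemma upper_var_superadd:
  fixes m :: "(real^'n) set \<Rightarrow> real"
  assumes m: "vector_measure m" and disj: "B \<inter> C = {}"
  shows "upper_var m B + upper_var m C \<le> upper_var m (B \<union> C)"
proof -
  have *: "ennreal (m E) + ennreal (m F) \<le> upper_var m (B \<union> C)"
    if "E \<in> sets borel" "E \<subseteq> B" "F \<in> sets borel" "F \<subseteq> C" for E F
  proof -
    consider "m E \<le> 0" | "m F \<le> 0" | "0 \<le> m E" "0 \<le> m F" by linarith
    then show ?thesis
    proof cases
      case 1 with that show ?thesis by (auto simp: ennreal_neg intro!: upper_var_upper)
    next
      case 2 with that show ?thesis by (auto simp: ennreal_neg intro!: upper_var_upper)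
    next
      case 3
      have "m (E \<union> F) = m E + m F" using that disj by (intro vector_measure_Un m) auto
      with 3 have "ennreal (m E) + ennreal (m F) = ennreal (m (E \<union> F))" by simp
      also have "\<dots> \<le> upper_var m (B \<union> C)" using that by (intro upper_var_upper) auto
      finally show ?thesis .
    qed
  qed
  have "ennreal (m E) + upper_var m C \<le> upper_var m (B \<union> C)" if "E \<in> sets borel" "E \<subseteq> B" for E
  proof -
    have "ennreal (m E) + upper_var m C = (SUP F\<in>{A \<in> sets borel. A \<subseteq> C}. ennreal (m E) + ennreal (m F))"
      unfolding upper_var_def by (subst ennreal_SUP_add_right) auto
    also have "\<dots> \<le> upper_var m (B \<union> C)" using that * by (intro SUP_least) auto
    finally show ?thesis .
  qed
  then have "(SUP E\<in>{A \<in> sets borel. A \<subseteq> B}. ennreal (m E) + upper_var m C) \<le> upper_var m (B \<union> C)"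
    by (intro SUP_least) auto
  also have "(SUP E\<in>{A \<in> sets borel. A \<subseteq> B}. ennreal (m E) + upper_var m C) = upper_var m B + upper_var m C"
    unfolding upper_var_def[of m B] by (subst ennreal_SUP_add_left) auto
  finally show ?thesis .
qed

text \<open>One inequality is finite superadditivity plus monotonicity. For the other, a Borel
  subset \<open>E\<close> of the union is cut along the \<open>A i\<close>, and the partial sums of
  \<open>m (E \<inter> A i)\<close> are bounded by those of the upper variations.\<close>

lemma upper_var_countably_additive:
  fixes m :: "(real^'n) set \<Rightarrow> real"
  assumes m: "vector_measure m"
  shows "countably_additive (sets borel) (upper_var m)"
  unfolding countably_additive_def
proof (intro allI impI)
  fix A :: "nat \<Rightarrow> (real^'n) set"
  assume A: "range A \<subseteq> sets borel" "disjoint_family A"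
  have "(\<Sum>i<n. upper_var m (A i)) \<le> upper_var m (\<Union>i<n. A i)" for n
  proof (induction n)
    case (Suc n)
    have "(\<Sum>i<Suc n. upper_var m (A i)) \<le> upper_var m (\<Union>i<n. A i) + upper_var m (A n)"
      using Suc by (simp add: add_right_mono)
    also have "\<dots> \<le> upper_var m ((\<Union>i<n. A i) \<union> A n)"
    proof (rule upper_var_superadd[OF m])
      have "A i \<inter> A n = {}" if "i < n" for i
        using A(2) that by (intro disjoint_family_onD[where I=UNIV]) auto
      then show "(\<Union>i<n. A i) \<inter> A n = {}" by blast
    qed
    finally show ?case by (simp add: lessThan_Suc Un_commute)
  qed simp
  then have "(\<Sum>i<n. upper_var m (A i)) \<le> upper_var m (\<Union>i. A i)" for n
    by (rule order_trans) (auto intro: upper_var_mono)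
  then have le: "(\<Sum>i. upper_var m (A i)) \<le> upper_var m (\<Union>i. A i)"
    by (simp add: suminf_eq_SUP SUP_least)
  have "ennreal (m E) \<le> (\<Sum>i. upper_var m (A i))" if E: "E \<in> sets borel" "E \<subseteq> (\<Union>i. A i)" for E
  proof -
    have "(\<lambda>i. m (E \<inter> A i)) sums m (\<Union>i. E \<inter> A i)"
      using A E by (intro m[unfolded vector_measure_def, rule_format]) (auto simp: disjoint_family_on_def)
    also have "(\<Union>i. E \<inter> A i) = E" using E by auto
    finally have "(\<lambda>n. ennreal (\<Sum>i<n. m (E \<inter> A i))) \<longlonglongrightarrow> ennreal (m E)"
      unfolding sums_def by (rule tendsto_ennrealI)
    moreover have "ennreal (\<Sum>i<n. m (E \<inter> A i)) \<le> (\<Sum>i. upper_var m (A i))" for n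
    proof -
      \<comment> \<open>\<open>ennreal\<close> commutes with sums of nonnegative terms only, hence
        the detour through \<open>max 0\<close>.\<close>
      have "ennreal (\<Sum>i<n. m (E \<inter> A i)) \<le> ennreal (\<Sum>i<n. max 0 (m (E \<inter> A i)))"
        by (intro ennreal_leI sum_mono) auto
      also have "\<dots> = (\<Sum>i<n. ennreal (m (E \<inter> A i)))"
      proof -
        have "ennreal (max 0 (m (E \<inter> A i))) = ennreal (m (E \<inter> A i))" for i
          by (auto simp: max_def ennreal_neg)
        then show ?thesis using sum_ennreal[of "{..<n}" "\<lambda>i. max 0 (m (E \<inter> A i))"] by simp
      qed
      also have "\<dots> \<le> (\<Sum>i<n. upper_var m (A i))"
        using A E by (intro sum_mono upper_var_upper) auto
      also have "\<dots> \<le> (\<Sum>i. upper_var m (A i))"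
        by (rule sum_le_suminf) auto
      finally show ?thesis .
    qed
    ultimately show ?thesis by (blast intro: LIMSEQ_le_const2)
  qed
  then have "upper_var m (\<Union>i. A i) \<le> (\<Sum>i. upper_var m (A i))"
    unfolding upper_var_def[of m "\<Union>i. A i"] by (intro SUP_least) auto
  with le show "(\<Sum>i. upper_var m (A i)) = upper_var m (\<Union>i. A i)" by (rule antisym)
qed

section \<open>The positive part as a finite measure\<close>

lemma space_positive_part [simp]: "space (positive_part m) = UNIV"
  unfolding positive_part_def by (rule space_measure_of) auto

lemma sets_positive_part [simp, measurable_cong]:
  "sets (positive_part m) = sets (borel :: (real^'n) measure)"
proof -
  have "sets (positive_part m) = sigma_sets UNIV (sets (borel :: (real^'n) measure))"
    unfolding positive_part_def by (rule sets_measure_of) auto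
  also have "\<dots> = sets borel"
    using sets.sigma_sets_eq[of "borel :: (real^'n) measure"] by simp
  finally show ?thesis .
qed

lemma emeasure_positive_part:
  fixes m :: "(real^'n) set \<Rightarrow> real"
  assumes m: "vector_measure m" and B: "B \<in> sets borel"
  shows "emeasure (positive_part m) B = upper_var m B"
proof -
  have "sigma_sets UNIV (sets borel) = sets (borel :: (real^'n) measure)"
    by (metis sets.sigma_sets_eq space_borel)
  moreover have "upper_var m {} = 0"
    using vector_measure_empty[OF m] by (auto simp: upper_var_def)
  ultimately show ?thesis
    using upper_var_countably_additive[OF m] B unfolding positive_part_def upper_var_def
    by (intro emeasure_measure_of) (auto simp: positive_def sets_measure_of_conv)
qed

text \<open>A Borel set \<open>B\<close> of infinite upper variation contains a Borel set
  \<open>A\<close> with \<open>m A > \<bar>m B\<bar> + 1\<close>. Either \<open>A\<close> or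
  \<open>B - A\<close> again has infinite upper variation, and the margin makes \<open>m\<close> at
  least 1 in absolute value on whichever piece is split off. Iteration yields disjoint pieces on
  which \<open>m\<close> does not tend to 0, against countable additivity.\<close>

lemma finite_positive_part:
  fixes m :: "(real^'n) set \<Rightarrow> real"
  assumes m: "vector_measure m"
  shows "finite_measure (positive_part m)"
proof (rule ccontr)
  assume "\<not> finite_measure (positive_part m)"
  then have inf: "upper_var m UNIV = \<infinity>"
    using emeasure_positive_part[OF m, of UNIV] by (metis finite_measureI infinity_ennreal_def space_positive_part sets.top space_borel)
  have step: "\<exists>C\<in>sets borel. C \<subseteq> B \<and> upper_var m C = \<infinity> \<and> 1 \<le> \<bar>m (B - C)\<bar>"
    if B: "B \<in> sets borel" "upper_var m B = \<infinity>" for B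
  proof -
    have "ennreal (\<bar>m B\<bar> + 1) < upper_var m B" using B by simp
    then obtain A where A: "A \<in> sets borel" "A \<subseteq> B" "ennreal (\<bar>m B\<bar> + 1) < ennreal (m A)"
      unfolding upper_var_def less_SUP_iff by auto
    then have mA: "\<bar>m B\<bar> + 1 < m A" by (subst (asm) ennreal_less_iff) auto
    have "emeasure (positive_part m) B = emeasure (positive_part m) A + emeasure (positive_part m) (B - A)"
      using A B by (subst plus_emeasure) (auto simp: Un_absorb1)
    then have "upper_var m A = \<infinity> \<or> upper_var m (B - A) = \<infinity>"
      using A B by (metis emeasure_positive_part[OF m] ennreal_add_eq_top infinity_ennreal_def sets.Diff)
    then show ?thesis
    proof
      assume "upper_var m A = \<infinity>"
      then show ?thesis using A B mA
        by (intro bexI[of _ A]) (auto simp: vector_measure_Diff[OF m])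
    next
      assume "upper_var m (B - A) = \<infinity>"
      moreover have "B - (B - A) = A" using A by auto
      ultimately show ?thesis using A B mA by (intro bexI[of _ "B - A"]) auto
    qed
  qed
  have "\<exists>B :: nat \<Rightarrow> (real^'n) set. \<forall>k. (B k \<in> sets borel \<and> upper_var m (B k) = \<infinity>) \<and>
      (B (Suc k) \<subseteq> B k \<and> 1 \<le> \<bar>m (B k - B (Suc k))\<bar>)"
  proof (rule dependent_nat_choice)
    show "\<exists>x. x \<in> sets borel \<and> upper_var m x = \<infinity>" using inf by (intro exI[of _ UNIV]) auto
  qed (use step in blast)
  then obtain B :: "nat \<Rightarrow> (real^'n) set" where B: "\<And>k. B k \<in> sets borel" "\<And>k. B (Suc k) \<subseteq> B k"
      "\<And>k. 1 \<le> \<bar>m (B k - B (Suc k))\<bar>" by blast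
  have anti: "B j \<subseteq> B k" if "k \<le> j" for j k
    using that by (rule lift_Suc_antimono_le[rotated]) (rule B(2))
  have "disjoint_family (\<lambda>k. B k - B (Suc k))"
    unfolding disjoint_family_on_def
  proof (intro ballI impI)
    fix j k :: nat assume "j \<noteq> k"
    then show "(B j - B (Suc j)) \<inter> (B k - B (Suc k)) = {}"
      using anti[of "Suc j" k] anti[of "Suc k" j] by (cases j k rule: linorder_cases) auto
  qed
  then have "(\<lambda>k. m (B k - B (Suc k))) sums m (\<Union>k. B k - B (Suc k))"
    using B by (intro m[unfolded vector_measure_def, rule_format]) auto
  then have "(\<lambda>k. m (B k - B (Suc k))) \<longlonglongrightarrow> 0" by (auto dest: sums_summable summable_LIMSEQ_zero)
  then have "eventually (\<lambda>k. \<bar>m (B k - B (Suc k))\<bar> < 1) sequentially"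
    by (auto dest!: tendstoD[where e=1])
  then show False using B(3) by (auto simp: eventually_sequentially not_less[symmetric])
qed

text \<open>For a Borel subset \<open>A\<close> of \<open>B\<close>,
  \<open>m A = m B - m (B - A)\<close>, and \<open>- m (B - A)\<close> is at most the mass of
  \<open>B\<close> under the negative part. The supremum over \<open>A\<close> gives one inequality;
  the other is the same for \<open>- m\<close>.\<close>

lemma jordan_decomposition:
  fixes m :: "(real^'n) set \<Rightarrow> real"
  assumes m: "vector_measure m" and B: "B \<in> sets borel"
  shows "m B = measure (positive_part m) B - measure (negative_part m) B"
proof -
  have le: "measure (positive_part m) B \<le> measure (positive_part (\<lambda>A. - m A)) B + m B"
    if m: "vector_measure m" for m :: "(real^'n) set \<Rightarrow> real"
  proof -
    let ?N = "positive_part (\<lambda>A. - m A)"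
    interpret P: finite_measure "positive_part m" by (rule finite_positive_part[OF m])
    interpret N: finite_measure ?N by (rule finite_positive_part[OF vector_measure_uminus[OF m]])
    have *: "m A \<le> measure ?N B + m B" if A: "A \<in> sets borel" "A \<subseteq> B" for A
    proof -
      have "ennreal (- m (B - A)) \<le> emeasure ?N B"
        using A B by (subst emeasure_positive_part[OF vector_measure_uminus[OF m]])
          (auto intro: upper_var_upper[where m="\<lambda>A. - m A"])
      then have "- m (B - A) \<le> measure ?N B"
        by (simp add: N.emeasure_eq_measure)
      then show ?thesis using vector_measure_Diff[OF m A(1) B A(2)] by simp
    qed
    have "ennreal (measure (positive_part m) B) = upper_var m B"
      using emeasure_positive_part[OF m B] by (simp add: P.emeasure_eq_measure)
    also have "\<dots> \<le> ennreal (measure ?N B + m B)"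
      unfolding upper_var_def by (intro SUP_least ennreal_leI) (use * in auto)
    finally show ?thesis
      using *[of "{}"] vector_measure_empty[OF m] by simp
  qed
  show ?thesis
    using le[OF m] le[OF vector_measure_uminus[OF m]] by (simp add: negative_part_def)
qed

lemma finite_negative_part: "vector_measure m \<Longrightarrow> finite_measure (negative_part m)"
  unfolding negative_part_def by (intro finite_positive_part vector_measure_uminus)

lemma space_negative_part [simp]: "space (negative_part m) = UNIV"
  and sets_negative_part [simp, measurable_cong]: "sets (negative_part m) = sets borel"
  by (simp_all add: negative_part_def)

text \<open>The exceptional set is enclosed in one Borel set that is null for both parts of all
  components. By the Jordan decomposition \<nu> vanishes on each of its Borel subsets, so every
  partition sum in the total variation is 0 there.\<close>

lemma AE_total_variation:
  fixes \<nu> :: "(real^'n) set \<Rightarrow> real^'n"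
  assumes \<nu>: "vector_measure \<nu>"
    and P: "\<And>i. AE x in positive_part (\<lambda>A. \<nu> A $ i). P x"
    and N: "\<And>i. AE x in negative_part (\<lambda>A. \<nu> A $ i). P x"
  shows "AE x in total_variation \<nu>. P x"
proof -
  have "\<exists>B\<in>sets borel. {x. \<not> P x} \<subseteq> B \<and> emeasure (positive_part (\<lambda>A. \<nu> A $ i)) B = 0" for i
    using P[of i] by (auto simp: eventually_ae_filter null_sets_def)
  then obtain B where B: "\<And>i. B i \<in> sets borel" "\<And>i. {x. \<not> P x} \<subseteq> B i"
      "\<And>i. emeasure (positive_part (\<lambda>A. \<nu> A $ i)) (B i) = 0" by metis
  have "\<exists>C\<in>sets borel. {x. \<not> P x} \<subseteq> C \<and> emeasure (negative_part (\<lambda>A. \<nu> A $ i)) C = 0" for i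
    using N[of i] by (auto simp: eventually_ae_filter null_sets_def)
  then obtain C where C: "\<And>i. C i \<in> sets borel" "\<And>i. {x. \<not> P x} \<subseteq> C i"
      "\<And>i. emeasure (negative_part (\<lambda>A. \<nu> A $ i)) (C i) = 0" by metis
  define Z where "Z = (\<Inter>i\<in>UNIV. B i \<inter> C i)"
  have Z: "Z \<in> sets borel" "{x. \<not> P x} \<subseteq> Z"
    using B(1) C(1) subsetD[OF B(2)] subsetD[OF C(2)] by (auto simp: Z_def intro!: sets.finite_INT)
  have zero: "\<nu> E = 0" if E: "E \<in> sets borel" "E \<subseteq> Z" for E
  proof -
    have "\<nu> E $ i = 0" for i
    proof -
      have "emeasure (positive_part (\<lambda>A. \<nu> A $ i)) E = 0" "emeasure (negative_part (\<lambda>A. \<nu> A $ i)) E = 0"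
        using E(2) B(1)[of i] C(1)[of i] emeasure_eq_0[OF _ B(3)[of i], of E] emeasure_eq_0[OF _ C(3)[of i], of E]
        by (auto simp: Z_def)
      then show ?thesis
        using jordan_decomposition[OF vector_measure_component[OF \<nu>, of i] E(1)]
        by (simp add: measure_def)
    qed
    then show ?thesis by (simp add: vec_eq_iff)
  qed
  have "emeasure (total_variation \<nu>) Z = 0"
  proof -
    have "(SUP P\<in>{P::nat \<Rightarrow> (real^'n) set. range P \<subseteq> sets borel \<and> disjoint_family P \<and> (\<Union>i. P i) = Z}.
        \<Sum>i. ennreal (norm (\<nu> (P i)))) = 0"
    proof -
      have "(\<Sum>i. ennreal (norm (\<nu> (P i)))) = 0" if "range P \<subseteq> sets borel" "(\<Union>i. P i) = Z" for P :: "nat \<Rightarrow> (real^'n) set"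
      proof -
        have "\<nu> (P i) = 0" for i using that by (intro zero) auto
        then show ?thesis by simp
      qed
      then have "(SUP P\<in>{P::nat \<Rightarrow> (real^'n) set. range P \<subseteq> sets borel \<and> disjoint_family P \<and> (\<Union>i. P i) = Z}.
        \<Sum>i. ennreal (norm (\<nu> (P i)))) \<le> 0"
        by (intro SUP_least) (metis (mono_tags, lifting) mem_Collect_eq order_refl)
      then show ?thesis by (simp only: le_zero_eq)
    qed
    \<comment> \<open>\<open>emeasure_measure_of_conv\<close> yields the supremum or, failing
      countable additivity, the default 0; both are 0 at \<open>Z\<close>.\<close>
    then show ?thesis unfolding total_variation_def emeasure_measure_of_conv by simp
  qed
  moreover have "Z \<in> sets (total_variation \<nu>)"
    using Z by (simp add: total_variation_def sets_measure_of_conv)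
  ultimately show ?thesis
    using Z(2) by (intro AE_I[of _ _ Z]) auto
qed

section \<open>Gagliardo energy and the singular bilinear form\<close>

definition shift_diff :: "(real^'n \<Rightarrow> real) \<Rightarrow> real^'n \<Rightarrow> ennreal" where
  "shift_diff u h = (\<integral>\<^sup>+x. ennreal \<bar>u (x + h) - u x\<bar> \<partial>lborel)"

text \<open>The seminorm of \<open>W1_loc\<close> taken over the whole space, the double integral of
  \<open>\<bar>u y - u x\<bar> / norm (y - x) powr (n + \<alpha>)\<close>, written with the
  increment \<open>h = y - x\<close> as outer variable. This order suits translations and the
  comparison with the Besov seminorm.\<close>

definition gagliardo :: "real \<Rightarrow> (real^'n \<Rightarrow> real) \<Rightarrow> ennreal" where
  "gagliardo \<alpha> u = (\<integral>\<^sup>+h. ennreal (riesz_kernel \<alpha> h) * shift_diff u h \<partial>lborel)"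

lemma shift_diff_measurable [measurable]:
  assumes [measurable]: "u \<in> borel_measurable borel"
  shows "shift_diff u \<in> borel_measurable borel"
  unfolding shift_diff_def by measurable

lemma shift_diff_sum:
  assumes [measurable]: "\<And>j. j \<in> I \<Longrightarrow> \<psi> j \<in> borel_measurable borel"
    and "finite I" and "\<And>x y. \<bar>u x - u y\<bar> \<le> (\<Sum>j\<in>I. \<bar>\<psi> j x - \<psi> j y\<bar>)"
  shows "shift_diff u h \<le> (\<Sum>j\<in>I. shift_diff (\<psi> j) h)"
proof -
  have "shift_diff u h \<le> (\<integral>\<^sup>+x. (\<Sum>j\<in>I. ennreal \<bar>\<psi> j (x + h) - \<psi> j x\<bar>) \<partial>lborel)"
    unfolding shift_diff_def by (intro nn_integral_mono) (simp add: assms)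
  also have "\<dots> = (\<Sum>j\<in>I. shift_diff (\<psi> j) h)"
    unfolding shift_diff_def by (intro nn_integral_sum) measurable
  finally show ?thesis .
qed

text \<open>Subadditivity in the form needed for a truncated sum
  \<open>min 1 (\<Sum>j\<in>I. \<psi> j x)\<close>, whose increments are controlled by those of the
  summands although it is not itself a sum.\<close>

lemma gagliardo_sum:
  assumes [measurable]: "\<And>j. j \<in> I \<Longrightarrow> \<psi> j \<in> borel_measurable borel"
    and "finite I" and "\<And>x y. \<bar>u x - u y\<bar> \<le> (\<Sum>j\<in>I. \<bar>\<psi> j x - \<psi> j y\<bar>)"
  shows "gagliardo \<alpha> u \<le> (\<Sum>j\<in>I. gagliardo \<alpha> (\<psi> j))"
proof -
  have "gagliardo \<alpha> u \<le> (\<integral>\<^sup>+h. (\<Sum>j\<in>I. ennreal (riesz_kernel \<alpha> h) * shift_diff (\<psi> j) h) \<partial>lborel)"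
    unfolding gagliardo_def sum_distrib_left[symmetric]
    by (intro nn_integral_mono mult_left_mono shift_diff_sum assms) auto
  also have "\<dots> = (\<Sum>j\<in>I. gagliardo \<alpha> (\<psi> j))"
    unfolding gagliardo_def by (intro nn_integral_sum) measurable
  finally show ?thesis .
qed

lemma shift_diff_le_integral:
  assumes [measurable]: "u \<in> borel_measurable borel"
  shows "shift_diff u h \<le> 2 * (\<integral>\<^sup>+x. ennreal \<bar>u x\<bar> \<partial>lborel)"
proof -
  have "shift_diff u h \<le> (\<integral>\<^sup>+x. ennreal \<bar>u (x + h)\<bar> + ennreal \<bar>u x\<bar> \<partial>lborel)"
    unfolding shift_diff_def by (intro nn_integral_mono) (simp flip: ennreal_plus)
  also have "\<dots> = 2 * (\<integral>\<^sup>+x. ennreal \<bar>u x\<bar> \<partial>lborel)"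
    by (subst nn_integral_add) (simp_all add: nn_integral_lborel_shift[where f="\<lambda>x. ennreal \<bar>u x\<bar>"] mult_2)
  finally show ?thesis .
qed

text \<open>An increment is at most \<open>min (L * norm h) (2 * B)\<close> and can be nonzero only
  if \<open>x\<close> or \<open>x + h\<close> lies in the supporting ball, which accounts for twice
  its volume.\<close>

lemma shift_diff_lipschitz:
  fixes u :: "real^'n \<Rightarrow> real"
  assumes L: "\<And>x y. \<bar>u x - u y\<bar> \<le> L * norm (x - y)" and B: "\<And>x. \<bar>u x\<bar> \<le> B"
    and supp: "\<And>x. x \<notin> cball a \<rho> \<Longrightarrow> u x = 0" and \<rho>: "0 \<le> \<rho>"
  shows "shift_diff u h \<le> ennreal (2 * (unit_ball_vol (real CARD('n)) * \<rho> ^ CARD('n)) * min (L * norm h) (2 * B))"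
proof -
  let ?c = "min (L * norm h) (2 * B)" and ?V = "unit_ball_vol (real CARD('n)) * \<rho> ^ CARD('n)"
  have c: "\<bar>u (x + h) - u x\<bar> \<le> ?c" for x
    using L[of "x + h" x] B[of x] B[of "x + h"] by simp
  have c0: "0 \<le> ?c" using c[of 0] by linarith
  have "shift_diff u h \<le> (\<integral>\<^sup>+x. ennreal ?c * indicator (cball a \<rho>) (x + h) + ennreal ?c * indicator (cball a \<rho>) x \<partial>lborel)"
    unfolding shift_diff_def
  proof (intro nn_integral_mono)
    fix x
    consider "x \<in> cball a \<rho>" | "x + h \<in> cball a \<rho>" | "x \<notin> cball a \<rho>" "x + h \<notin> cball a \<rho>" by blast
    then show "ennreal \<bar>u (x + h) - u x\<bar> \<le> ennreal ?c * indicator (cball a \<rho>) (x + h) + ennreal ?c * indicator (cball a \<rho>) x"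
    proof cases
      case 1
      then show ?thesis using c[of x] by (auto intro!: add_increasing ennreal_leI simp del: mem_cball)
    next
      case 2
      then show ?thesis using c[of x] by (auto intro!: add_increasing2 ennreal_leI simp del: mem_cball)
    qed (simp add: supp del: mem_cball)
  qed
  also have "\<dots> = (\<integral>\<^sup>+x. ennreal ?c * indicator (cball a \<rho>) (x + h) \<partial>lborel) + (\<integral>\<^sup>+x. ennreal ?c * indicator (cball a \<rho>) x \<partial>lborel)"
    by (intro nn_integral_add) (auto intro!: borel_measurable_times_ennreal borel_measurable_indicator')
  also have "\<dots> = 2 * (\<integral>\<^sup>+x. ennreal ?c * indicator (cball a \<rho>) x \<partial>lborel)"
  proof -
    have "(\<integral>\<^sup>+x. ennreal ?c * indicator (cball a \<rho>) (x + h) \<partial>lborel) = (\<integral>\<^sup>+x. ennreal ?c * indicator (cball a \<rho>) x \<partial>lborel)"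
      by (rule nn_integral_lborel_shift) (auto intro!: borel_measurable_times_ennreal borel_measurable_indicator)
    then show ?thesis by (simp only: mult_2)
  qed
  also have "(\<integral>\<^sup>+x. ennreal ?c * indicator (cball a \<rho>) x \<partial>lborel) = ennreal ?c * emeasure lborel (cball a \<rho>)"
    by (intro nn_integral_cmult_indicator) auto
  also have "2 * (ennreal ?c * emeasure lborel (cball a \<rho>)) = ennreal (2 * ?V * ?c)"
    using c0 \<rho> by (simp add: emeasure_cball ennreal_mult'' ennreal_mult' mult_ac)
  finally show ?thesis .
qed

text \<open>The increments are split at size \<open>r\<close>. Below it the Lipschitz bound gains a
  factor \<open>norm h\<close> and turns the kernel into
  \<open>riesz_kernel (- (1 - \<alpha>))\<close>, integrable at the origin; above it the bound
  \<open>2 * B\<close> meets the integrable tail. The radius \<open>r\<close> stays free, to be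
  matched to the scale of \<open>u\<close>.\<close>

lemma gagliardo_lipschitz:
  assumes \<alpha>: "0 < \<alpha>" "\<alpha> < 1"
  obtains C where "0 < C" "\<And>(u :: real^'n \<Rightarrow> real) L B a \<rho> r.
      \<lbrakk>\<And>x y. \<bar>u x - u y\<bar> \<le> L * norm (x - y); \<And>x. \<bar>u x\<bar> \<le> B; \<And>x. x \<notin> cball a \<rho> \<Longrightarrow> u x = 0; 0 \<le> \<rho>; 0 < r\<rbrakk>
      \<Longrightarrow> gagliardo \<alpha> u \<le> ennreal (C * \<rho> ^ CARD('n) * (L * r powr (1 - \<alpha>) + B * r powr (- \<alpha>)))"
proof -
  obtain C1 where C1: "0 < C1" "\<And>r. 0 < r \<Longrightarrow>
    (\<integral>\<^sup>+h. ennreal (riesz_kernel \<alpha> (h::real^'n)) * indicator (- ball 0 r) h \<partial>lborel) \<le> ennreal (C1 * r powr (- \<alpha>))"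
    using riesz_kernel_far[OF \<alpha>(1)] by blast
  obtain C2 where C2: "0 < C2" "\<And>r. 0 < r \<Longrightarrow>
    (\<integral>\<^sup>+h. ennreal (riesz_kernel (- (1 - \<alpha>)) (h::real^'n)) * indicator (ball 0 r) h \<partial>lborel) \<le> ennreal (C2 * r powr (1 - \<alpha>))"
    using riesz_kernel_near[of "1 - \<alpha>"] \<alpha> by auto
  define \<omega> where "\<omega> = unit_ball_vol (real CARD('n))"
  have \<omega>: "0 < \<omega>" by (simp add: \<omega>_def)
  define C where "C = 2 * \<omega> * C2 + 4 * \<omega> * C1"
  have "gagliardo \<alpha> u \<le> ennreal (C * \<rho> ^ CARD('n) * (L * r powr (1 - \<alpha>) + B * r powr (- \<alpha>)))"
    if L: "\<And>x y. \<bar>u x - u y\<bar> \<le> L * norm (x - y)" and B: "\<And>x. \<bar>u x\<bar> \<le> B"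
      and supp: "\<And>x. x \<notin> cball a \<rho> \<Longrightarrow> u x = 0" and \<rho>: "0 \<le> \<rho>" and r: "0 < r"
    for u :: "real^'n \<Rightarrow> real" and L B a \<rho> r
  proof -
    have B0: "0 \<le> B" using B[of 0] by linarith
    \<comment> \<open>Nonnegativity of \<open>L\<close> is read off from one unit increment;
      \<open>undefined\<close> is just some coordinate index.\<close>
    have "0 \<le> L * norm (axis undefined 1 - (0::real^'n))" using L[of "axis undefined 1" 0] by linarith
    then have L0: "0 \<le> L" by (simp add: norm_axis_1)
    let ?V = "\<omega> * \<rho> ^ CARD('n)"
    have V: "0 \<le> ?V" using \<omega> \<rho> by simp
    have pt: "ennreal (riesz_kernel \<alpha> h) * shift_diff u h \<le>
        ennreal (2 * ?V * L) * (ennreal (riesz_kernel (- (1 - \<alpha>)) h) * indicator (ball 0 r) h)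
        + ennreal (4 * ?V * B) * (ennreal (riesz_kernel \<alpha> h) * indicator (- ball 0 r) h)" for h
    proof -
      have sd: "shift_diff u h \<le> ennreal (2 * ?V * min (L * norm h) (2 * B))"
        unfolding \<omega>_def by (rule shift_diff_lipschitz[of u L B a \<rho>, OF L B supp \<rho>])
      show ?thesis
      proof (cases "h \<in> ball 0 r")
        case True
        have "ennreal (riesz_kernel \<alpha> h) * shift_diff u h \<le> ennreal (riesz_kernel \<alpha> h) * ennreal (2 * ?V * (L * norm h))"
          by (intro mult_left_mono order_trans[OF sd] ennreal_leI) (use V in auto)
        also have "\<dots> = ennreal (riesz_kernel \<alpha> h * (2 * ?V * (L * norm h)))"
          by (rule ennreal_mult'[symmetric]) simp
        also have "riesz_kernel \<alpha> h * (2 * ?V * (L * norm h)) = (2 * ?V * L) * riesz_kernel (- (1 - \<alpha>)) h"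
          by (cases "h = 0") (auto simp: riesz_kernel_def powr_add powr_minus powr_diff field_simps)
        also have "ennreal \<dots> = ennreal (2 * ?V * L) * ennreal (riesz_kernel (- (1 - \<alpha>)) h)"
          by (simp add: ennreal_mult'')
        finally show ?thesis using True by simp
      next
        case False
        have "ennreal (riesz_kernel \<alpha> h) * shift_diff u h \<le> ennreal (riesz_kernel \<alpha> h) * ennreal (2 * ?V * (2 * B))"
          by (intro mult_left_mono order_trans[OF sd] ennreal_leI) (use V in auto)
        also have "\<dots> = ennreal (4 * ?V * B) * ennreal (riesz_kernel \<alpha> h)"
          by (simp add: ennreal_mult''[symmetric] mult_ac)
        finally show ?thesis using False by simp
      qed
    qed
    have "gagliardo \<alpha> u \<le> (\<integral>\<^sup>+h. ennreal (2 * ?V * L) * (ennreal (riesz_kernel (- (1 - \<alpha>)) h) * indicator (ball 0 r) h)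
        + ennreal (4 * ?V * B) * (ennreal (riesz_kernel \<alpha> h) * indicator (- ball 0 r) h) \<partial>(lborel :: (real^'n) measure))"
      unfolding gagliardo_def by (intro nn_integral_mono pt)
    also have "\<dots> = (\<integral>\<^sup>+h. ennreal (2 * ?V * L) * (ennreal (riesz_kernel (- (1 - \<alpha>)) h) * indicator (ball 0 r) h) \<partial>(lborel :: (real^'n) measure))
        + (\<integral>\<^sup>+h. ennreal (4 * ?V * B) * (ennreal (riesz_kernel \<alpha> h) * indicator (- ball 0 r) h) \<partial>(lborel :: (real^'n) measure))"
      by (intro nn_integral_add) (auto intro!: borel_measurable_times_ennreal borel_measurable_indicator measurable_compose[OF riesz_kernel_measurable] simp: comp_def)
    also have "\<dots> = ennreal (2 * ?V * L) * (\<integral>\<^sup>+h. (ennreal (riesz_kernel (- (1 - \<alpha>)) h) * indicator (ball 0 r) h) \<partial>(lborel :: (real^'n) measure))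
        + ennreal (4 * ?V * B) * (\<integral>\<^sup>+h. (ennreal (riesz_kernel \<alpha> h) * indicator (- ball 0 r) h) \<partial>(lborel :: (real^'n) measure))"
      by (intro arg_cong2[where f="(+)"] nn_integral_cmult borel_measurable_times_ennreal borel_measurable_indicator)
         (auto intro!: borel_measurable_indicator)
    also have "\<dots> \<le> ennreal (2 * ?V * L) * ennreal (C2 * r powr (1 - \<alpha>)) + ennreal (4 * ?V * B) * ennreal (C1 * r powr (- \<alpha>))"
      by (intro add_mono mult_left_mono C1 C2 r) auto
    also have "\<dots> = ennreal (2 * ?V * L * (C2 * r powr (1 - \<alpha>)) + 4 * ?V * B * (C1 * r powr (- \<alpha>)))"
      using V L0 B0 C1(1) C2(1) by (simp add: ennreal_mult'[symmetric] ennreal_plus[symmetric] del: ennreal_plus)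
    \<comment> \<open>\<open>C\<close> is the sum of the constants of both halves; the cross terms
      \<open>?X\<close> and \<open>?Y\<close> are a nonnegative surplus.\<close>
    also have "\<dots> \<le> ennreal (C * \<rho> ^ CARD('n) * (L * r powr (1 - \<alpha>) + B * r powr (- \<alpha>)))"
    proof (rule ennreal_leI)
      let ?X = "\<rho> ^ CARD('n) * (L * r powr (1 - \<alpha>))" and ?Y = "\<rho> ^ CARD('n) * (B * r powr (- \<alpha>))"
      have "0 \<le> 4 * \<omega> * C1 * ?X" "0 \<le> 2 * \<omega> * C2 * ?Y"
        using \<omega> C1(1) C2(1) \<rho> L0 B0 by auto
      moreover have "C * \<rho> ^ CARD('n) * (L * r powr (1 - \<alpha>) + B * r powr (- \<alpha>)) =
         2 * ?V * L * (C2 * r powr (1 - \<alpha>)) + 4 * ?V * B * (C1 * r powr (- \<alpha>)) + 4 * \<omega> * C1 * ?X + 2 * \<omega> * C2 * ?Y"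
        by (simp add: C_def algebra_simps)
      ultimately show "2 * ?V * L * (C2 * r powr (1 - \<alpha>)) + 4 * ?V * B * (C1 * r powr (- \<alpha>))
         \<le> C * \<rho> ^ CARD('n) * (L * r powr (1 - \<alpha>) + B * r powr (- \<alpha>))" by linarith
    qed
    finally show ?thesis .
  qed
  moreover have "0 < C" using \<omega> C1 C2 by (simp add: C_def add_pos_pos)
  ultimately show ?thesis using that by blast
qed

section \<open>Energy and bilinear form as integrals over pairs of a point and an increment\<close>

lemma gagliardo_eq_pair:
  assumes [measurable]: "u \<in> borel_measurable borel"
  shows "gagliardo \<alpha> u = (\<integral>\<^sup>+z. ennreal (riesz_kernel \<alpha> (snd z) * \<bar>u (fst z + snd z) - u (fst z)\<bar>) \<partial>(lborel \<Otimes>\<^sub>M lborel))"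
proof -
  have "gagliardo \<alpha> u = (\<integral>\<^sup>+h. (\<integral>\<^sup>+x. ennreal (riesz_kernel \<alpha> h * \<bar>u (x + h) - u x\<bar>) \<partial>lborel) \<partial>lborel)"
    unfolding gagliardo_def shift_diff_def
    by (simp add: nn_integral_cmult[symmetric] ennreal_mult')
  also have "\<dots> = (\<integral>\<^sup>+z. ennreal (riesz_kernel \<alpha> (snd z) * \<bar>u (fst z + snd z) - u (fst z)\<bar>) \<partial>(lborel \<Otimes>\<^sub>M lborel))"
    by (subst lborel_pair.nn_integral_snd[symmetric]) auto
  finally show ?thesis .
qed

definition grad_kernel :: "real \<Rightarrow> 'n \<Rightarrow> real^'n \<Rightarrow> real" where
  "grad_kernel \<alpha> i h = h $ i * norm h powr (- (real CARD('n) + \<alpha> + 1))"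

lemma grad_kernel_measurable [measurable]: "grad_kernel \<alpha> i \<in> borel_measurable borel"
  unfolding grad_kernel_def by measurable

lemma grad_kernel_minus [simp]: "grad_kernel \<alpha> i (- h) = - grad_kernel \<alpha> i h"
  by (simp add: grad_kernel_def)

lemma abs_grad_kernel_le: "\<bar>grad_kernel \<alpha> i h\<bar> \<le> riesz_kernel \<alpha> h"
proof (cases "h = 0")
  case False
  have "\<bar>grad_kernel \<alpha> i h\<bar> \<le> norm h * norm h powr (- (real CARD('a) + \<alpha> + 1))"
    unfolding grad_kernel_def abs_mult by (intro mult_mono component_le_norm_cart) auto
  also have "\<dots> = riesz_kernel \<alpha> h"
    using False powr_add[of "norm h" 1 "- (real CARD('a) + \<alpha> + 1)"] by (simp add: riesz_kernel_def)
  finally show ?thesis .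
qed (simp add: grad_kernel_def)

text \<open>The weight is evaluated at the pair of \<open>x = fst z\<close> and
  \<open>h = snd z\<close>. It depends on pairs, rather than on \<open>x\<close> alone, because the
  product rule produces weights such as \<open>f x * g (x + h)\<close>.\<close>

definition riesz_form :: "real \<Rightarrow> 'n \<Rightarrow> ((real^'n) \<times> (real^'n) \<Rightarrow> real) \<Rightarrow> (real^'n \<Rightarrow> real) \<Rightarrow> real" where
  "riesz_form \<alpha> i w u = (LINT z|(lborel \<Otimes>\<^sub>M lborel). w z * (grad_kernel \<alpha> i (snd z) * (u (fst z + snd z) - u (fst z))))"

lemma riesz_form_integrable:
  assumes [measurable]: "u \<in> borel_measurable borel" "w \<in> borel_measurable (borel \<Otimes>\<^sub>M borel)"
    and w: "\<And>z. \<bar>w z\<bar> \<le> B" and fin: "gagliardo \<alpha> u < \<infinity>"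
  shows "integrable (lborel \<Otimes>\<^sub>M lborel) (\<lambda>z. w z * (grad_kernel \<alpha> i (snd z) * (u (fst z + snd z) - u (fst z))))"
proof (rule Bochner_Integration.integrable_bound)
  show "integrable (lborel \<Otimes>\<^sub>M lborel) (\<lambda>z. B * (riesz_kernel \<alpha> (snd z) * \<bar>u (fst z + snd z) - u (fst z)\<bar>))"
    using fin unfolding gagliardo_eq_pair[OF assms(1)]
    by (intro integrable_mult_right integrableI_bounded) (auto simp: abs_mult)
  show "AE z in lborel \<Otimes>\<^sub>M lborel. norm (w z * (grad_kernel \<alpha> i (snd z) * (u (fst z + snd z) - u (fst z))))
     \<le> norm (B * (riesz_kernel \<alpha> (snd z) * \<bar>u (fst z + snd z) - u (fst z)\<bar>))"
  proof (rule AE_I2)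
    fix z
    have "0 \<le> B" using w[of z] by linarith
    then have "\<bar>w z\<bar> * (\<bar>grad_kernel \<alpha> i (snd z)\<bar> * \<bar>u (fst z + snd z) - u (fst z)\<bar>)
        \<le> B * (riesz_kernel \<alpha> (snd z) * \<bar>u (fst z + snd z) - u (fst z)\<bar>)"
      by (intro mult_mono w abs_grad_kernel_le) auto
    then show "norm (w z * (grad_kernel \<alpha> i (snd z) * (u (fst z + snd z) - u (fst z))))
     \<le> norm (B * (riesz_kernel \<alpha> (snd z) * \<bar>u (fst z + snd z) - u (fst z)\<bar>))"
      using \<open>0 \<le> B\<close> by (simp add: abs_mult)
  qed
qed measurable

text \<open>For a bounded weight the kernel bound makes the form continuous in \<open>u\<close> with
  respect to the energy. The covering argument and the mollification limit both rest on this
  estimate.\<close>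

lemma riesz_form_bound:
  assumes [measurable]: "u \<in> borel_measurable borel" "w \<in> borel_measurable (borel \<Otimes>\<^sub>M borel)"
    and w: "\<And>z. \<bar>w z\<bar> \<le> B" and E: "gagliardo \<alpha> u \<le> ennreal E" "0 \<le> E"
  shows "\<bar>riesz_form \<alpha> i w u\<bar> \<le> B * E"
proof -
  have B: "0 \<le> B" using w[of undefined] by linarith
  have fin: "gagliardo \<alpha> u < \<infinity>" using E by (auto simp: le_less_trans)
  let ?F = "\<lambda>z. w z * (grad_kernel \<alpha> i (snd z) * (u (fst z + snd z) - u (fst z)))"
  have "ennreal \<bar>riesz_form \<alpha> i w u\<bar> \<le> (\<integral>\<^sup>+z. ennreal \<bar>?F z\<bar> \<partial>(lborel \<Otimes>\<^sub>M lborel))"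
    unfolding riesz_form_def
    using integral_norm_bound_ennreal[OF riesz_form_integrable[OF assms(1,2) w fin]] by simp
  also have "\<dots> \<le> (\<integral>\<^sup>+z. ennreal B * ennreal (riesz_kernel \<alpha> (snd z) * \<bar>u (fst z + snd z) - u (fst z)\<bar>) \<partial>(lborel \<Otimes>\<^sub>M lborel))"
  proof (intro nn_integral_mono)
    fix z
    have "\<bar>w z\<bar> * (\<bar>grad_kernel \<alpha> i (snd z)\<bar> * \<bar>u (fst z + snd z) - u (fst z)\<bar>)
        \<le> B * (riesz_kernel \<alpha> (snd z) * \<bar>u (fst z + snd z) - u (fst z)\<bar>)"
      using B by (intro mult_mono w abs_grad_kernel_le) auto
    then show "ennreal \<bar>?F z\<bar> \<le> ennreal B * ennreal (riesz_kernel \<alpha> (snd z) * \<bar>u (fst z + snd z) - u (fst z)\<bar>)"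
      using B by (simp add: abs_mult ennreal_mult'[symmetric] ennreal_leI)
  qed
  also have "\<dots> = ennreal B * gagliardo \<alpha> u"
    unfolding gagliardo_eq_pair[OF assms(1)] by (intro nn_integral_cmult) measurable
  also have "\<dots> \<le> ennreal (B * E)"
    using B E by (simp add: ennreal_mult' mult_left_mono)
  finally show ?thesis using B E by (simp add: ennreal_le_iff)
qed

text \<open>For a field along one axis only one component of \<open>y - x\<close> survives in the
  scalar product, and the substitution \<open>h = y - x\<close> turns the quotient into
  \<open>grad_kernel\<close>.\<close>

lemma frac_div_axis:
  assumes [measurable]: "u \<in> borel_measurable borel"
  shows "frac_div \<alpha> (\<lambda>x. u x *\<^sub>R axis i 1) (x::real^'n) =
    frac_const CARD('n) \<alpha> * (LINT h|lborel. grad_kernel \<alpha> i h * (u (x + h) - u x))"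
proof -
  have "(LINT h|lborel. grad_kernel \<alpha> i h * (u (x + h) - u x))
     = (LINT y|lborel. grad_kernel \<alpha> i (y - x) * (u y - u x))"
    using integral_lborel_shift[of "\<lambda>h. grad_kernel \<alpha> i h * (u (x + h) - u x)" "- x"]
    by simp
  also have "\<dots> = (LINT y|lebesgue. grad_kernel \<alpha> i (y - x) * (u y - u x))"
    by (rule integral_completion[symmetric]) measurable
  also have "\<dots> = (LINT y|lebesgue. ((y - x) \<bullet> (u y *\<^sub>R axis i 1 - u x *\<^sub>R axis i 1)) / norm (y - x) powr (real CARD('n) + \<alpha> + 1))"
  proof (intro Bochner_Integration.integral_cong refl)
    fix y
    have "norm (y - x) powr (- (real CARD('n) + \<alpha> + 1)) = 1 / norm (y - x) powr (real CARD('n) + \<alpha> + 1)"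
      by (rule powr_minus_divide)
    moreover have "(y - x) \<bullet> (u y *\<^sub>R axis i 1 - u x *\<^sub>R axis i 1) = (y - x) $ i * (u y - u x)"
      unfolding scaleR_diff_left[symmetric] by (simp add: inner_axis)
    ultimately show "grad_kernel \<alpha> i (y - x) * (u y - u x) =
        ((y - x) \<bullet> (u y *\<^sub>R axis i 1 - u x *\<^sub>R axis i 1)) / norm (y - x) powr (real CARD('n) + \<alpha> + 1)"
      unfolding grad_kernel_def by simp
  qed
  finally show ?thesis by (simp add: frac_div_def)
qed

lemma integral_frac_div_axis:
  fixes f u :: "real^'n \<Rightarrow> real"
  assumes [measurable]: "f \<in> borel_measurable borel" "u \<in> borel_measurable borel"
    and f: "\<And>x. \<bar>f x\<bar> \<le> B" and fin: "gagliardo \<alpha> u < \<infinity>"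
  shows "(LINT x|lborel. f x * frac_div \<alpha> (\<lambda>x. u x *\<^sub>R axis i 1) x)
    = frac_const CARD('n) \<alpha> * riesz_form \<alpha> i (\<lambda>z. f (fst z)) u"
proof -
  have "riesz_form \<alpha> i (\<lambda>z. f (fst z)) u = (LINT x|lborel. (LINT h|lborel. f x * (grad_kernel \<alpha> i h * (u (x + h) - u x))))"
    unfolding riesz_form_def
    by (subst lborel_pair.integral_fst'[symmetric]) (use riesz_form_integrable[of u "\<lambda>z. f (fst z)" B] f fin in auto)
  then show ?thesis
    by (simp add: frac_div_axis mult.left_commute[of _ "frac_const CARD('n) \<alpha>"])
qed

section \<open>Upper density of the fractional variation\<close>

text \<open>One index governs both the constant and the range of radii. The sets for all
  \<open>M\<close> thus exhaust, countably, the points where ball masses are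
  \<open>O(r powr s)\<close>, while on each of them the bound is uniform.\<close>

definition density_le :: "real \<Rightarrow> (real^'n) measure \<Rightarrow> nat \<Rightarrow> (real^'n) set" where
  "density_le s \<kappa> M = {x. \<forall>r. 0 < r \<longrightarrow> r < 1 / real (Suc M) \<longrightarrow> emeasure \<kappa> (ball x r) \<le> ennreal (real M * r powr s)}"

text \<open>By continuity from below some slightly smaller ball still has mass above
  \<open>c\<close>, and it stays inside every ball of radius \<open>r\<close> with a nearby centre.
  This makes \<open>density_le\<close> closed.\<close>

lemma open_emeasure_ball_greater:
  fixes \<kappa> :: "(real^'n) measure"
  assumes sets: "sets \<kappa> = sets borel"
  shows "open {x. c < emeasure \<kappa> (ball x r)}"
proof (subst open_contains_ball, safe)
  fix x assume x: "c < emeasure \<kappa> (ball x r)"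
  have "(SUP j. emeasure \<kappa> (ball x (r - 1 / real (Suc j)))) = emeasure \<kappa> (\<Union>j. ball x (r - 1 / real (Suc j)))"
    by (rule SUP_emeasure_incseq) (auto simp: sets incseq_def frac_le intro!: subset_ball)
  also have "(\<Union>j. ball x (r - 1 / real (Suc j))) = ball x r"
  proof (intro equalityI subsetI)
    fix y assume "y \<in> ball x r"
    then obtain j where "inverse (real (Suc j)) < r - dist x y"
      using reals_Archimedean[of "r - dist x y"] by auto
    then show "y \<in> (\<Union>j. ball x (r - 1 / real (Suc j)))"
      by (auto simp: inverse_eq_divide intro!: exI[of _ j])
  next
    fix y assume "y \<in> (\<Union>j. ball x (r - 1 / real (Suc j)))"
    then obtain j where "dist x y < r - 1 / real (Suc j)" by auto
    moreover have "0 < 1 / real (Suc j)" by simp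
    ultimately show "y \<in> ball x r" unfolding mem_ball by linarith
  qed
  finally obtain j where j: "c < emeasure \<kappa> (ball x (r - 1 / real (Suc j)))"
    using x by (metis (mono_tags, lifting) less_SUP_iff)
  show "\<exists>e>0. ball x e \<subseteq> {x. c < emeasure \<kappa> (ball x r)}"
  proof (intro exI conjI subsetI)
    fix y assume y: "y \<in> ball x (1 / real (Suc j))"
    have "ball x (r - 1 / real (Suc j)) \<subseteq> ball y r"
    proof
      fix z assume "z \<in> ball x (r - 1 / real (Suc j))"
      then show "z \<in> ball y r" using y dist_triangle[of y z x] by (simp add: dist_commute)
    qed
    then have "emeasure \<kappa> (ball x (r - 1 / real (Suc j))) \<le> emeasure \<kappa> (ball y r)"
      by (intro emeasure_mono) (auto simp: sets)
    with j show "y \<in> {x. c < emeasure \<kappa> (ball x r)}" by simp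
  qed simp
qed

lemma density_le_borel:
  assumes sets: "sets \<kappa> = sets borel"
  shows "density_le s \<kappa> M \<in> sets borel"
proof -
  have "- density_le s \<kappa> M = (\<Union>r\<in>{0<..<1 / real (Suc M)}. {x. ennreal (real M * r powr s) < emeasure \<kappa> (ball x r)})"
    by (auto simp: density_le_def not_le)
  then have "open (- density_le s \<kappa> M)"
    by (simp only:) (intro open_UN ballI open_emeasure_ball_greater[OF sets])
  then show ?thesis by (metis borel_closed closed_def)
qed

section \<open>Lipschitz cutoffs of balls\<close>

definition cutoff :: "real^'n \<Rightarrow> real \<Rightarrow> real^'n \<Rightarrow> real" where
  "cutoff a r y = max 0 (min 1 (2 - dist a y / r))"

lemma cutoff_bounds: "0 \<le> cutoff a r y" "cutoff a r y \<le> 1"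
  by (auto simp: cutoff_def)

lemma cutoff_eq_1: "0 < r \<Longrightarrow> y \<in> cball a r \<Longrightarrow> cutoff a r y = 1"
  by (auto simp: cutoff_def field_simps)

lemma cutoff_eq_0: "0 < r \<Longrightarrow> y \<notin> cball a (2 * r) \<Longrightarrow> cutoff a r y = 0"
  by (auto simp: cutoff_def field_simps)

lemma cutoff_lipschitz: "0 < r \<Longrightarrow> \<bar>cutoff a r x - cutoff a r y\<bar> \<le> (1 / r) * norm (x - y)"
proof -
  assume r: "0 < r"
  have "\<bar>cutoff a r x - cutoff a r y\<bar> \<le> \<bar>(2 - dist a x / r) - (2 - dist a y / r)\<bar>"
    unfolding cutoff_def by linarith
  also have "\<dots> = \<bar>dist a y - dist a x\<bar> / r"
    using r by (simp add: diff_divide_distrib[symmetric] abs_divide)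
  also have "\<dots> \<le> norm (x - y) / r"
    using r abs_dist_diff_le[of a y x] dist_triangle[of a x y] dist_triangle[of a y x]
    by (intro divide_right_mono) (auto simp: dist_norm norm_minus_commute)
  finally show ?thesis by simp
qed

lemma cutoff_measurable [measurable]: "cutoff a r \<in> borel_measurable borel"
  unfolding cutoff_def[abs_def] by measurable

text \<open>With slope \<open>1 / r\<close>, splitting the increments at the same \<open>r\<close>
  balances both terms at \<open>r powr (- \<alpha>)\<close>; the support contributes
  \<open>(2 * r) ^ CARD('n)\<close>.\<close>

lemma gagliardo_cutoff:
  assumes \<alpha>: "0 < \<alpha>" "\<alpha> < 1"
  obtains C where "0 < C" "\<And>(a::real^'n) r. 0 < r \<Longrightarrow> gagliardo \<alpha> (cutoff a r) \<le> ennreal (C * r powr (real CARD('n) - \<alpha>))"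
proof -
  obtain C where C: "0 < C" and le: "\<And>(u :: real^'n \<Rightarrow> real) L B a \<rho> r.
      \<lbrakk>\<And>x y. \<bar>u x - u y\<bar> \<le> L * norm (x - y); \<And>x. \<bar>u x\<bar> \<le> B; \<And>x. x \<notin> cball a \<rho> \<Longrightarrow> u x = 0; 0 \<le> \<rho>; 0 < r\<rbrakk>
      \<Longrightarrow> gagliardo \<alpha> u \<le> ennreal (C * \<rho> ^ CARD('n) * (L * r powr (1 - \<alpha>) + B * r powr (- \<alpha>)))"
    using gagliardo_lipschitz[OF \<alpha>, where ?'n='n] by blast
  have "gagliardo \<alpha> (cutoff a r) \<le> ennreal (C * 2 ^ CARD('n) * 2 * r powr (real CARD('n) - \<alpha>))"
    if r: "0 < r" for a :: "real^'n" and r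
  proof -
    have "gagliardo \<alpha> (cutoff a r) \<le> ennreal (C * (2 * r) ^ CARD('n) * ((1 / r) * r powr (1 - \<alpha>) + 1 * r powr (- \<alpha>)))"
    proof (rule le[where a=a])
      show "\<bar>cutoff a r x - cutoff a r y\<bar> \<le> 1 / r * norm (x - y)" for x y by (rule cutoff_lipschitz[OF r])
      show "\<bar>cutoff a r x\<bar> \<le> 1" for x using cutoff_bounds[of a r x] by simp
      show "cutoff a r x = 0" if "x \<notin> cball a (2 * r)" for x using cutoff_eq_0[OF r that] .
    qed (use r in auto)
    also have "C * (2 * r) ^ CARD('n) * ((1 / r) * r powr (1 - \<alpha>) + 1 * r powr (- \<alpha>))
       = C * 2 ^ CARD('n) * 2 * (r powr (real CARD('n)) * r powr (- \<alpha>))"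
      using r by (simp add: powr_diff powr_minus powr_realpow power_mult_distrib field_simps)
    also have "r powr (real CARD('n)) * r powr (- \<alpha>) = r powr (real CARD('n) - \<alpha>)"
      by (simp flip: powr_add)
    finally show ?thesis .
  qed
  then show ?thesis using C by (intro that[of "C * 2 ^ CARD('n) * 2"]) auto
qed

text \<open>A set of infinite upper density carrying positive mass would, by the Vitali covering lemma, be
  covered by balls whose cutoff functions have arbitrarily small total energy.\<close>

lemma positive_part_density_le:
  fixes m :: "(real^'n) set \<Rightarrow> real"
  assumes \<alpha>: "0 < \<alpha>" "\<alpha> < 1" and m: "vector_measure m" and C: "0 \<le> C"
    and test: "\<And>\<psi> L E. L-lipschitz_on UNIV \<psi> \<Longrightarrow> compact_support \<psi> \<Longrightarrow>
        gagliardo \<alpha> \<psi> \<le> ennreal E \<Longrightarrow> 0 \<le> E \<Longrightarrow> \<bar>signed_integral m \<psi>\<bar> \<le> C * E"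
  shows "AE x in positive_part m. \<exists>M. x \<in> density_le (real CARD('n) - \<alpha>) (positive_part m) M"
proof -
  let ?s = "real CARD('n) - \<alpha>"
  let ?P = "positive_part m" and ?N = "negative_part m"
  interpret P: finite_measure ?P by (rule finite_positive_part[OF m])
  interpret N: finite_measure ?N by (rule finite_negative_part[OF m])
  obtain C0 where C0: "0 < C0" "\<And>(a::real^'n) r. 0 < r \<Longrightarrow> gagliardo \<alpha> (cutoff a r) \<le> ennreal (C0 * r powr ?s)"
    using gagliardo_cutoff[OF \<alpha>] by blast
  define Z where "Z = - (\<Union>M. density_le ?s ?P M)"
  have Z: "Z \<in> sets borel"
    unfolding Z_def by (intro borel_comp sets.countable_UN) (auto intro!: density_le_borel)
  have "emeasure ?P Z = 0"
  proof (rule ccontr)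
    assume "emeasure ?P Z \<noteq> 0"
    then have "0 < upper_var m Z" by (simp add: emeasure_positive_part[OF m Z] zero_less_iff_neq_zero)
    \<comment> \<open>Only \<open>m\<close> can be tested with functions, so a subset is taken on
      which \<open>m\<close> itself, and not merely its positive part, is positive.\<close>
    then obtain A where A: "A \<in> sets borel" "A \<subseteq> Z" "0 < m A"
      unfolding upper_var_def less_SUP_iff by auto
    have mP: "m B \<le> measure ?P B" if "B \<in> sets borel" for B
      using jordan_decomposition[OF m that] by simp
    \<comment> \<open>The loss in the positive part also bounds \<open>m (A - K)\<close>, so more
      than half of \<open>m A\<close> remains in \<open>m K\<close>.\<close>
    obtain K where K: "K \<subseteq> A" "compact K" "measure ?P A - m A / 2 < measure ?P K"
    proof -
      have "ennreal (measure ?P A - m A / 2) < emeasure ?P A"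
        using A mP[OF A(1)] by (simp add: P.emeasure_eq_measure ennreal_less_iff)
      also have "emeasure ?P A = (SUP K \<in> {K. K \<subseteq> A \<and> compact K}. emeasure ?P K)"
        by (rule inner_regular) (use A in auto)
      finally show ?thesis
        using that A mP[OF A(1)] by (auto simp: less_SUP_iff P.emeasure_eq_measure ennreal_less_iff)
    qed
    have Kb: "K \<in> sets borel" using K(2) by (rule borel_compact)
    define c where "c = m K"
    have c: "0 < c"
    proof -
      have "m (A - K) = m A - m K" using A Kb K by (intro vector_measure_Diff m)
      moreover have "measure ?P (A - K) = measure ?P A - measure ?P K"
        using A Kb K by (intro P.finite_measure_Diff) auto
      ultimately show ?thesis using mP[of "A - K"] A Kb K(3) by (simp add: c_def)
    qed
    have c_eq: "c = measure ?P K - measure ?N K"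
      unfolding c_def by (rule jordan_decomposition[OF m Kb])
    \<comment> \<open>\<open>U\<close> carries less than \<open>c / 2\<close> negative mass beyond
      that of \<open>K\<close>, so a function with values in \<open>[0, 1]\<close> that is 1 on
      \<open>K\<close> and vanishes off \<open>U\<close> still has signed integral at least
      \<open>c / 2\<close>.\<close>
    obtain U where U: "K \<subseteq> U" "open U" "measure ?N U < measure ?N K + c / 2"
    proof -
      have "(INF U \<in> {U. K \<subseteq> U \<and> open U}. emeasure ?N U) = emeasure ?N K"
        by (rule outer_regular[symmetric]) (use Kb in auto)
      also have "\<dots> < ennreal (measure ?N K + c / 2)"
        using c by (simp add: N.emeasure_eq_measure ennreal_less_iff)
      finally show ?thesis
        using that c by (auto simp: INF_less_iff N.emeasure_eq_measure ennreal_less_iff simp del: ennreal_plus)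
    qed
    obtain d where d: "0 < d" "(\<Union>x\<in>K. ball x d) \<subseteq> U"
      using compact_subset_open_imp_ball_epsilon_subset[OF K(2) U(2,1)] by metis
    \<comment> \<open>The condition on \<open>M\<close> gives \<open>10 * r i < d\<close> for radii
      below \<open>1 / real (Suc M)\<close>: a cutoff of radius \<open>5 * r i\<close> lives in the
      ball of radius \<open>10 * r i\<close>, hence in \<open>U\<close>.\<close>
    have bound: "c / 2 * real M \<le> C * (C0 * 5 powr ?s * measure ?P UNIV)" if M: "1 / d * 10 < real M" for M :: nat
    proof -
      have M0: "0 < real M" using M d by (meson divide_pos_pos less_trans mult_pos_pos zero_less_numeral zero_less_one)
      have dM: "10 / real (Suc M) \<le> d"
        using M d M0 by (simp add: field_simps)
      have "\<exists>r. 0 < r \<and> r < 1 / real (Suc M) \<and> ennreal (real M * r powr ?s) < emeasure ?P (ball x r)" if "x \<in> K" for x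
        using that K(1) A(2) by (auto simp: Z_def density_le_def not_le)
      then obtain r where r: "\<And>x. x \<in> K \<Longrightarrow> 0 < r x" "\<And>x. x \<in> K \<Longrightarrow> r x < 1 / real (Suc M)"
        "\<And>x. x \<in> K \<Longrightarrow> ennreal (real M * r x powr ?s) < emeasure ?P (ball x (r x))" by metis
      \<comment> \<open>The disjoint balls carry the mass estimate and their fivefold enlargements
        cover \<open>K\<close>; compactness then keeps finitely many.\<close>
      obtain J where J: "countable J" "J \<subseteq> K" "pairwise (\<lambda>i j. disjnt (ball i (r i)) (ball j (r j))) J"
        "K \<subseteq> (\<Union>i\<in>J. ball i (5 * r i))"
        by (rule Vitali_covering_lemma_balls[where S=K and K=K and a="\<lambda>x. x" and r=r and B="1 / real (Suc M)"])
           (use r in \<open>auto intro!: less_imp_le[of "r _"]\<close>)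
      obtain I where I: "I \<subseteq> J" "finite I" "K \<subseteq> (\<Union>i\<in>I. ball i (5 * r i))"
        by (rule compactE_image[OF K(2), of J "\<lambda>i. ball i (5 * r i)"]) (use J in auto)
      have IK: "I \<subseteq> K" using I J by auto
      have r0: "0 < r i" if "i \<in> I" for i using that IK r by auto
      define \<psi> where "\<psi> i = cutoff i (5 * r i)" for i
      \<comment> \<open>Truncation keeps \<phi> at most 1 where enlarged balls overlap, and its
        energy is still at most the sum of the energies of the \<open>\<psi> i\<close>.\<close>
      define \<phi> where "\<phi> y = min 1 (\<Sum>i\<in>I. \<psi> i y)" for y
      have \<psi>m [measurable]: "\<psi> i \<in> borel_measurable borel" for i by (simp add: \<psi>_def)
      have \<phi>m [measurable]: "\<phi> \<in> borel_measurable borel" unfolding \<phi>_def[abs_def] by measurable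
      have sum0: "0 \<le> (\<Sum>i\<in>I. \<psi> i y)" for y by (intro sum_nonneg) (simp add: \<psi>_def cutoff_bounds)
      have \<phi>01: "0 \<le> \<phi> y" "\<phi> y \<le> 1" for y using sum0[of y] by (auto simp: \<phi>_def)
      have diff: "\<bar>\<phi> x - \<phi> y\<bar> \<le> (\<Sum>i\<in>I. \<bar>\<psi> i x - \<psi> i y\<bar>)" for x y
      proof -
        have "\<bar>\<phi> x - \<phi> y\<bar> \<le> \<bar>(\<Sum>i\<in>I. \<psi> i x - \<psi> i y)\<bar>"
          unfolding \<phi>_def sum_subtractf by linarith
        also have "\<dots> \<le> (\<Sum>i\<in>I. \<bar>\<psi> i x - \<psi> i y\<bar>)" by (rule sum_abs)
        finally show ?thesis .
      qed
      have lip: "(\<Sum>i\<in>I. 1 / (5 * r i))-lipschitz_on UNIV \<phi>"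
      proof (rule lipschitz_onI)
        fix x y
        have "(\<Sum>i\<in>I. \<bar>\<psi> i x - \<psi> i y\<bar>) \<le> (\<Sum>i\<in>I. 1 / (5 * r i) * norm (x - y))"
          unfolding \<psi>_def by (intro sum_mono cutoff_lipschitz) (use r0 in auto)
        with diff[of x y] show "dist (\<phi> x) (\<phi> y) \<le> (\<Sum>i\<in>I. 1 / (5 * r i)) * dist x y"
          by (simp add: sum_distrib_right dist_norm)
      qed (use r0 in \<open>auto intro!: sum_nonneg simp: less_imp_le\<close>)
      have supp: "y \<in> U \<and> y \<in> (\<Union>i\<in>I. cball i (10 * r i))" if "\<phi> y \<noteq> 0" for y
      proof -
        have "(\<Sum>i\<in>I. \<psi> i y) \<noteq> 0" using that by (auto simp: \<phi>_def)
        then obtain i where i: "i \<in> I" "\<psi> i y \<noteq> 0" by (auto dest: sum.not_neutral_contains_not_neutral)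
        then have "y \<in> cball i (10 * r i)"
          using cutoff_eq_0[of "5 * r i" y i] r0[of i] by (auto simp: \<psi>_def)
        moreover have "10 * r i < d"
        proof -
          have "r i < 1 / real (Suc M)" using r(2)[of i] i IK by auto
          then have "10 * r i < 10 * (1 / real (Suc M))" by simp
          then show ?thesis using dM by simp
        qed
        ultimately show ?thesis using d(2) i IK by force
      qed
      have cs: "compact_support \<phi>"
      proof -
        have "bounded (\<Union>i\<in>I. cball i (10 * r i))" using I by (intro bounded_UN) auto
        then have "bounded {y. \<phi> y \<noteq> 0}" by (rule bounded_subset) (use supp in auto)
        then show ?thesis by (simp add: compact_support_def compact_closure)
      qed
      have one: "\<phi> y = 1" if "y \<in> K" for y
      proof -
        have "y \<in> (\<Union>i\<in>I. ball i (5 * r i))" using that I(3) by blast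
        then obtain i where i: "i \<in> I" "y \<in> ball i (5 * r i)" by blast
        then have "1 = \<psi> i y" using r0[of i] by (simp add: \<psi>_def cutoff_eq_1)
        also have "\<dots> \<le> (\<Sum>i\<in>I. \<psi> i y)"
          using i I by (intro member_le_sum) (auto simp: \<psi>_def cutoff_bounds)
        finally show ?thesis by (simp add: \<phi>_def)
      qed
      define R where "R = (\<Sum>i\<in>I. r i powr ?s)"
      have R0: "0 \<le> R" by (auto simp: R_def intro: sum_nonneg)
      \<comment> \<open>Each chosen ball violates the density bound with constant \<open>M\<close>,
        and the balls are disjoint, so the energy budget \<open>R\<close> is at most the total mass
        divided by \<open>M\<close>.\<close>
      have "real M * R \<le> measure ?P UNIV"
      proof -
        have "real M * R = (\<Sum>i\<in>I. real M * r i powr ?s)" by (simp add: R_def sum_distrib_left)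
        also have "\<dots> \<le> (\<Sum>i\<in>I. measure ?P (ball i (r i)))"
          using r(3) IK by (intro sum_mono less_imp_le) (auto simp: P.emeasure_eq_measure ennreal_less_iff)
        also have "\<dots> = measure ?P (\<Union>i\<in>I. ball i (r i))"
        proof (rule P.finite_measure_finite_Union[symmetric])
          show "disjoint_family_on (\<lambda>i. ball i (r i)) I"
            using J(3) I(1) by (auto simp: disjoint_family_on_def pairwise_def disjnt_def)
        qed (use I in auto)
        also have "\<dots> \<le> measure ?P UNIV" by (rule P.finite_measure_mono) auto
        finally show ?thesis .
      qed
      have "gagliardo \<alpha> \<phi> \<le> (\<Sum>i\<in>I. gagliardo \<alpha> (\<psi> i))"
        by (rule gagliardo_sum) (use I diff in auto)
      also have "\<dots> \<le> (\<Sum>i\<in>I. ennreal (C0 * (5 * r i) powr ?s))"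
        unfolding \<psi>_def by (intro sum_mono C0(2)) (use r0 in auto)
      also have "\<dots> = ennreal (C0 * 5 powr ?s * R)"
        using C0 by (subst sum_ennreal) (auto simp: R_def sum_distrib_left powr_mult mult.assoc r0 less_imp_le intro!: sum.cong arg_cong[where f=ennreal])
      finally have G: "gagliardo \<alpha> \<phi> \<le> ennreal (C0 * 5 powr ?s * R)" .
      have "\<bar>signed_integral m \<phi>\<bar> \<le> C * (C0 * 5 powr ?s * R)"
        by (rule test[OF lip cs G]) (use C0 R0 in auto)
      moreover have "c / 2 \<le> signed_integral m \<phi>"
      proof -
        have intP: "integrable ?P \<phi>" and intN: "integrable ?N \<phi>"
          by (rule P.integrable_const_bound[where B=1] N.integrable_const_bound[where B=1]; use \<phi>01 in \<open>auto simp: abs_le_iff\<close>)+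
        have "measure ?P K = (LINT x|?P. indicator K x)" using Kb by simp
        also have "\<dots> \<le> (LINT x|?P. \<phi> x)"
          by (intro integral_mono intP integrable_real_indicator) (use Kb \<phi>01 one in \<open>auto simp: indicator_def P.emeasure_eq_measure\<close>)
        finally have 1: "measure ?P K \<le> (LINT x|?P. \<phi> x)" .
        have zero: "\<phi> x \<le> 0" if "x \<notin> U" for x using supp[of x] that by force
        have "(LINT x|?N. \<phi> x) \<le> (LINT x|?N. indicator U x)"
          by (intro integral_mono intN integrable_real_indicator) (use U \<phi>01 supp zero in \<open>auto simp: indicator_def N.emeasure_eq_measure\<close>)
        also have "\<dots> = measure ?N U" using U by simp
        finally show ?thesis using 1 U(3) c_eq unfolding signed_integral_def by linarith
      qed
      ultimately have "c / 2 * real M \<le> C * (C0 * 5 powr ?s * R) * real M"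
        by (intro mult_right_mono) auto
      also have "\<dots> = C * (C0 * 5 powr ?s * (real M * R))" by simp
      also have "\<dots> \<le> C * (C0 * 5 powr ?s * measure ?P UNIV)"
        using C C0 \<open>real M * R \<le> measure ?P UNIV\<close> by (intro mult_left_mono) auto
      finally show ?thesis .
    qed
    \<comment> \<open>The right side of \<open>bound\<close> does not depend on \<open>M\<close>, so
      a large \<open>M\<close> gives the contradiction.\<close>
    obtain M :: nat where M: "max (1 / d * 10) (C * (C0 * 5 powr ?s * measure ?P UNIV) / (c / 2)) < real M"
      using reals_Archimedean2 by blast
    then have "C * (C0 * 5 powr ?s * measure ?P UNIV) < c / 2 * real M"
      using c by (simp add: field_simps)
    with bound[of M] M show False by simp
  qed
  then have "AE x in ?P. x \<notin> Z"
    using Z by (intro AE_not_in) auto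
  then show ?thesis by eventually_elim (auto simp: Z_def)
qed

section \<open>Oscillation of ball averages\<close>

text \<open>The outer factor 5 comes from the auxiliary ball used to compare averages. Shells for
  the radii \<open>\<delta> / 2 ^ k\<close> then overlap at most three times.\<close>

definition shell_diff :: "real \<Rightarrow> (real^'n \<Rightarrow> real) \<Rightarrow> real \<Rightarrow> real^'n \<Rightarrow> ennreal" where
  "shell_diff \<alpha> u s y = (\<integral>\<^sup>+h. ennreal (riesz_kernel \<alpha> h * \<bar>u (y + h) - u y\<bar>) * indicator {h. s \<le> norm h \<and> norm h \<le> 5 * s} h \<partial>lborel)"

definition locally_integrable :: "(real^'n \<Rightarrow> real) \<Rightarrow> bool" where
  "locally_integrable u \<longleftrightarrow> u \<in> borel_measurable borel \<and> (\<forall>x r. set_integrable lborel (ball x r) u)"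

lemma shell_diff_measurable [measurable]:
  assumes [measurable]: "u \<in> borel_measurable borel"
  shows "shell_diff \<alpha> u s \<in> borel_measurable borel"
  unfolding shell_diff_def by measurable

lemma ball_average_lborel:
  assumes [measurable]: "u \<in> borel_measurable borel"
  shows "ball_average u x r = (LINT y:ball x r|lborel. u y) / measure lborel (ball x r)"
  unfolding ball_average_def set_lebesgue_integral_def
  by (subst integral_completion) (auto intro!: borel_measurable_times borel_measurable_indicator simp: measure_completion)

text \<open>The average of \<open>u - c\<close> is bounded by the average of its modulus. The volume
  stays as a factor on the left to avoid division in \<open>ennreal\<close>; \<open>c\<close> may be
  a value of \<open>u\<close> or another average.\<close>

lemma ball_average_deviation:
  assumes u: "locally_integrable u" and r: "0 < r"
  shows "ennreal \<bar>ball_average u x r - c\<bar> * emeasure lborel (ball x r) \<le> (\<integral>\<^sup>+y. ennreal \<bar>u y - c\<bar> * indicator (ball x r) y \<partial>lborel)"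
proof -
  have [measurable]: "u \<in> borel_measurable borel" and int: "set_integrable lborel (ball x r) u"
    using u by (auto simp: locally_integrable_def)
  let ?V = "measure lborel (ball x r)"
  have V: "0 < ?V" using r by (simp add: content_ball_pos)
  have fin: "emeasure lborel (ball x r) = ennreal ?V"
    by (rule emeasure_eq_ennreal_measure) (use emeasure_lborel_ball_finite[of x r] in auto)
  have intc: "set_integrable lborel (ball x r) (\<lambda>y. c)"
    unfolding set_integrable_def using emeasure_lborel_ball_finite[of x r]
    by (auto intro!: integrable_scaleR_left integrable_real_indicator)
  have "(ball_average u x r - c) * ?V = (LINT y:ball x r|lborel. u y) - (LINT y:ball x r|lborel. c)"
  proof -
    have "(LINT y:ball x r|lborel. c) = c * ?V"
      using emeasure_lborel_ball_finite[of x r] unfolding set_lebesgue_integral_def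
      by (subst integral_scaleR_left) auto
    then show ?thesis using V by (simp add: ball_average_lborel field_simps)
  qed
  also have "\<dots> = (LINT y:ball x r|lborel. u y - c)"
    using int intc by (simp add: set_integral_diff)
  finally have eq: "(ball_average u x r - c) * ?V = (LINT y:ball x r|lborel. u y - c)" .
  have "ennreal \<bar>ball_average u x r - c\<bar> * emeasure lborel (ball x r) = ennreal \<bar>(ball_average u x r - c) * ?V\<bar>"
    using V by (simp add: fin ennreal_mult abs_mult)
  also have "\<dots> \<le> (\<integral>\<^sup>+y. ennreal (norm (indicator (ball x r) y *\<^sub>R (u y - c))) \<partial>lborel)"
    unfolding eq set_lebesgue_integral_def real_norm_def[symmetric]
    by (rule integral_norm_bound_ennreal)
       (use set_integral_diff(1)[OF int intc] in \<open>simp add: set_integrable_def\<close>)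
  also have "\<dots> = (\<integral>\<^sup>+y. ennreal \<bar>u y - c\<bar> * indicator (ball x r) y \<partial>lborel)"
    by (intro nn_integral_cong) (simp add: indicator_def)
  finally show ?thesis .
qed

text \<open>Both averages are compared with the average over a ball whose distance to \<open>x\<close> is comparable to \<open>s\<close>,
  so that only increments of size comparable to \<open>s\<close> enter.\<close>

lemma ball_average_oscillation:
  fixes u :: "real^'n \<Rightarrow> real"
  assumes u: "locally_integrable u" and \<alpha>: "0 < \<alpha>" and s: "0 < s"
    and r: "s / 2 \<le> r" "r \<le> s" and r': "s / 2 \<le> r'" "r' \<le> s"
  defines "n \<equiv> real CARD('n)"
  shows "ennreal \<bar>ball_average u x r - ball_average u x r'\<bar>
    \<le> ennreal (2 * (5 powr (n + \<alpha>) * 2 powr n / (unit_ball_vol n)\<^sup>2) * s powr (\<alpha> - n))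
       * (\<integral>\<^sup>+y. shell_diff \<alpha> u s y * indicator (ball x s) y \<partial>lborel)"
proof -
  have [measurable]: "u \<in> borel_measurable borel" using u by (auto simp: locally_integrable_def)
  define \<omega> where "\<omega> = unit_ball_vol n"
  have \<omega>: "0 < \<omega>" by (simp add: \<omega>_def n_def)
  \<comment> \<open>The centre lies \<open>3 * s\<close> away, so a point within \<open>s\<close> of
    \<open>x\<close> and one within \<open>s\<close> of \<open>w\<close> have distance between
    \<open>s\<close> and \<open>5 * s\<close>, the bounds in \<open>shell_diff\<close>.\<close>
  define w :: "real^'n" where "w = x + (3 * s) *\<^sub>R axis undefined 1"
  have dw: "dist x w = 3 * s" using s by (simp add: w_def dist_norm norm_axis_1)
  define b where "b = ball_average u w s"
  define T where "T = (\<integral>\<^sup>+y. shell_diff \<alpha> u s y * indicator (ball x s) y \<partial>lborel)"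
  let ?V = "\<lambda>r. \<omega> * r powr n"
  have em: "emeasure lborel (ball z r) = ennreal (?V r)" if "0 < r" for z :: "real^'n" and r
    using that by (simp add: emeasure_ball \<omega>_def n_def powr_realpow)
  \<comment> \<open>The quotient of the inverse kernel bound
    \<open>(5 * s) powr (n + \<alpha>)\<close> by the volumes of two balls, of radii
    \<open>s / 2\<close> and \<open>s\<close>.\<close>
  define c where "c = 5 powr (n + \<alpha>) * 2 powr n / \<omega>\<^sup>2 * s powr (\<alpha> - n)"
  have key: "ennreal \<bar>ball_average u x r - b\<bar> \<le> ennreal c * T" if r: "s / 2 \<le> r" "r \<le> s" for r
  proof -
    have r0: "0 < r" using r s by simp
    have inner: "ennreal \<bar>u y - b\<bar> * ennreal (?V s) \<le> ennreal ((5 * s) powr (n + \<alpha>)) * shell_diff \<alpha> u s y"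
      if y: "y \<in> ball x r" for y
    proof -
      have "ennreal \<bar>u y - b\<bar> * ennreal (?V s) = ennreal \<bar>ball_average u w s - u y\<bar> * emeasure lborel (ball w s)"
        by (simp add: em s b_def abs_minus_commute)
      also have "\<dots> \<le> (\<integral>\<^sup>+z. ennreal \<bar>u z - u y\<bar> * indicator (ball w s) z \<partial>lborel)"
        by (rule ball_average_deviation[OF u s])
      also have "\<dots> = (\<integral>\<^sup>+h. ennreal \<bar>u (h + y) - u y\<bar> * indicator (ball w s) (h + y) \<partial>lborel)"
        by (rule nn_integral_lborel_shift[where f="\<lambda>z. ennreal \<bar>u z - u y\<bar> * indicator (ball w s) z", symmetric])
           (auto intro!: borel_measurable_times_ennreal borel_measurable_indicator)
      also have "\<dots> \<le> (\<integral>\<^sup>+h. ennreal ((5 * s) powr (n + \<alpha>)) * (ennreal (riesz_kernel \<alpha> h * \<bar>u (y + h) - u y\<bar>)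
            * indicator {h. s \<le> norm h \<and> norm h \<le> 5 * s} h) \<partial>lborel)"
      proof (intro nn_integral_mono)
        fix h
        show "ennreal \<bar>u (h + y) - u y\<bar> * indicator (ball w s) (h + y) \<le> ennreal ((5 * s) powr (n + \<alpha>)) * (ennreal (riesz_kernel \<alpha> h * \<bar>u (y + h) - u y\<bar>)
            * indicator {h. s \<le> norm h \<and> norm h \<le> 5 * s} h)"
        proof (cases "h + y \<in> ball w s")
          case True
          have "dist w (y + h) < s" "dist x y < s" using True y r by (auto simp: add.commute)
          moreover have "norm h = dist y (y + h)" by (simp add: dist_norm)
          ultimately have h: "s \<le> norm h" "norm h \<le> 5 * s"
            using dw dist_triangle[of x w "y + h"] dist_triangle[of x "y + h" y]
              dist_triangle[of y "y + h" x] dist_triangle[of x "y + h" w]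
            by (simp_all add: dist_commute)
          \<comment> \<open>On the shell the kernel is at least
            \<open>(5 * s) powr (- (n + \<alpha>))\<close>, so it can be inserted in front of the
            increment.\<close>
          have "1 \<le> (5 * s) powr (n + \<alpha>) * riesz_kernel \<alpha> h"
          proof -
            have "norm h powr (n + \<alpha>) \<le> (5 * s) powr (n + \<alpha>)"
              using h \<alpha> by (intro powr_mono2) (auto simp: n_def)
            moreover have "0 < norm h" using h s by linarith
            moreover have "riesz_kernel \<alpha> h = 1 / norm h powr (n + \<alpha>)"
              unfolding riesz_kernel_def n_def by (rule powr_minus_divide)
            ultimately show ?thesis by simp
          qed
          then have "1 * \<bar>u (y + h) - u y\<bar> \<le> ((5 * s) powr (n + \<alpha>) * riesz_kernel \<alpha> h) * \<bar>u (y + h) - u y\<bar>"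
            by (intro mult_right_mono) auto
          then show ?thesis using h True
            by (simp add: ennreal_mult'[symmetric] mult.assoc add.commute del: mem_ball)
        qed simp
      qed
      also have "\<dots> = ennreal ((5 * s) powr (n + \<alpha>)) * shell_diff \<alpha> u s y"
        unfolding shell_diff_def by (intro nn_integral_cmult) measurable
      finally show ?thesis .
    qed
    have "ennreal \<bar>ball_average u x r - b\<bar> * ennreal (?V r) * ennreal (?V s)
      \<le> (\<integral>\<^sup>+y. ennreal \<bar>u y - b\<bar> * indicator (ball x r) y \<partial>lborel) * ennreal (?V s)"
      using ball_average_deviation[OF u r0, of x b] r0 by (intro mult_right_mono) (auto simp: em)
    also have "\<dots> = (\<integral>\<^sup>+y. (ennreal \<bar>u y - b\<bar> * ennreal (?V s)) * indicator (ball x r) y \<partial>lborel)"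
      by (subst nn_integral_multc[symmetric]) (auto simp: mult_ac intro!: borel_measurable_times_ennreal borel_measurable_indicator)
    also have "\<dots> \<le> (\<integral>\<^sup>+y. ennreal ((5 * s) powr (n + \<alpha>)) * (shell_diff \<alpha> u s y * indicator (ball x s) y) \<partial>lborel)"
    proof (intro nn_integral_mono)
      fix y
      show "(ennreal \<bar>u y - b\<bar> * ennreal (?V s)) * indicator (ball x r) y \<le> ennreal ((5 * s) powr (n + \<alpha>)) * (shell_diff \<alpha> u s y * indicator (ball x s) y)"
        using inner[of y] r by (cases "y \<in> ball x r") auto
    qed
    also have "\<dots> = ennreal ((5 * s) powr (n + \<alpha>)) * T"
      unfolding T_def by (intro nn_integral_cmult borel_measurable_times_ennreal borel_measurable_indicator) auto
    finally have *: "ennreal \<bar>ball_average u x r - b\<bar> * ennreal (?V r) * ennreal (?V s) \<le> ennreal ((5 * s) powr (n + \<alpha>)) * T" .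
    have "(s / 2) powr n \<le> r powr n" using r s by (intro powr_mono2) (auto simp: n_def)
    then have Vr: "?V (s / 2) \<le> ?V r" using \<omega> by simp
    have "ennreal \<bar>ball_average u x r - b\<bar> * ennreal (?V (s / 2) * ?V s) \<le> ennreal \<bar>ball_average u x r - b\<bar> * ennreal (?V r) * ennreal (?V s)"
      using Vr \<omega> by (simp add: ennreal_mult' mult.assoc[symmetric]) (intro mult_right_mono mult_left_mono ennreal_leI, auto)
    also note *
    finally have le: "ennreal \<bar>ball_average u x r - b\<bar> * ennreal (?V (s / 2) * ?V s) * ennreal (1 / (?V (s / 2) * ?V s))
      \<le> ennreal ((5 * s) powr (n + \<alpha>)) * T * ennreal (1 / (?V (s / 2) * ?V s))"
      by (intro mult_right_mono) auto
    have inv: "ennreal (?V (s / 2) * ?V s) * ennreal (1 / (?V (s / 2) * ?V s)) = 1"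
      using \<omega> s by (simp add: ennreal_mult'[symmetric])
    have cc: "ennreal ((5 * s) powr (n + \<alpha>)) * ennreal (1 / (?V (s / 2) * ?V s)) = ennreal c"
    proof -
      have "(5 * s) powr (n + \<alpha>) * (1 / (?V (s / 2) * ?V s)) = c"
        using s \<omega> by (simp add: c_def powr_mult powr_divide powr_add powr_diff power2_eq_square field_simps)
      then show ?thesis by (simp add: ennreal_mult'[symmetric])
    qed
    have "ennreal \<bar>ball_average u x r - b\<bar> = ennreal \<bar>ball_average u x r - b\<bar> * (ennreal (?V (s / 2) * ?V s) * ennreal (1 / (?V (s / 2) * ?V s)))"
      by (simp only: inv mult_1_right)
    also have "\<dots> \<le> ennreal ((5 * s) powr (n + \<alpha>)) * T * ennreal (1 / (?V (s / 2) * ?V s))"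
      using le by (simp only: mult.assoc)
    also have "\<dots> = ennreal ((5 * s) powr (n + \<alpha>)) * ennreal (1 / (?V (s / 2) * ?V s)) * T"
      by (simp only: mult_ac)
    finally show ?thesis by (simp only: cc)
  qed
  have c0: "0 \<le> c" using \<omega> by (simp add: c_def)
  have "ennreal \<bar>ball_average u x r - ball_average u x r'\<bar> \<le> ennreal (\<bar>ball_average u x r - b\<bar> + \<bar>ball_average u x r' - b\<bar>)"
    by (intro ennreal_leI) linarith
  also have "\<dots> \<le> ennreal c * T + ennreal c * T"
    by (subst ennreal_plus) (auto intro!: add_mono key r r')
  also have "\<dots> = ennreal (2 * c) * T"
  proof -
    have "ennreal (2 * c) = ennreal c + ennreal c"
      using c0 by (simp flip: ennreal_plus)
    then show ?thesis by (simp only: distrib_right)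
  qed
  finally show ?thesis by (simp add: c_def T_def \<omega>_def mult.assoc)
qed

text \<open>For radii between \<open>\<delta> / 2 ^ Suc k\<close> and
  \<open>\<delta> / 2 ^ k\<close> the averages oscillate by at most a constant times term
  \<open>k\<close> of the series. Summability makes the averages at dyadic radii converge, and every
  other radius differs from a dyadic one by a vanishing error.\<close>

lemma has_precise_value_if_summable:
  fixes u :: "real^'n \<Rightarrow> real"
  assumes u: "locally_integrable u" and \<alpha>: "0 < \<alpha>" and \<delta>: "0 < \<delta>"
    and fin: "(\<Sum>k. ennreal ((\<delta> / 2 ^ k) powr (\<alpha> - real CARD('n))) *
        (\<integral>\<^sup>+y. shell_diff \<alpha> u (\<delta> / 2 ^ k) y * indicator (ball x (\<delta> / 2 ^ k)) y \<partial>lborel)) < \<infinity>"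
  shows "has_precise_value u x"
proof -
  define n where "n = real CARD('n)"
  define c where "c = 2 * (5 powr (n + \<alpha>) * 2 powr n / (unit_ball_vol n)\<^sup>2)"
  have c0: "0 \<le> c" by (simp add: c_def n_def)
  define T where "T k = ennreal ((\<delta> / 2 ^ k) powr (\<alpha> - real CARD('n))) *
        (\<integral>\<^sup>+y. shell_diff \<alpha> u (\<delta> / 2 ^ k) y * indicator (ball x (\<delta> / 2 ^ k)) y \<partial>lborel)" for k
  have T: "(\<Sum>k. T k) < \<infinity>" using fin by (simp add: T_def)
  have Tfin: "T k < \<infinity>" for k
    using T sum_le_suminf[of T "{k}"] by (simp add: le_less_trans)
  define t where "t k = c * enn2real (T k)" for k
  have t: "ennreal (t k) = ennreal c * T k" for k
    using Tfin[of k] c0 by (simp add: t_def ennreal_mult')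
  have t0: "0 \<le> t k" for k using c0 by (simp add: t_def)
  have "(\<Sum>k. ennreal (t k)) = ennreal c * (\<Sum>k. T k)" unfolding t by (rule ennreal_suminf_cmult)
  then have "(\<Sum>k. ennreal (t k)) \<noteq> \<infinity>" using T by (simp add: ennreal_mult_eq_top_iff)
  then have summ: "summable t" using summable_suminf_not_top[of t] t0 by simp
  have osc: "\<bar>ball_average u x r - ball_average u x r'\<bar> \<le> t k"
    if "\<delta> / 2 ^ Suc k \<le> r" "r \<le> \<delta> / 2 ^ k" "\<delta> / 2 ^ Suc k \<le> r'" "r' \<le> \<delta> / 2 ^ k" for r r' k
  proof -
    have "ennreal \<bar>ball_average u x r - ball_average u x r'\<bar> \<le> ennreal (c * (\<delta> / 2 ^ k) powr (\<alpha> - n)) *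
        (\<integral>\<^sup>+y. shell_diff \<alpha> u (\<delta> / 2 ^ k) y * indicator (ball x (\<delta> / 2 ^ k)) y \<partial>lborel)"
      unfolding c_def n_def by (rule ball_average_oscillation[OF u \<alpha>]) (use \<delta> that in auto)
    also have "\<dots> = ennreal (t k)"
      using c0 by (simp add: t T_def n_def ennreal_mult' mult.assoc)
    finally show ?thesis using t0 by simp
  qed
  define a where "a k = ball_average u x (\<delta> / 2 ^ k)" for k
  have "summable (\<lambda>k. a (Suc k) - a k)"
    by (rule summable_comparison_test'[OF summ, of 0])
       (use \<delta> in \<open>auto simp: a_def field_simps intro!: osc\<close>)
  then have "convergent (\<lambda>k. \<Sum>i<k. a (Suc i) - a i)" by (simp add: summable_iff_convergent)
  then have "convergent (\<lambda>k. a k - a 0)" by (simp add: sum_lessThan_telescope)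
  then have "convergent (\<lambda>k. (a k - a 0) + a 0)" by (intro convergent_add convergent_const)
  then obtain l where l: "a \<longlonglongrightarrow> l" by (auto simp: convergent_def)
  have "(ball_average u x \<longlongrightarrow> l) (at_right 0)"
  proof (rule tendstoI)
    fix e :: real assume e: "0 < e"
    have "eventually (\<lambda>k. dist (a k) l < e / 2 \<and> t k < e / 2) sequentially"
      using tendstoD[OF l, of "e / 2"] order_tendstoD(2)[OF summable_LIMSEQ_zero[OF summ], of "e / 2"] e
      by (auto intro: eventually_conj)
    then obtain K where K: "\<And>k. K \<le> k \<Longrightarrow> dist (a k) l < e / 2" "\<And>k. K \<le> k \<Longrightarrow> t k < e / 2"
      by (auto simp: eventually_sequentially)
    have "dist (ball_average u x r) l < e" if r: "0 < r" "r < \<delta> / 2 ^ K" for r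
    proof -
      have "1 \<le> \<delta> / 2 ^ K / r" unfolding pos_le_divide_eq[OF r(1)] using r(2) by linarith
      from dyadic_bracket[OF this] obtain j where j: "2 ^ j \<le> \<delta> / 2 ^ K / r" "\<delta> / 2 ^ K / r < 2 ^ Suc j" .
      then have "r \<le> \<delta> / 2 ^ (K + j)" "\<delta> / 2 ^ Suc (K + j) \<le> r"
        using r by (auto simp: field_simps power_add)
      then have "\<bar>ball_average u x r - a (K + j)\<bar> \<le> t (K + j)"
        unfolding a_def using \<delta> by (intro osc) (auto simp: field_simps)
      then show ?thesis using K(1)[OF le_add1[of K j]] K(2)[OF le_add1[of K j]] unfolding dist_real_def by linarith
    qed
    then show "eventually (\<lambda>r. dist (ball_average u x r) l < e) (at_right 0)"
      using \<delta> by (auto simp: eventually_at_right[of 0 1] intro!: exI[of _ "\<delta> / 2 ^ K"])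
  qed
  then show ?thesis by (auto simp: has_precise_value_def)
qed

text \<open>An increment \<open>h\<close> belongs to at most three consecutive shells, because
  \<open>5 < 2 ^ 3\<close>.\<close>

lemma shell_diff_suminf_le:
  fixes u :: "real^'n \<Rightarrow> real"
  assumes [measurable]: "u \<in> borel_measurable borel" and \<delta>: "0 < \<delta>"
  shows "(\<Sum>k. shell_diff \<alpha> u (\<delta> / 2 ^ k) y) \<le>
    3 * (\<integral>\<^sup>+h. ennreal (riesz_kernel \<alpha> h * \<bar>u (y + h) - u y\<bar>) * indicator (cball 0 (5 * \<delta>)) h \<partial>lborel)"
proof -
  have overlap: "(\<Sum>k. indicator {h. \<delta> / 2 ^ k \<le> norm h \<and> norm h \<le> 5 * (\<delta> / 2 ^ k)} h) \<le> (3 * indicator (cball 0 (5 * \<delta>)) h :: ennreal)" for h :: "real^'n"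
  proof (cases "\<exists>k. \<delta> / 2 ^ k \<le> norm h \<and> norm h \<le> 5 * (\<delta> / 2 ^ k)")
    case True
    define A where "A = {k. \<delta> / 2 ^ k \<le> norm h \<and> norm h \<le> 5 * (\<delta> / 2 ^ k)}"
    \<comment> \<open>The first index whose inner radius does not exceed \<open>norm h\<close>; from
      index \<open>j + 3\<close> on the outer radius is at most \<open>5 / 8\<close> of that inner
      radius.\<close>
    define j where "j = (LEAST k. \<delta> / 2 ^ k \<le> norm h)"
    have j: "\<delta> / 2 ^ j \<le> norm h" unfolding j_def using True LeastI_ex[of "\<lambda>k. \<delta> / 2 ^ k \<le> norm h"] by blast
    have "A \<subseteq> {j, j + 1, j + 2}"
    proof
      fix k assume k: "k \<in> A"
      then have "j \<le> k" unfolding j_def A_def by (simp add: Least_le[of "\<lambda>k. \<delta> / 2 ^ k \<le> norm h"])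
      moreover have "k < j + 3"
      proof (rule ccontr)
        assume "\<not> k < j + 3"
        then obtain i where i: "k = j + 3 + i" using le_Suc_ex[of "j + 3" k] by auto
        have "norm h \<le> 5 * (\<delta> / 2 ^ k)" using k by (auto simp: A_def)
        also have "\<delta> / 2 ^ k = \<delta> / 2 ^ j * (1 / (8 * 2 ^ i))" by (simp add: i power_add field_simps)
        also have "5 * (\<delta> / 2 ^ j * (1 / (8 * 2 ^ i))) \<le> 5 * (\<delta> / 2 ^ j * (1 / 8))"
          using \<delta> by (intro mult_left_mono divide_left_mono) auto
        also have "\<dots> < \<delta> / 2 ^ j" using \<delta> by (simp add: field_simps)
        finally show False using j by simp
      qed
      ultimately show "k \<in> {j, j + 1, j + 2}" by auto
    qed
    then have fin: "finite A" and card: "card A \<le> 3"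
      using card_mono[of "{j, j + 1, j + 2}" A] by (auto intro: finite_subset)
    have "(\<Sum>k. indicator {h. \<delta> / 2 ^ k \<le> norm h \<and> norm h \<le> 5 * (\<delta> / 2 ^ k)} h :: ennreal) = (\<Sum>k\<in>A. 1)"
      by (subst suminf_finite[OF fin]) (auto simp: A_def indicator_def)
    also have "\<dots> \<le> 3" using of_nat_mono[OF card, where 'a=ennreal] by simp
    also have "(3 :: ennreal) = 3 * indicator (cball 0 (5 * \<delta>)) h"
    proof -
      obtain k where "norm h \<le> 5 * (\<delta> / 2 ^ k)" using True by auto
      also have "\<delta> / 2 ^ k \<le> \<delta>" using \<delta> by (simp add: field_simps)
      finally show ?thesis by simp
    qed
    finally show ?thesis .
  next
    case False
    then have "indicator {h. \<delta> / 2 ^ k \<le> norm h \<and> norm h \<le> 5 * (\<delta> / 2 ^ k)} h = (0 :: ennreal)" for k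
      by (auto simp: indicator_def)
    then show ?thesis by simp
  qed
  have "(\<Sum>k. shell_diff \<alpha> u (\<delta> / 2 ^ k) y)
     = (\<integral>\<^sup>+h. (\<Sum>k. ennreal (riesz_kernel \<alpha> h * \<bar>u (y + h) - u y\<bar>) * indicator {h. \<delta> / 2 ^ k \<le> norm h \<and> norm h \<le> 5 * (\<delta> / 2 ^ k)} h) \<partial>lborel)"
    unfolding shell_diff_def by (subst nn_integral_suminf) auto
  also have "\<dots> \<le> (\<integral>\<^sup>+h. 3 * (ennreal (riesz_kernel \<alpha> h * \<bar>u (y + h) - u y\<bar>) * indicator (cball 0 (5 * \<delta>)) h) \<partial>lborel)"
    unfolding ennreal_suminf_cmult
    by (intro nn_integral_mono) (simp only: mult.left_commute[of 3], intro mult_left_mono overlap, simp)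
  also have "\<dots> = 3 * (\<integral>\<^sup>+h. ennreal (riesz_kernel \<alpha> h * \<bar>u (y + h) - u y\<bar>) * indicator (cball 0 (5 * \<delta>)) h \<partial>lborel)"
    by (intro nn_integral_cmult borel_measurable_times_ennreal borel_measurable_indicator) auto
  finally show ?thesis .
qed

text \<open>Radius 5 contains every shell between \<open>s\<close> and \<open>5 * s\<close> with
  \<open>s \<le> 1\<close>.\<close>

definition near_energy :: "real \<Rightarrow> (real^'n \<Rightarrow> real) \<Rightarrow> real^'n \<Rightarrow> ennreal" where
  "near_energy \<alpha> u y = (\<integral>\<^sup>+h. ennreal (riesz_kernel \<alpha> h * \<bar>u (y + h) - u y\<bar>) * indicator (cball 0 5) h \<partial>lborel)"

text \<open>Only increments up to a fixed size are counted; for a bounded function the larger ones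
  are controlled by the tail of the kernel.\<close>

definition locally_gagliardo :: "real \<Rightarrow> (real^'n \<Rightarrow> real) \<Rightarrow> bool" where
  "locally_gagliardo \<alpha> u \<longleftrightarrow> (\<forall>L. (\<integral>\<^sup>+y. near_energy \<alpha> u y * indicator (ball 0 L) y \<partial>lborel) < \<infinity>)"

lemma near_energy_measurable [measurable]:
  assumes [measurable]: "(u :: real^'n \<Rightarrow> real) \<in> borel_measurable borel"
  shows "near_energy \<alpha> (u :: real^'n \<Rightarrow> real) \<in> borel_measurable borel"
proof -
  have [measurable]: "cball (0::real^'n) 5 \<in> sets borel" by auto
  show ?thesis unfolding near_energy_def by measurable
qed

text \<open>The series of \<open>has_precise_value_if_summable\<close> is integrated against
  \<kappa> over a bounded part of the density set. Exchanging the integrals brings in the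
  \<kappa>-masses of balls of radius \<open>s k\<close>, whose size
  \<open>s k powr (n - \<alpha>)\<close> cancels the weight. What remains is a sum over shells,
  bounded by three times the near energy.\<close>

lemma AE_density_le_has_precise_value:
  fixes u :: "real^'n \<Rightarrow> real"
  assumes u: "locally_integrable u" and \<alpha>: "0 < \<alpha>"
    and \<kappa>: "finite_measure \<kappa>" and sets[measurable_cong, simp]: "sets \<kappa> = sets borel"
    and fin: "\<And>L. (\<integral>\<^sup>+y. near_energy \<alpha> u y * indicator (ball 0 L) y \<partial>lborel) < \<infinity>"
  shows "AE x in \<kappa>. x \<in> density_le (real CARD('n) - \<alpha>) \<kappa> M \<longrightarrow> has_precise_value u x"
proof -
  interpret finite_measure \<kappa> by (rule \<kappa>)
  interpret pair_sigma_finite \<kappa> "lborel :: (real^'n) measure" ..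
  have space[simp]: "space \<kappa> = UNIV" using sets_eq_imp_space_eq[OF sets] by simp
  have [measurable]: "u \<in> borel_measurable borel" using u by (auto simp: locally_integrable_def)
  define n where "n = real CARD('n)"
  \<comment> \<open>Small enough for the density bound at the radii \<open>2 * s k\<close>, and at
    most 1 so that the shells stay within increments of size 5.\<close>
  define \<delta> where "\<delta> = 1 / (4 * real (Suc M))"
  have \<delta>: "0 < \<delta>" "2 * \<delta> < 1 / real (Suc M)" "\<delta> \<le> 1" by (auto simp: \<delta>_def field_simps)
  define s where "s k = \<delta> / 2 ^ k" for k :: nat
  let ?I = "\<lambda>k x. \<integral>\<^sup>+y. shell_diff \<alpha> u (s k) y * indicator (ball x (s k)) y \<partial>lborel"
  let ?J = "\<lambda>L k. \<integral>\<^sup>+y. shell_diff \<alpha> u (s k) y * indicator (ball 0 (L + 1)) y \<partial>lborel"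
  have s: "0 < s k" "s k \<le> \<delta>" for k using \<delta> by (auto simp: s_def field_simps)
  define T where "T x = (\<Sum>k. ennreal (s k powr (\<alpha> - n)) *
        ?I k x)" for x
  have ball_meas: "{z \<in> space (borel \<Otimes>\<^sub>M borel). snd z \<in> ball (fst z) r} \<in> sets (borel \<Otimes>\<^sub>M (borel :: (real^'n) measure))" for r
    unfolding mem_ball by measurable
  have ind[measurable]: "(\<lambda>z. indicator (ball (fst z) r) (snd z) :: ennreal) \<in> borel_measurable (borel \<Otimes>\<^sub>M (borel :: (real^'n) measure))" for r
  proof -
    have "(\<lambda>z. indicator (ball (fst z) r) (snd z) :: ennreal) = indicator {z. dist (fst z) (snd z :: real^'n) < r}"
      by (auto simp: indicator_def)
    moreover have "{z. dist (fst z) (snd z :: real^'n) < r} \<in> sets (borel \<Otimes>\<^sub>M borel)"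
      using ball_meas[of r] by (simp add: space_pair_measure)
    ultimately show ?thesis by simp
  qed
  have Tk [measurable]: "(\<lambda>x. ?I k x) \<in> borel_measurable borel" for k
  proof -
    have "(\<lambda>z. shell_diff \<alpha> u (s k) (snd z) * indicator (ball (fst z) (s k)) (snd z)) \<in> borel_measurable (borel \<Otimes>\<^sub>M lborel)"
      using ind by (intro borel_measurable_times_ennreal) (measurable, simp cong: measurable_cong_sets)
    from lborel.borel_measurable_nn_integral_fst[OF this] show ?thesis by simp
  qed
  let ?S = "density_le (n - \<alpha>) \<kappa> M"
  have S[measurable]: "?S \<in> sets borel" by (rule density_le_borel) simp
  have local: "AE x in \<kappa>. x \<in> ?S \<and> x \<in> ball 0 L \<longrightarrow> T x < \<infinity>" for L
  proof -
    let ?A = "?S \<inter> ball 0 L"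
    have A: "?A \<in> sets borel" by auto
    have A'[measurable]: "?A \<in> sets \<kappa>" by auto
    \<comment> \<open>The centre \<open>y\<close> may fail to be a density point. If the
      intersection is nonempty it contains one, and the ball about \<open>y\<close> lies in the ball
      of twice the radius about that point; also \<open>norm y < L + 1\<close> since
      \<open>s k \<le> 1\<close>.\<close>
    have small: "emeasure \<kappa> (?A \<inter> ball y (s k)) \<le> ennreal (real M * (2 * s k) powr (n - \<alpha>)) * indicator (ball 0 (L + 1)) y" for y k
    proof (cases "?A \<inter> ball y (s k) = {}")
      case False
      then obtain x where x: "x \<in> ?S" "norm x < L" "dist y x < s k" by auto
      have "norm y < L + 1" using x s[of k] \<delta>(3) norm_triangle_ineq[of x "y - x"] by (simp add: dist_norm)
      moreover have "emeasure \<kappa> (?A \<inter> ball y (s k)) \<le> emeasure \<kappa> (ball x (2 * s k))"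
      proof (intro emeasure_mono subsetI)
        fix z assume "z \<in> ?A \<inter> ball y (s k)"
        then show "z \<in> ball x (2 * s k)" using x dist_triangle[of x z y] by (simp add: dist_commute)
      qed simp
      moreover have "emeasure \<kappa> (ball x (2 * s k)) \<le> ennreal (real M * (2 * s k) powr (n - \<alpha>))"
        using x(1) s[of k] \<delta>(2) unfolding density_le_def by auto
      ultimately show ?thesis by (simp add: order_trans)
    qed simp
    have "(\<integral>\<^sup>+x. T x * indicator ?A x \<partial>\<kappa>) =
      (\<integral>\<^sup>+x. (\<Sum>k. ennreal (s k powr (\<alpha> - n)) * (?I k x * indicator ?A x)) \<partial>\<kappa>)"
      unfolding T_def by (simp add: ennreal_suminf_multc[symmetric] mult.assoc)
    also have "\<dots> = (\<Sum>k. ennreal (s k powr (\<alpha> - n)) * (\<integral>\<^sup>+x. ?I k x * indicator ?A x \<partial>\<kappa>))"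
      by (subst nn_integral_suminf) (auto intro!: suminf_cong nn_integral_cmult)
    also have "\<dots> \<le> (\<Sum>k. ennreal (real M * 2 powr (n - \<alpha>)) * ?J L k)"
    proof (intro suminf_le summableI)
      fix k
      have "(\<integral>\<^sup>+x. ?I k x * indicator ?A x \<partial>\<kappa>)
         = (\<integral>\<^sup>+x. (\<integral>\<^sup>+y. shell_diff \<alpha> u (s k) y * indicator (ball x (s k)) y * indicator ?A x \<partial>lborel) \<partial>\<kappa>)"
        by (intro nn_integral_cong nn_integral_multc[symmetric]) (auto intro!: borel_measurable_times_ennreal borel_measurable_indicator)
      also have "\<dots> = (\<integral>\<^sup>+y. (\<integral>\<^sup>+x. shell_diff \<alpha> u (s k) y * indicator (ball x (s k)) y * indicator ?A x \<partial>\<kappa>) \<partial>lborel)"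
      proof (rule Fubini'[symmetric])
        have "(\<lambda>z. shell_diff \<alpha> u (s k) (snd z) * indicator (ball (fst z) (s k)) (snd z) * indicator ?A (fst z)) \<in> borel_measurable (borel \<Otimes>\<^sub>M borel)"
          using A by measurable
        then show "(\<lambda>(x, y). shell_diff \<alpha> u (s k) y * indicator (ball x (s k)) y * indicator ?A x) \<in> borel_measurable (\<kappa> \<Otimes>\<^sub>M lborel)"
          by (simp add: case_prod_beta' cong: measurable_cong_sets)
      qed
      also have "\<dots> = (\<integral>\<^sup>+y. shell_diff \<alpha> u (s k) y * emeasure \<kappa> (?A \<inter> ball y (s k)) \<partial>lborel)"
      proof (intro nn_integral_cong)
        fix y
        have "(\<integral>\<^sup>+x. shell_diff \<alpha> u (s k) y * indicator (ball x (s k)) y * indicator ?A x \<partial>\<kappa>)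
          = (\<integral>\<^sup>+x. shell_diff \<alpha> u (s k) y * indicator (?A \<inter> ball y (s k)) x \<partial>\<kappa>)"
          by (intro nn_integral_cong) (auto simp: indicator_def dist_commute)
        also have "\<dots> = shell_diff \<alpha> u (s k) y * emeasure \<kappa> (?A \<inter> ball y (s k))"
          by (intro nn_integral_cmult_indicator) auto
        finally show "(\<integral>\<^sup>+x. shell_diff \<alpha> u (s k) y * indicator (ball x (s k)) y * indicator ?A x \<partial>\<kappa>)
          = shell_diff \<alpha> u (s k) y * emeasure \<kappa> (?A \<inter> ball y (s k))" .
      qed
      also have "\<dots> \<le> (\<integral>\<^sup>+y. ennreal (real M * (2 * s k) powr (n - \<alpha>)) * (shell_diff \<alpha> u (s k) y * indicator (ball 0 (L + 1)) y) \<partial>lborel)"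
        by (intro nn_integral_mono) (use mult_left_mono[OF small] in \<open>simp add: mult_ac\<close>)
      also have "\<dots> = ennreal (real M * (2 * s k) powr (n - \<alpha>)) * ?J L k"
        by (intro nn_integral_cmult) (auto intro!: borel_measurable_times_ennreal borel_measurable_indicator)
      finally have "ennreal (s k powr (\<alpha> - n)) * (\<integral>\<^sup>+x. ?I k x * indicator ?A x \<partial>\<kappa>)
         \<le> ennreal (s k powr (\<alpha> - n)) * (ennreal (real M * (2 * s k) powr (n - \<alpha>)) * ?J L k)"
        by (intro mult_left_mono) auto
      also have "\<dots> = ennreal (s k powr (\<alpha> - n) * (real M * (2 * s k) powr (n - \<alpha>))) * ?J L k"
        by (simp add: ennreal_mult' mult.assoc)
      also have "s k powr (\<alpha> - n) * (real M * (2 * s k) powr (n - \<alpha>)) = real M * 2 powr (n - \<alpha>)"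
        using s[of k] by (simp add: powr_mult powr_diff field_simps)
      finally show "ennreal (s k powr (\<alpha> - n)) * (\<integral>\<^sup>+x. ?I k x * indicator ?A x \<partial>\<kappa>)
         \<le> ennreal (real M * 2 powr (n - \<alpha>)) * ?J L k" .
    qed
    also have "\<dots> = ennreal (real M * 2 powr (n - \<alpha>)) * (\<integral>\<^sup>+y. (\<Sum>k. shell_diff \<alpha> u (s k) y) * indicator (ball 0 (L + 1)) y \<partial>lborel)"
      unfolding ennreal_suminf_cmult ennreal_suminf_multc[symmetric]
      by (subst nn_integral_suminf) (auto intro!: borel_measurable_times_ennreal borel_measurable_indicator)
    also have "\<dots> \<le> ennreal (real M * 2 powr (n - \<alpha>)) * (\<integral>\<^sup>+y. (3 * near_energy \<alpha> u y) * indicator (ball 0 (L + 1)) y \<partial>lborel)"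
    proof (intro mult_left_mono nn_integral_mono mult_right_mono)
      fix y
      have "(\<Sum>k. shell_diff \<alpha> u (s k) y) \<le> 3 * (\<integral>\<^sup>+h. ennreal (riesz_kernel \<alpha> h * \<bar>u (y + h) - u y\<bar>) * indicator (cball 0 (5 * \<delta>)) h \<partial>lborel)"
        unfolding s_def by (rule shell_diff_suminf_le) (use \<delta> in auto)
      also have "\<dots> \<le> 3 * near_energy \<alpha> u y"
        unfolding near_energy_def using \<delta>(3) by (intro mult_left_mono nn_integral_mono) (auto simp: indicator_def)
      finally show "(\<Sum>k. shell_diff \<alpha> u (s k) y) \<le> 3 * near_energy \<alpha> u y" .
    qed auto
    also have "\<dots> = ennreal (real M * 2 powr (n - \<alpha>)) * (3 * (\<integral>\<^sup>+y. near_energy \<alpha> u y * indicator (ball 0 (L + 1)) y \<partial>lborel))"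
    proof -
      have [measurable]: "cball (0::real^'n) 5 \<in> sets borel" by auto
      have "(\<lambda>y. \<integral>\<^sup>+h. ennreal (riesz_kernel \<alpha> h * \<bar>u (y + h) - u y\<bar>) * indicator (cball 0 5) h \<partial>lborel) \<in> borel_measurable lborel"
        by measurable
      then show ?thesis
        unfolding mult.assoc
        by (subst nn_integral_cmult) (auto intro!: borel_measurable_times_ennreal borel_measurable_indicator)
    qed
    also have "\<dots> < \<infinity>"
      using fin[of "L + 1"] by (simp add: ennreal_mult_less_top)
    finally have "(\<integral>\<^sup>+x. T x * indicator ?A x \<partial>\<kappa>) \<noteq> \<infinity>" by simp
    moreover have "(\<lambda>x. T x * indicator ?A x) \<in> borel_measurable \<kappa>"
      unfolding T_def by measurable
    ultimately have "AE x in \<kappa>. T x * indicator ?A x \<noteq> \<infinity>"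
      by (intro nn_integral_noteq_infinite) auto
    then show ?thesis by eventually_elim (auto simp: indicator_def top.not_eq_extremum split: if_splits)
  qed
  have "AE x in \<kappa>. \<forall>L::nat. x \<in> ?S \<and> x \<in> ball 0 (real L) \<longrightarrow> T x < \<infinity>"
    unfolding AE_all_countable using local by blast
  then have "AE x in \<kappa>. x \<in> ?S \<longrightarrow> has_precise_value u x"
  proof eventually_elim
    case (elim x)
    show ?case
    proof
      assume S: "x \<in> ?S"
      obtain L :: nat where "norm x < real L" using reals_Archimedean2 by blast
      with elim S have "T x < \<infinity>" by auto
      then show "has_precise_value u x"
        using has_precise_value_if_summable[OF u \<alpha> \<delta>(1), of x] by (simp add: T_def s_def n_def)
    qed
  qed
  then show ?thesis by (simp add: n_def)
qed

section \<open>Ball averages as mollifiers\<close>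

lemma measure_lborel_ball:
  "0 \<le> r \<Longrightarrow> measure lborel (ball (x::real^'n) r) = unit_ball_vol (real CARD('n)) * r ^ CARD('n)"
  by (simp add: content_ball)

lemma integrable_bounded_support:
  fixes u :: "real^'n \<Rightarrow> real"
  assumes [measurable]: "u \<in> borel_measurable borel" and B: "\<And>y. \<bar>u y\<bar> \<le> B" and out: "\<And>y. y \<notin> ball a r \<Longrightarrow> u y = 0"
  shows "integrable lborel u"
proof (rule Bochner_Integration.integrable_bound)
  show "integrable lborel (\<lambda>y. B * indicat_real (ball a r) y)"
    using emeasure_lborel_ball_finite[of a r] by (intro integrable_mult_right integrable_real_indicator) auto
  show "AE y in lborel. norm (u y) \<le> norm (B * indicat_real (ball a r) y)"
    using B out by (auto simp: indicator_def intro: order_trans[OF _ abs_ge_self])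
qed measurable

lemma locally_integrable_bounded:
  assumes [measurable]: "u \<in> borel_measurable borel" and B: "\<And>x. \<bar>u x\<bar> \<le> B"
  shows "locally_integrable u"
  unfolding locally_integrable_def set_integrable_def
proof (intro conjI allI)
  fix x r
  have "0 \<le> B" using B[of x] by linarith
  then show "integrable lborel (\<lambda>y. indicator (ball x r) y *\<^sub>R u y)"
    by (intro integrable_bounded_support[where B=B and a=x and r=r])
       (auto simp: indicator_def B intro!: borel_measurable_times borel_measurable_indicator)
qed fact

lemma locally_integrable_integrable:
  assumes "integrable lborel u" "u \<in> borel_measurable borel"
  shows "locally_integrable u"
  using assms unfolding locally_integrable_def set_integrable_def
  by (auto intro!: integrable_mult_indicator simp del: real_scaleR_def)

lemma ball_average_diff_cmult:
  assumes u: "locally_integrable u" and w: "locally_integrable w"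
  shows "ball_average (\<lambda>y. u y - c * w y) x r = ball_average u x r - c * ball_average w x r"
proof -
  have int: "set_integrable lborel (ball x r) u" "set_integrable lborel (ball x r) w"
    and [measurable]: "u \<in> borel_measurable borel" "w \<in> borel_measurable borel"
    using u w by (auto simp: locally_integrable_def)
  have "(LINT y:ball x r|lborel. u y - c * w y) = (LINT y:ball x r|lborel. u y) - c * (LINT y:ball x r|lborel. w y)"
    using int by (subst set_integral_diff) auto
  then show ?thesis by (simp add: ball_average_lborel diff_divide_distrib)
qed

lemma abs_ball_average_le:
  fixes u :: "real^'n \<Rightarrow> real"
  assumes [measurable]: "u \<in> borel_measurable borel" and B: "\<And>y. y \<in> ball x r \<Longrightarrow> \<bar>u y\<bar> \<le> B" and r: "0 < r"
  shows "\<bar>ball_average u x r\<bar> \<le> B"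
proof -
  \<comment> \<open>Setting \<open>u\<close> to 0 outside the ball makes it bounded everywhere,
    hence locally integrable, without changing this average.\<close>
  define u' where "u' y = indicator (ball x r) y * u y" for y
  have B0: "0 \<le> B" using B[of x] r by force
  have [measurable]: "u' \<in> borel_measurable borel" unfolding u'_def
    by (intro borel_measurable_times borel_measurable_indicator) auto
  have u': "locally_integrable u'"
    by (rule locally_integrable_bounded[where B=B]) (use B B0 in \<open>auto simp: u'_def indicator_def\<close>)
  have eq: "ball_average u x r = ball_average u' x r"
    unfolding ball_average_def set_lebesgue_integral_def u'_def
    by (intro arg_cong2[where f="(/)"] Bochner_Integration.integral_cong) (auto simp: indicator_def)
  have "ennreal \<bar>ball_average u' x r - 0\<bar> * emeasure lborel (ball x r) \<le> (\<integral>\<^sup>+y. ennreal \<bar>u' y - 0\<bar> * indicator (ball x r) y \<partial>lborel)"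
    by (rule ball_average_deviation[OF u' r])
  also have "\<dots> \<le> (\<integral>\<^sup>+y. ennreal B * indicator (ball x r) y \<partial>lborel)"
    using B by (intro nn_integral_mono) (auto simp: u'_def indicator_def intro: ennreal_leI)
  also have "\<dots> = ennreal B * emeasure lborel (ball x r)" by (intro nn_integral_cmult_indicator) auto
  finally have le: "ennreal \<bar>ball_average u' x r\<bar> * emeasure lborel (ball x r) \<le> ennreal B * emeasure lborel (ball x r)" by simp
  have "emeasure lborel (ball x r) = ennreal (unit_ball_vol (real CARD('n)) * r ^ CARD('n))"
    using r by (simp add: emeasure_ball)
  moreover have "0 < unit_ball_vol (real CARD('n)) * r ^ CARD('n)" using r by simp
  ultimately have "ennreal (\<bar>ball_average u' x r\<bar> * (unit_ball_vol (real CARD('n)) * r ^ CARD('n))) \<le> ennreal (B * (unit_ball_vol (real CARD('n)) * r ^ CARD('n)))"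
    using le B0 by (simp only: ennreal_mult'[OF abs_ge_zero] ennreal_mult'[OF B0])
  then show ?thesis using B0 r unfolding eq by (subst (asm) ennreal_le_iff) auto
qed

lemma ball_average_eq_0:
  assumes "\<And>y. y \<in> ball x r \<Longrightarrow> u y = 0" shows "ball_average u x r = 0"
proof -
  have "(LINT y:ball x r|lebesgue. u y) = (LINT y:ball x r|lebesgue. 0)"
    unfolding set_lebesgue_integral_def using assms by (intro Bochner_Integration.integral_cong) (auto simp: indicator_def)
  then show ?thesis by (simp add: ball_average_def)
qed

text \<open>With \<open>d\<close> the distance of the centres, the integrals differ only on the
  symmetric difference of the balls. Their intersection contains \<open>ball x (r - d)\<close>, and
  Bernoulli's inequality bounds the missing fraction of the volume by \<open>n * d / r\<close>. For
  \<open>d > r\<close> the trivial bound \<open>2 * B\<close> suffices.\<close>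

lemma ball_average_lipschitz:
  fixes u :: "real^'n \<Rightarrow> real"
  assumes [measurable]: "u \<in> borel_measurable borel" and B: "\<And>x. \<bar>u x\<bar> \<le> B" and r: "0 < r"
  shows "\<bar>ball_average u x r - ball_average u y r\<bar> \<le> 2 * B * real CARD('n) / r * norm (x - y)"
proof -
  define n where "n = CARD('n)"
  have n1: "1 \<le> real n" by (simp add: n_def Suc_leI)
  define d where "d = norm (x - y)"
  have B0: "0 \<le> B" using B[of 0] by linarith
  have d0: "0 \<le> d" by (simp add: d_def)
  show ?thesis
  proof (cases "d \<le> r")
    case False
    have "\<bar>ball_average u x r - ball_average u y r\<bar> \<le> 2 * B"
      using abs_ball_average_le[of u x r B] abs_ball_average_le[of u y r B] B r by fastforce
    also have "\<dots> \<le> 2 * B * (real n * (d / r))"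
    proof -
      have "1 \<le> d / r" using False r by simp
      then have "1 * 1 \<le> real n * (d / r)" using n1 by (intro mult_mono) auto
      then show ?thesis using mult_left_mono[of 1 "real n * (d / r)" "2 * B"] B0 by simp
    qed
    finally show ?thesis by (simp add: n_def d_def mult.assoc)
  next
    case True
    define \<omega> where "\<omega> = unit_ball_vol (real n)"
    have \<omega>: "0 < \<omega>" by (simp add: \<omega>_def)
    let ?V = "\<lambda>r. \<omega> * r ^ n"
    have V: "measure lborel (ball z t) = ?V t" if "0 \<le> t" for z :: "real^'n" and t
      using that by (simp add: measure_lborel_ball \<omega>_def n_def)
    have fin: "emeasure lborel (ball z t) < \<infinity>" for z :: "real^'n" and t
      using emeasure_lborel_ball_finite[of z t] by simp
    have int: "integrable lborel (\<lambda>z. indicator (ball w r) z *\<^sub>R u z)" for w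
      using locally_integrable_bounded[of u B] B unfolding locally_integrable_def set_integrable_def by auto
    have inter: "?V (r - d) \<le> measure lborel (ball x r \<inter> ball y r)"
    proof -
      have "?V (r - d) = measure lborel (ball x (r - d))" using True by (simp add: V)
      also have "\<dots> \<le> measure lborel (ball x r \<inter> ball y r)"
      proof (rule measure_mono_fmeasurable)
        show "ball x (r - d) \<subseteq> ball x r \<inter> ball y r"
        proof
          fix z assume z: "z \<in> ball x (r - d)"
          have "dist y z \<le> d + dist x z" using dist_triangle[of y z x] by (simp add: d_def dist_norm norm_minus_commute)
          then show "z \<in> ball x r \<inter> ball y r" using z d0 by simp
        qed
        show "ball x r \<inter> ball y r \<in> fmeasurable lborel"
          using fin[of x r] by (intro fmeasurable_Int_fmeasurable[of "ball x r"] fmeasurableI) auto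
      qed auto
      finally show ?thesis .
    qed
    have bern: "r ^ n - (r - d) ^ n \<le> r ^ n * (real n * d / r)"
    proof -
      have "1 + real n * (- d / r) \<le> (1 + (- d / r)) ^ n"
        using True r by (intro Bernoulli_inequality) (simp add: field_simps)
      then have "r ^ n * (1 + real n * (- d / r)) \<le> r ^ n * (1 + (- d / r)) ^ n"
        using r by (intro mult_left_mono) auto
      also have "\<dots> = (r - d) ^ n"
        using r by (simp add: power_mult_distrib[symmetric] field_simps)
      finally show ?thesis by (simp add: algebra_simps)
    qed
    have "(ball_average u x r - ball_average u y r) * ?V r = (LINT z|lborel. indicator (ball x r) z *\<^sub>R u z) - (LINT z|lborel. indicator (ball y r) z *\<^sub>R u z)"
      using r \<omega> by (simp add: ball_average_lborel V set_lebesgue_integral_def left_diff_distrib)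
    also have "\<dots> = (LINT z|lborel. indicator (ball x r) z *\<^sub>R u z - indicator (ball y r) z *\<^sub>R u z)"
      using int by simp
    finally have "\<bar>ball_average u x r - ball_average u y r\<bar> * ?V r = \<bar>(LINT z|lborel. indicator (ball x r) z *\<^sub>R u z - indicator (ball y r) z *\<^sub>R u z)\<bar>"
      using \<omega> r by (metis abs_mult abs_of_pos mult_pos_pos zero_less_power)
    also have "\<dots> \<le> (LINT z|lborel. B * (indicator (ball x r) z + indicator (ball y r) z - 2 * indicator (ball x r \<inter> ball y r) z))"
    proof (rule integral_abs_bound[THEN order_trans], rule integral_mono)
      show "\<bar>indicator (ball x r) z *\<^sub>R u z - indicator (ball y r) z *\<^sub>R u z\<bar>
        \<le> B * (indicator (ball x r) z + indicator (ball y r) z - 2 * indicator (ball x r \<inter> ball y r) z)" for z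
        using B[of z] B0 by (auto simp: indicator_def)
    next
      have "emeasure lborel (ball x r \<inter> ball y r) < \<infinity>"
        using fin[of x r] by (rule le_less_trans[rotated]) (auto intro: emeasure_mono)
      then show "integrable lborel (\<lambda>z. B * (indicator (ball x r) z + indicator (ball y r) z - 2 * indicator (ball x r \<inter> ball y r) z))"
        using fin[of x r] fin[of y r]
        by (intro integrable_mult_right Bochner_Integration.integrable_diff Bochner_Integration.integrable_add integrable_real_indicator) auto
    qed (use int in auto)
    also have "\<dots> = B * (?V r + ?V r - 2 * measure lborel (ball x r \<inter> ball y r))"
    proof -
      have f3: "emeasure lborel (ball x r \<inter> ball y r) < \<infinity>"
        using fin[of x r] by (rule le_less_trans[rotated]) (auto intro: emeasure_mono)
      have i: "integrable lborel (indicat_real (ball x r))" "integrable lborel (indicat_real (ball y r))"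
          "integrable lborel (indicat_real (ball x r \<inter> ball y r))"
        using fin[of x r] fin[of y r] f3 by (auto intro!: integrable_real_indicator)
      have "(LINT z|lborel. (indicat_real (ball x r) z + indicator (ball y r) z - 2 * indicator (ball x r \<inter> ball y r) z))
        = (LINT z|lborel. indicat_real (ball x r) z) + (LINT z|lborel. indicator (ball y r) z) - 2 * (LINT z|lborel. indicator (ball x r \<inter> ball y r) z)"
        using i by (subst Bochner_Integration.integral_diff) auto
      then show ?thesis using r by (simp add: V)
    qed
    also have "\<dots> \<le> B * (2 * (\<omega> * (r ^ n * (real n * d / r))))"
    proof (intro mult_left_mono B0)
      have "\<omega> * (r ^ n - (r - d) ^ n) \<le> \<omega> * (r ^ n * (real n * d / r))"
        using bern \<omega> by (intro mult_left_mono) auto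
      then show "?V r + ?V r - 2 * measure lborel (ball x r \<inter> ball y r) \<le> 2 * (\<omega> * (r ^ n * (real n * d / r)))"
        using inter by (simp add: right_diff_distrib)
    qed
    also have "\<dots> = (2 * B * real n / r * d) * ?V r" by simp
    finally have "\<bar>ball_average u x r - ball_average u y r\<bar> * ?V r \<le> (2 * B * real n / r * d) * ?V r" .
    moreover have "0 < ?V r" using \<omega> r by simp
    ultimately have "\<bar>ball_average u x r - ball_average u y r\<bar> \<le> 2 * B * real n / r * d"
      by (rule mult_right_le_imp_le)
    then show ?thesis by (simp only: n_def d_def)
  qed
qed

lemma ball_average_lipschitz_on:
  fixes u :: "real^'n \<Rightarrow> real"
  assumes "u \<in> borel_measurable borel" "\<And>x. \<bar>u x\<bar> \<le> B" "0 < r"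
  shows "(2 * B * real CARD('n) / r)-lipschitz_on UNIV (\<lambda>x. ball_average u x r)"
proof (rule lipschitz_onI)
  show "dist (ball_average u x r) (ball_average u y r) \<le> 2 * B * real CARD('n) / r * dist x y" for x y
    unfolding dist_norm real_norm_def by (rule ball_average_lipschitz[OF assms])
  show "0 \<le> 2 * B * real CARD('n) / r" using assms(2)[of 0] assms(3) by simp
qed

text \<open>When centres converge, the indicators of the balls converge off the limiting sphere,
  which is a null set; dominated convergence applies with \<open>\<bar>u y\<bar>\<close>.\<close>

lemma ball_average_continuous:
  fixes u :: "real^'n \<Rightarrow> real"
  assumes u: "integrable lborel u" and [measurable]: "u \<in> borel_measurable borel"
  shows "continuous_on UNIV (\<lambda>x. ball_average u x r)"
proof -
  have "(\<lambda>j. LINT y|lborel. indicator (ball (X j) r) y *\<^sub>R u y) \<longlonglongrightarrow> (LINT y|lborel. indicator (ball x r) y *\<^sub>R u y)"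
    if X: "X \<longlonglongrightarrow> x" for X and x :: "real^'n"
  proof (rule integral_dominated_convergence)
    show "integrable lborel (\<lambda>y. \<bar>u y\<bar>)" using u by simp
    have "AE y in lborel. y \<notin> sphere x r"
      using negligible_sphere[of x r] AE_not_in[of "sphere x r" lebesgue]
      by (simp add: negligible_iff_null_sets AE_completion_iff)
    then show "AE y in lborel. (\<lambda>j. indicator (ball (X j) r) y *\<^sub>R u y) \<longlonglongrightarrow> indicator (ball x r) y *\<^sub>R u y"
    proof eventually_elim
      case (elim y)
      have lim: "(\<lambda>j. dist (X j) y) \<longlonglongrightarrow> dist x y" using X by (intro tendsto_dist tendsto_const)
      have "eventually (\<lambda>j. (y \<in> ball (X j) r) = (y \<in> ball x r)) sequentially"
      proof (cases "dist x y < r")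
        case True
        then show ?thesis using order_tendstoD(2)[OF lim, of r] by (auto elim: eventually_mono)
      next
        case False
        then show ?thesis using elim order_tendstoD(1)[OF lim, of r] by (auto elim!: eventually_mono)
      qed
      then have "eventually (\<lambda>j. indicator (ball (X j) r) y *\<^sub>R u y = indicator (ball x r) y *\<^sub>R u y) sequentially"
        by eventually_elim (auto simp: indicator_def)
      then show ?case by (rule tendsto_eventually)
    qed
  qed (auto simp: indicator_def intro!: borel_measurable_times borel_measurable_indicator)
  moreover define m where "m = measure lborel (ball (0::real^'n) r)"
  have m: "measure lborel (ball z r) = m" for z :: "real^'n"
    unfolding m_def by (cases "0 \<le> r") (auto simp: content_ball ball_empty not_le less_imp_le)
  ultimately have "(\<lambda>j. ball_average u (X j) r) \<longlonglongrightarrow> ball_average u x r" if "X \<longlonglongrightarrow> x" for X and x :: "real^'n"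
    unfolding ball_average_lborel[OF assms(2)] set_lebesgue_integral_def divide_inverse m
    using that by (intro tendsto_mult tendsto_const) blast
  then show ?thesis by (auto simp: continuous_on_sequentially comp_def)
qed

text \<open>Averaging is a mean over translations by \<open>h\<close> in \<open>ball 0 r\<close>,
  and Tonelli's theorem moves the norm inside. The comparison function \<open>c\<close> is 0 for
  contraction in \<open>L1\<close> and \<open>u\<close> for the rate of approximation.\<close>

lemma ball_average_L1:
  fixes u :: "real^'n \<Rightarrow> real"
  assumes u: "locally_integrable u" and r: "0 < r" and c[measurable]: "c \<in> borel_measurable borel"
  shows "(\<integral>\<^sup>+x. ennreal \<bar>ball_average u x r - c x\<bar> \<partial>lborel) * ennreal (unit_ball_vol (real CARD('n)) * r ^ CARD('n))
    \<le> (\<integral>\<^sup>+h. (\<integral>\<^sup>+x. ennreal \<bar>u (x + h) - c x\<bar> \<partial>lborel) * indicator (ball 0 r) h \<partial>lborel)"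
proof -
  let ?I = "\<lambda>x. \<integral>\<^sup>+h. ennreal \<bar>u (x + h) - c x\<bar> * indicator (ball 0 r) h \<partial>lborel"
  let ?J = "\<integral>\<^sup>+h. (\<integral>\<^sup>+x. ennreal \<bar>u (x + h) - c x\<bar> \<partial>lborel) * indicator (ball 0 r) h \<partial>lborel"
  have [measurable]: "u \<in> borel_measurable borel" using u by (auto simp: locally_integrable_def)
  let ?V = "ennreal (unit_ball_vol (real CARD('n)) * r ^ CARD('n))"
  have V0: "unit_ball_vol (real CARD('n)) * r ^ CARD('n) > 0" using r by simp
  have inv: "inverse ?V * ?V = 1"
  proof -
    have "inverse ?V * ?V = ennreal (inverse (unit_ball_vol (real CARD('n)) * r ^ CARD('n)) * (unit_ball_vol (real CARD('n)) * r ^ CARD('n)))"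
      unfolding inverse_ennreal[OF V0] using V0 by (intro ennreal_mult''[symmetric]) linarith
    then show ?thesis using V0 by (simp only: left_inverse less_imp_neq[OF V0, symmetric] not_False_eq_True ennreal_1)
  qed
  have inner: "ennreal \<bar>ball_average u x r - c x\<bar> * ?V \<le> ?I x" for x
  proof -
    have "ennreal \<bar>ball_average u x r - c x\<bar> * ?V \<le> (\<integral>\<^sup>+y. ennreal \<bar>u y - c x\<bar> * indicator (ball x r) y \<partial>lborel)"
      using ball_average_deviation[OF u r, of x "c x"] r by (simp add: emeasure_ball)
    also have "\<dots> = (\<integral>\<^sup>+h. ennreal \<bar>u (h + x) - c x\<bar> * indicator (ball x r) (h + x) \<partial>lborel)"
      by (rule nn_integral_lborel_shift[where f="\<lambda>y. ennreal \<bar>u y - c x\<bar> * indicator (ball x r) y", symmetric])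
         (auto intro!: borel_measurable_times_ennreal borel_measurable_indicator)
    also have "\<dots> = ?I x"
      by (intro nn_integral_cong) (auto simp: indicator_def dist_norm add.commute)
    finally show ?thesis .
  qed
  have ball[measurable]: "ball (0::real^'n) r \<in> sets borel" by auto
  have "(\<integral>\<^sup>+x. ennreal \<bar>ball_average u x r - c x\<bar> \<partial>lborel) \<le> (\<integral>\<^sup>+x. inverse ?V * ?I x \<partial>lborel)"
  proof (intro nn_integral_mono)
    fix x
    have "ennreal \<bar>ball_average u x r - c x\<bar> = (inverse ?V * ?V) * ennreal \<bar>ball_average u x r - c x\<bar>"
      by (simp only: inv mult_1_left)
    also have "\<dots> = inverse ?V * (ennreal \<bar>ball_average u x r - c x\<bar> * ?V)"
      by (simp only: mult_ac)

    also have "\<dots> \<le> inverse ?V * ?I x"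
      by (intro mult_left_mono inner) auto
    finally show "ennreal \<bar>ball_average u x r - c x\<bar> \<le> inverse ?V * ?I x" .
  qed
  also have "\<dots> = inverse ?V * (\<integral>\<^sup>+x. ?I x \<partial>lborel)"
    by (intro nn_integral_cmult) measurable
  also have "(\<integral>\<^sup>+x. ?I x \<partial>(lborel::(real^'n) measure))
      = (\<integral>\<^sup>+h. (\<integral>\<^sup>+x. ennreal \<bar>u (x + h) - c x\<bar> * indicator (ball 0 r) h \<partial>lborel) \<partial>lborel)"
    by (rule lborel_pair.Fubini') measurable
  also have "\<dots> = ?J"
    by (intro nn_integral_cong nn_integral_multc) measurable
  finally have "(\<integral>\<^sup>+x. ennreal \<bar>ball_average u x r - c x\<bar> \<partial>lborel) * ?V
    \<le> inverse ?V * ?J * ?V"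
    by (intro mult_right_mono) auto
  also have "\<dots> = ?J * (inverse ?V * ?V)"
    by (simp only: mult_ac)
  finally show ?thesis by (simp only: inv mult_1_right)
qed

lemma ennreal_le_divide_right:
  assumes "X * ennreal v \<le> Y" "0 < v"
  shows "X \<le> ennreal (1 / v) * Y"
proof -
  have "X = X * (ennreal v * ennreal (1 / v))"
    using assms(2) by (subst ennreal_mult'[symmetric]) auto
  also have "\<dots> = ennreal (1 / v) * (X * ennreal v)" by (simp only: mult_ac)
  also have "\<dots> \<le> ennreal (1 / v) * Y" by (intro mult_left_mono assms) auto
  finally show ?thesis .
qed

lemma ball_average_L1_le:
  fixes u :: "real^'n \<Rightarrow> real"
  assumes u: "locally_integrable u" and r: "0 < r"
  shows "(\<integral>\<^sup>+x. ennreal \<bar>ball_average u x r\<bar> \<partial>lborel) \<le> (\<integral>\<^sup>+x. ennreal \<bar>u x\<bar> \<partial>lborel)"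
proof -
  have [measurable]: "u \<in> borel_measurable borel" using u by (auto simp: locally_integrable_def)
  let ?v = "unit_ball_vol (real CARD('n)) * r ^ CARD('n)" and ?I = "\<integral>\<^sup>+x. ennreal \<bar>u x\<bar> \<partial>lborel"
  have v: "0 < ?v" using r by simp
  have r0: "r \<noteq> 0" using r by simp
  have "(\<integral>\<^sup>+x. ennreal \<bar>ball_average u x r - 0\<bar> \<partial>lborel) * ennreal ?v
    \<le> (\<integral>\<^sup>+h. (\<integral>\<^sup>+x. ennreal \<bar>u (x + h) - 0\<bar> \<partial>lborel) * indicator (ball 0 r) h \<partial>lborel)"
    by (rule ball_average_L1[OF u r]) simp
  also have "\<dots> = (\<integral>\<^sup>+h. ?I * indicator (ball (0::real^'n) r) h \<partial>lborel)"
    using nn_integral_lborel_shift[where f="\<lambda>x. ennreal \<bar>u x\<bar>"] by simp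
  also have "\<dots> = ?I * ennreal ?v"
    using r by (subst nn_integral_cmult_indicator) (auto simp: emeasure_ball)
  finally have "(\<integral>\<^sup>+x. ennreal \<bar>ball_average u x r - 0\<bar> \<partial>lborel) \<le> ennreal (1 / ?v) * (?I * ennreal ?v)"
    by (rule ennreal_le_divide_right[OF _ v])
  also have "\<dots> = (ennreal (1 / ?v) * ennreal ?v) * ?I" by (simp only: mult_ac)
  also have "ennreal (1 / ?v) * ennreal ?v = 1"
    using v r0 by (subst ennreal_mult'[symmetric]) auto
  finally show ?thesis by simp
qed

text \<open>For increments shorter than \<open>r\<close> the kernel is at least
  \<open>r powr (- (n + \<alpha>))\<close>, so the translation errors over \<open>ball 0 r\<close>
  integrate to at most \<open>r powr (n + \<alpha>)\<close> times the energy; dividing by the volume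
  leaves \<open>r powr \<alpha>\<close>.\<close>

lemma ball_average_L1_gagliardo:
  fixes u :: "real^'n \<Rightarrow> real"
  assumes u: "locally_integrable u" and r: "0 < r" and \<alpha>: "0 < \<alpha>"
  shows "(\<integral>\<^sup>+x. ennreal \<bar>ball_average u x r - u x\<bar> \<partial>lborel)
    \<le> ennreal (r powr \<alpha> / unit_ball_vol (real CARD('n))) * gagliardo \<alpha> u"
proof -
  have [measurable]: "u \<in> borel_measurable borel" using u by (auto simp: locally_integrable_def)
  let ?\<omega> = "unit_ball_vol (real CARD('n))"
  let ?v = "?\<omega> * r ^ CARD('n)" and ?e = "real CARD('n) + \<alpha>"
  have v: "0 < ?v" using r by simp
  have "(\<integral>\<^sup>+x. ennreal \<bar>ball_average u x r - u x\<bar> \<partial>lborel) * ennreal ?v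
    \<le> (\<integral>\<^sup>+h. shift_diff u h * indicator (ball 0 r) h \<partial>lborel)"
    unfolding shift_diff_def by (rule ball_average_L1[OF u r]) simp
  also have "\<dots> \<le> (\<integral>\<^sup>+h. ennreal (r powr ?e) * (ennreal (riesz_kernel \<alpha> h) * shift_diff u h) \<partial>lborel)"
  proof (intro nn_integral_mono)
    fix h :: "real^'n"
    show "shift_diff u h * indicator (ball 0 r) h \<le> ennreal (r powr ?e) * (ennreal (riesz_kernel \<alpha> h) * shift_diff u h)"
    \<comment> \<open>At \<open>h = 0\<close> the kernel is 0 by the convention for
      \<open>powr\<close>, but the increment vanishes as well.\<close>
    proof (cases "h = 0 \<or> h \<notin> ball 0 r")
      case True
      then show ?thesis by (auto simp: shift_diff_def)
    next
      case False
      then have h: "0 < norm h" "norm h < r" by auto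
      have "1 \<le> r powr ?e * riesz_kernel \<alpha> h"
      proof -
        have "norm h powr ?e \<le> r powr ?e" using h \<alpha> by (intro powr_mono2) auto
        moreover have "riesz_kernel \<alpha> h = 1 / norm h powr ?e"
          unfolding riesz_kernel_def by (rule powr_minus_divide)
        ultimately show ?thesis using h by simp
      qed
      then have "ennreal 1 * shift_diff u h \<le> ennreal (r powr ?e * riesz_kernel \<alpha> h) * shift_diff u h"
        by (intro mult_right_mono ennreal_leI) auto
      then show ?thesis using False by (simp add: ennreal_mult' mult.assoc)
    qed
  qed
  also have "\<dots> = ennreal (r powr ?e) * gagliardo \<alpha> u"
    unfolding gagliardo_def by (intro nn_integral_cmult) measurable
  finally have "(\<integral>\<^sup>+x. ennreal \<bar>ball_average u x r - u x\<bar> \<partial>lborel) \<le> ennreal (1 / ?v) * (ennreal (r powr ?e) * gagliardo \<alpha> u)"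
    by (rule ennreal_le_divide_right[OF _ v])
  also have "\<dots> = ennreal (1 / ?v * r powr ?e) * gagliardo \<alpha> u"
    using v by (subst ennreal_mult') (auto simp: mult.assoc)
  also have "1 / ?v * r powr ?e = r powr \<alpha> / ?\<omega>"
    using r by (simp add: powr_add powr_realpow)
  finally show ?thesis .
qed

lemma integrable_lborel_shift:
  fixes f :: "'a::euclidean_space \<Rightarrow> real"
  assumes "integrable lborel f" and [measurable]: "f \<in> borel_measurable borel"
  shows "integrable lborel (\<lambda>x. f (x + h))"
  using assms nn_integral_lborel_shift[of "\<lambda>x. ennreal \<bar>f x\<bar>" h]
  by (simp add: integrable_iff_bounded)

lemma ball_average_shift:
  fixes u :: "real^'n \<Rightarrow> real"
  assumes [measurable]: "u \<in> borel_measurable borel"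
  shows "ball_average u (x + h) r = ball_average (\<lambda>y. u (y + h)) x r"
proof -
  have "(LINT y|lborel. indicator (ball (x + h) r) y *\<^sub>R u y) = (LINT y|lborel. indicator (ball (x + h) r) (y + h) *\<^sub>R u (y + h))"
    by (rule integral_lborel_shift[where f="\<lambda>y. indicator (ball (x + h) r) y *\<^sub>R u y", symmetric])
       (auto intro!: borel_measurable_times borel_measurable_indicator)
  also have "(\<lambda>y. indicator (ball (x + h) r) (y + h) *\<^sub>R u (y + h)) = (\<lambda>y. indicator (ball x r) y *\<^sub>R u (y + h))"
    by (auto simp: indicator_def dist_norm)
  moreover have "measure lborel (ball (x + h) r) = measure lborel (ball x r)"
    by (cases "0 \<le> r") (auto simp: content_ball ball_empty not_le less_imp_le)
  ultimately show ?thesis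
    by (simp add: ball_average_lborel set_lebesgue_integral_def)
qed

text \<open>Dominated convergence in \<open>h\<close>. Averaging commutes with translations and
  contracts the \<open>L1\<close> norm, so the increments of the error are at most twice those of
  \<open>u\<close>; for fixed \<open>h\<close> they vanish in the limit because the error itself
  tends to 0 in \<open>L1\<close>.\<close>

lemma gagliardo_ball_average_tendsto:
  fixes u :: "real^'n \<Rightarrow> real"
  assumes u: "integrable lborel u" and [measurable]: "u \<in> borel_measurable borel"
    and \<alpha>: "0 < \<alpha>" and fin: "gagliardo \<alpha> u < \<infinity>"
    and r: "\<And>k. 0 < r k" "r \<longlonglongrightarrow> 0"
  shows "(\<lambda>k. gagliardo \<alpha> (\<lambda>x. ball_average u x (r k) - u x)) \<longlonglongrightarrow> 0"
proof -
  have li: "locally_integrable u" using u by (intro locally_integrable_integrable) auto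
  have [measurable]: "(\<lambda>x. ball_average u x t) \<in> borel_measurable borel" for t
    by (rule borel_measurable_continuous_onI, rule ball_average_continuous[OF u]) auto
  let ?w = "\<lambda>k x. ball_average u x (r k) - u x"
  obtain G where G: "gagliardo \<alpha> u = ennreal G" "0 \<le> G" using fin by (cases "gagliardo \<alpha> u") auto
  have dom: "shift_diff (?w k) h \<le> 2 * shift_diff u h" for k h
  proof -
    have "shift_diff (?w k) h \<le> (\<integral>\<^sup>+x. ennreal \<bar>ball_average u (x + h) (r k) - ball_average u x (r k)\<bar> + ennreal \<bar>u (x + h) - u x\<bar> \<partial>lborel)"
      unfolding shift_diff_def by (intro nn_integral_mono) (simp flip: ennreal_plus)
    also have "\<dots> = (\<integral>\<^sup>+x. ennreal \<bar>ball_average u (x + h) (r k) - ball_average u x (r k)\<bar> \<partial>lborel) + shift_diff u h"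
      unfolding shift_diff_def by (intro nn_integral_add) measurable
    also have "(\<integral>\<^sup>+x. ennreal \<bar>ball_average u (x + h) (r k) - ball_average u x (r k)\<bar> \<partial>lborel)
       = (\<integral>\<^sup>+x. ennreal \<bar>ball_average (\<lambda>y. u (y + h) - 1 * u y) x (r k)\<bar> \<partial>lborel)"
      by (subst ball_average_diff_cmult)
         (auto simp: ball_average_shift li intro!: locally_integrable_integrable integrable_lborel_shift u)
    also have "\<dots> \<le> (\<integral>\<^sup>+x. ennreal \<bar>u (x + h) - 1 * u x\<bar> \<partial>lborel)"
      using r by (intro ball_average_L1_le locally_integrable_integrable Bochner_Integration.integrable_diff integrable_lborel_shift integrable_mult_right u) auto
    finally show ?thesis by (simp add: shift_diff_def mult_2 add_right_mono)
  qed
  have lim: "(\<lambda>k. shift_diff (?w k) h) \<longlonglongrightarrow> 0" for h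
  proof (rule tendsto_sandwich[OF _ _ tendsto_const])
    show "eventually (\<lambda>k. shift_diff (?w k) h \<le> ennreal (2 * (r k powr \<alpha> / unit_ball_vol (real CARD('n)) * G))) sequentially"
    proof (intro always_eventually allI)
      fix k
      have "shift_diff (?w k) h \<le> 2 * (\<integral>\<^sup>+x. ennreal \<bar>?w k x\<bar> \<partial>lborel)"
        by (rule shift_diff_le_integral) measurable
      also have "\<dots> \<le> 2 * (ennreal (r k powr \<alpha> / unit_ball_vol (real CARD('n))) * gagliardo \<alpha> u)"
        by (intro mult_left_mono ball_average_L1_gagliardo li r \<alpha>) auto
      also have "\<dots> = ennreal (2 * (r k powr \<alpha> / unit_ball_vol (real CARD('n)) * G))"
      proof -
        have "ennreal (r k powr \<alpha> / unit_ball_vol (real CARD('n))) * ennreal G = ennreal (r k powr \<alpha> / unit_ball_vol (real CARD('n)) * G)"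
          by (rule ennreal_mult'[symmetric]) simp
        then show ?thesis unfolding G(1) by (simp only: ennreal_mult' ennreal_numeral zero_le_numeral)
      qed
      finally show "shift_diff (?w k) h \<le> ennreal (2 * (r k powr \<alpha> / unit_ball_vol (real CARD('n)) * G))" .
    qed
    have "(\<lambda>k. r k powr \<alpha>) \<longlonglongrightarrow> 0 powr \<alpha>"
      using \<alpha> r by (intro tendsto_powr2 tendsto_const) (auto simp: less_imp_le intro!: always_eventually)
    then have "(\<lambda>k. 2 * (r k powr \<alpha> / unit_ball_vol (real CARD('n)) * G)) \<longlonglongrightarrow> 2 * (0 / unit_ball_vol (real CARD('n)) * G)"
      using \<alpha> less_imp_neq[OF unit_ball_vol_pos[of "real CARD('n)"]]
      by (intro tendsto_mult tendsto_divide tendsto_const) auto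
    then show "(\<lambda>k. ennreal (2 * (r k powr \<alpha> / unit_ball_vol (real CARD('n)) * G))) \<longlonglongrightarrow> 0"
      using tendsto_ennrealI by fastforce
  qed auto
  have "(\<lambda>k. \<integral>\<^sup>+h. ennreal (riesz_kernel \<alpha> h) * shift_diff (?w k) h \<partial>lborel) \<longlonglongrightarrow> (\<integral>\<^sup>+h. 0 \<partial>(lborel :: (real^'n) measure))"
  proof (rule nn_integral_dominated_convergence[where w="\<lambda>h. 2 * (ennreal (riesz_kernel \<alpha> h) * shift_diff u h)"])
    show "AE h in lborel. ennreal (riesz_kernel \<alpha> h) * shift_diff (?w k) h \<le> 2 * (ennreal (riesz_kernel \<alpha> h) * shift_diff u h)" for k
    proof (intro AE_I2)
      fix h :: "real^'n"
      have "ennreal (riesz_kernel \<alpha> h) * shift_diff (?w k) h \<le> ennreal (riesz_kernel \<alpha> h) * (2 * shift_diff u h)"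
        by (intro mult_left_mono dom) auto
      then show "ennreal (riesz_kernel \<alpha> h) * shift_diff (?w k) h \<le> 2 * (ennreal (riesz_kernel \<alpha> h) * shift_diff u h)"
        by (simp only: mult.left_commute)
    qed
    have "(\<integral>\<^sup>+h. 2 * (ennreal (riesz_kernel \<alpha> h) * shift_diff u h) \<partial>lborel) = 2 * gagliardo \<alpha> u"
      unfolding gagliardo_def by (intro nn_integral_cmult) measurable
    then show "(\<integral>\<^sup>+h. 2 * (ennreal (riesz_kernel \<alpha> h) * shift_diff u h) \<partial>lborel) < \<infinity>"
      using fin by (simp add: ennreal_mult_less_top)
    show "AE h in lborel. (\<lambda>k. ennreal (riesz_kernel \<alpha> h) * shift_diff (?w k) h) \<longlonglongrightarrow> 0"
    proof (intro AE_I2)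
      fix h :: "real^'n"
      have "(\<lambda>k. ennreal (riesz_kernel \<alpha> h) * shift_diff (?w k) h) \<longlonglongrightarrow> ennreal (riesz_kernel \<alpha> h) * 0"
        by (intro ennreal_tendsto_cmult lim) simp
      then show "(\<lambda>k. ennreal (riesz_kernel \<alpha> h) * shift_diff (?w k) h) \<longlonglongrightarrow> 0" by simp
    qed
  qed measurable
  then show ?thesis by (simp add: gagliardo_def)
qed

text \<open>The Cauchy criterion at \<open>0+\<close> with tolerances and thresholds indexed by
  naturals. The non-strict inequality makes each condition closed in \<open>x\<close> once the
  averages are continuous, which is the form needed for measurability.\<close>

lemma has_precise_value_iff:
  fixes u :: "real^'n \<Rightarrow> real"
  shows "has_precise_value u x \<longleftrightarrow> (\<forall>k::nat. \<exists>m::nat. \<forall>r s. 0 < r \<longrightarrow> r < 1 / real (Suc m) \<longrightarrow> 0 < s \<longrightarrow> s < 1 / real (Suc m) \<longrightarrow>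
      \<bar>ball_average u x r - ball_average u x s\<bar> \<le> 1 / real (Suc k))" (is "_ \<longleftrightarrow> ?R")
proof
  assume "has_precise_value u x"
  then obtain l where l: "(ball_average u x \<longlongrightarrow> l) (at_right 0)" by (auto simp: has_precise_value_def)
  show ?R
  proof
    fix k :: nat
    have "eventually (\<lambda>r. dist (ball_average u x r) l < 1 / real (Suc k) / 2) (at_right 0)"
      by (rule tendstoD[OF l]) simp
    then obtain b where b: "0 < b" "\<And>r. 0 < r \<Longrightarrow> r < b \<Longrightarrow> dist (ball_average u x r) l < 1 / real (Suc k) / 2"
      by (auto simp: eventually_at_right[of 0 1])
    obtain m where m: "inverse (real (Suc m)) < b" using reals_Archimedean[OF b(1)] by auto
    show "\<exists>m::nat. \<forall>r s. 0 < r \<longrightarrow> r < 1 / real (Suc m) \<longrightarrow> 0 < s \<longrightarrow> s < 1 / real (Suc m) \<longrightarrow>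
      \<bar>ball_average u x r - ball_average u x s\<bar> \<le> 1 / real (Suc k)"
    proof (intro exI[of _ m] allI impI)
      fix r s :: real assume "0 < r" "r < 1 / real (Suc m)" "0 < s" "s < 1 / real (Suc m)"
      then have "dist (ball_average u x r) l < 1 / real (Suc k) / 2" "dist (ball_average u x s) l < 1 / real (Suc k) / 2"
        using m unfolding inverse_eq_divide by (intro b; linarith)+
      moreover have "\<bar>a - b\<bar> \<le> e" if "dist a l < e / 2" "dist b l < e / 2" for a b e :: real
        using that unfolding dist_real_def by linarith
      ultimately show "\<bar>ball_average u x r - ball_average u x s\<bar> \<le> 1 / real (Suc k)" by blast
    qed
  qed
next
  assume R: ?R
  \<comment> \<open>The index \<open>Suc (Suc j)\<close> makes the radius strictly less than
    \<open>1 / real (Suc m)\<close> for all \<open>m \<le> j\<close>.\<close>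
  define X where "X j = ball_average u x (1 / real (Suc (Suc j)))" for j
  have small: "1 / real (Suc (Suc j)) < 1 / real (Suc m)" if "m \<le> j" for j m
    using that by (simp add: field_simps)
  have "Cauchy X"
  proof (rule metric_CauchyI)
    fix e :: real assume "0 < e"
    then obtain k where k: "inverse (real (Suc k)) < e" using reals_Archimedean by auto
    obtain m where m: "\<And>r s. 0 < r \<Longrightarrow> r < 1 / real (Suc m) \<Longrightarrow> 0 < s \<Longrightarrow> s < 1 / real (Suc m) \<Longrightarrow>
      \<bar>ball_average u x r - ball_average u x s\<bar> \<le> 1 / real (Suc k)" using R by blast
    have "dist (X i) (X j) < e" if "m \<le> i" "m \<le> j" for i j
      using m[OF _ small[OF that(1)] _ small[OF that(2)]] k by (simp add: X_def dist_real_def inverse_eq_divide)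
    then show "\<exists>M. \<forall>m\<ge>M. \<forall>n\<ge>M. dist (X m) (X n) < e" by blast
  qed
  then obtain l where l: "X \<longlonglongrightarrow> l" by (auto dest!: Cauchy_convergent simp: convergent_def)
  have "(ball_average u x \<longlongrightarrow> l) (at_right 0)"
  proof (rule tendstoI)
    fix e :: real assume "0 < e"
    then obtain k where k: "inverse (real (Suc k)) < e" using reals_Archimedean by auto
    obtain m where m: "\<And>r s. 0 < r \<Longrightarrow> r < 1 / real (Suc m) \<Longrightarrow> 0 < s \<Longrightarrow> s < 1 / real (Suc m) \<Longrightarrow>
      \<bar>ball_average u x r - ball_average u x s\<bar> \<le> 1 / real (Suc k)" using R by blast
    have "\<bar>ball_average u x r - l\<bar> \<le> 1 / real (Suc k)" if "0 < r" "r < 1 / real (Suc m)" for r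
    proof (rule LIMSEQ_le_const2)
      show "(\<lambda>j. \<bar>ball_average u x r - X j\<bar>) \<longlonglongrightarrow> \<bar>ball_average u x r - l\<bar>"
        by (intro tendsto_rabs tendsto_diff tendsto_const l)
      show "\<exists>N. \<forall>j\<ge>N. \<bar>ball_average u x r - X j\<bar> \<le> 1 / real (Suc k)"
        using m[OF that _ small] by (auto simp: X_def)
    qed
    then have "\<bar>ball_average u x r - l\<bar> < e" if "0 < r" "r < 1 / real (Suc m)" for r
      using that k unfolding inverse_eq_divide by (meson le_less_trans)
    then show "eventually (\<lambda>r. dist (ball_average u x r) l < e) (at_right 0)"
      by (auto simp: eventually_at_right[of 0 1] dist_real_def intro!: exI[of _ "1 / real (Suc m)"])
  qed
  then show "has_precise_value u x" by (auto simp: has_precise_value_def)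
qed

lemma tendsto_precise_rep:
  assumes "has_precise_value u x"
  shows "(ball_average u x \<longlongrightarrow> precise_rep u x) (at_right 0)"
proof -
  obtain l where l: "(ball_average u x \<longlongrightarrow> l) (at_right 0)" using assms by (auto simp: has_precise_value_def)
  then have "Lim (at_right 0) (ball_average u x) = l" by (intro tendsto_Lim) auto
  with l assms show ?thesis by (simp add: precise_rep_def)
qed

lemma filterlim_inverse_Suc_at_right: "filterlim (\<lambda>j. 1 / real (Suc j)) (at_right 0) sequentially"
  using filterlim_compose[OF filterlim_inverse_at_right_top filterlim_compose[OF filterlim_real_sequentially filterlim_Suc]]
  by (simp add: inverse_eq_divide)

text \<open>The points with a precise value form a countable intersection of countable unions of
  closed sets; on this set the representative is the limit along the radii
  \<open>1 / real (Suc j)\<close>.\<close>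

lemma precise_rep_measurable:
  fixes u :: "real^'n \<Rightarrow> real"
  assumes cont: "\<And>r. 0 < r \<Longrightarrow> continuous_on UNIV (\<lambda>x. ball_average u x r)"
  shows "precise_rep u \<in> borel_measurable borel"
proof -
  have S: "{x. has_precise_value u x} \<in> sets borel"
  proof -
    \<comment> \<open>The intersection over uncountably many radii is harmless, because each
      condition is closed.\<close>
    let ?S = "\<lambda>m k. \<Inter>r\<in>{0<..<1 / real (Suc m)}. \<Inter>s\<in>{0<..<1 / real (Suc m)}. {x. \<bar>ball_average u x r - ball_average u x s\<bar> \<le> 1 / real (Suc k)}"
    have "closed (?S m k)" for m k :: nat
      by (intro closed_INT ballI closed_Collect_le continuous_on_rabs continuous_on_diff cont continuous_on_const) auto
    then have "?S m k \<in> sets borel" for m k :: nat by (rule borel_closed)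
    then have "(\<Inter>k. \<Union>m. ?S m k) \<in> sets borel"
      by (intro sets.countable_INT sets.countable_UN image_subsetI) auto
    also have "(\<Inter>k. \<Union>m. ?S m k) = {x. has_precise_value u x}"
    proof (rule set_eqI)
      show "x \<in> (\<Inter>k. \<Union>m. ?S m k) \<longleftrightarrow> x \<in> {x. has_precise_value u x}" for x
      proof -
        have "(\<forall>r\<in>{0<..<c}. \<forall>s\<in>{0<..<c}. P r s) \<longleftrightarrow> (\<forall>r s. 0 < r \<longrightarrow> r < c \<longrightarrow> 0 < s \<longrightarrow> s < c \<longrightarrow> P r s)"
          for c :: real and P by auto
        then show ?thesis
          unfolding mem_Collect_eq[of x "has_precise_value u"] has_precise_value_iff
          by (simp only: INT_iff UN_iff mem_Collect_eq ball_UNIV bex_UNIV)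
      qed
    qed
    finally show ?thesis .
  qed
  have "precise_rep u x = (if x \<in> {x. has_precise_value u x} then lim (\<lambda>j. ball_average u x (1 / real (Suc j))) else 0)" for x
  proof (cases "has_precise_value u x")
    case True
    have "(\<lambda>j. ball_average u x (1 / real (Suc j))) \<longlonglongrightarrow> precise_rep u x"
      by (rule filterlim_compose[OF tendsto_precise_rep[OF True] filterlim_inverse_Suc_at_right])
    then show ?thesis using True by (simp add: limI)
  qed (simp add: precise_rep_def)
  moreover have "(\<lambda>x. if x \<in> {x. has_precise_value u x} then lim (\<lambda>j. ball_average u x (1 / real (Suc j))) else 0) \<in> borel_measurable borel"
    by (intro measurable_If_set borel_measurable_lim_metric borel_measurable_continuous_onI cont measurable_const)
       (use S in auto)
  ultimately show ?thesis by (simp cong: measurable_cong)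
qed

lemma precise_rep_measurable_bounded:
  fixes u :: "real^'n \<Rightarrow> real"
  assumes "u \<in> borel_measurable borel" "\<And>x. \<bar>u x\<bar> \<le> B"
  shows "precise_rep u \<in> borel_measurable borel"
  by (rule precise_rep_measurable, rule lipschitz_on_continuous_on, rule ball_average_lipschitz_on[OF assms])

lemma abs_precise_rep_le:
  fixes u :: "real^'n \<Rightarrow> real"
  assumes "u \<in> borel_measurable borel" "\<And>x. \<bar>u x\<bar> \<le> B"
  shows "\<bar>precise_rep u x\<bar> \<le> B"
proof (cases "has_precise_value u x")
  case True
  have "((\<lambda>r. \<bar>ball_average u x r\<bar>) \<longlongrightarrow> \<bar>precise_rep u x\<bar>) (at_right 0)"
    by (intro tendsto_rabs tendsto_precise_rep True)
  then show ?thesis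
  proof (rule tendsto_upperbound)
    show "eventually (\<lambda>r. \<bar>ball_average u x r\<bar> \<le> B) (at_right 0)"
      using abs_ball_average_le[OF assms(1), of x _ B] assms(2) by (auto simp: eventually_at_right[of 0 1] intro!: exI[of _ 1])
  qed simp
next
  case False
  have "0 \<le> B" using assms(2)[of 0] by linarith
  with False show ?thesis by (simp add: precise_rep_def)
qed

text \<open>The averages of \<open>g y * (v y - v x)\<close> tend to 0 by continuity of
  \<open>v\<close> and boundedness of \<open>g\<close>; the constant \<open>v x\<close> then comes
  out of the average of \<open>g\<close>.\<close>

lemma tendsto_ball_average_mult:
  fixes g v :: "real^'n \<Rightarrow> real"
  assumes [measurable]: "g \<in> borel_measurable borel" and B: "\<And>x. \<bar>g x\<bar> \<le> B"
    and v: "continuous_on UNIV v" "\<And>x. \<bar>v x\<bar> \<le> M" and x: "has_precise_value g x"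
  shows "(ball_average (\<lambda>y. g y * v y) x \<longlongrightarrow> precise_rep g x * v x) (at_right 0)"
proof -
  have [measurable]: "v \<in> borel_measurable borel" using v(1) by (rule borel_measurable_continuous_onI)
  have B0: "0 \<le> B" using B[of 0] by linarith
  have gv: "locally_integrable (\<lambda>y. g y * v y)"
    by (rule locally_integrable_bounded[where B="B * M"]) (auto simp: abs_mult intro!: mult_mono B v B0)
  have g: "locally_integrable g" by (rule locally_integrable_bounded) (auto intro: B)
  have "((\<lambda>r. ball_average (\<lambda>y. g y * v y - v x * g y) x r) \<longlongrightarrow> 0) (at_right 0)"
  proof (rule tendstoI)
    fix e :: real assume e: "0 < e"
    have "isCont v x" using v(1) by (simp add: continuous_on_eq_continuous_at)
    \<comment> \<open>\<open>B + 1\<close> stands in for \<open>B\<close>, which may be 0.\<close>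
    then obtain d where d: "0 < d" "\<And>y. dist y x < d \<Longrightarrow> dist (v y) (v x) < e / (2 * (B + 1))"
      unfolding continuous_at_eps_delta using e B0 by (metis add_nonneg_pos divide_pos_pos mult_pos_pos zero_less_numeral zero_less_one)
    have "\<bar>ball_average (\<lambda>y. g y * v y - v x * g y) x r\<bar> \<le> e / 2" if r: "0 < r" "r < d" for r
    proof (rule abs_ball_average_le)
      fix y assume "y \<in> ball x r"
      then have "\<bar>v y - v x\<bar> \<le> e / (2 * (B + 1))" using d(2)[of y] r by (auto simp: dist_commute dist_real_def[symmetric])
      then have "\<bar>g y\<bar> * \<bar>v y - v x\<bar> \<le> (B + 1) * (e / (2 * (B + 1)))"
        using B[of y] B0 by (intro mult_mono) auto
      also have "\<dots> = e / 2" using B0 by (simp add: field_simps)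
      finally show "\<bar>g y * v y - v x * g y\<bar> \<le> e / 2" by (simp add: abs_mult[symmetric] algebra_simps)
    qed (use r in auto)
    then show "eventually (\<lambda>r. dist (ball_average (\<lambda>y. g y * v y - v x * g y) x r) 0 < e) (at_right 0)"
      using d(1) e by (fastforce simp: eventually_at_right[of 0 1])
  qed
  then have "((\<lambda>r. ball_average (\<lambda>y. g y * v y) x r - v x * ball_average g x r + v x * ball_average g x r) \<longlongrightarrow> 0 + v x * precise_rep g x) (at_right 0)"
    unfolding ball_average_diff_cmult[OF gv g]
    by (intro tendsto_add tendsto_mult tendsto_const tendsto_precise_rep x)
  then show ?thesis by (simp add: mult.commute)
qed

section \<open>Hoelder inequality and Besov functions\<close>

lemma nn_integral_powr_le_Lp_norm:
  fixes f :: "real^'n \<Rightarrow> real"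
  assumes p: "0 < p" and A: "0 < A" and le: "Lp_norm (ennreal p) f \<le> ennreal A"
  shows "(\<integral>\<^sup>+x. ennreal (\<bar>f x\<bar> powr p) \<partial>lborel) \<le> ennreal (A powr p)"
proof -
  let ?I = "\<integral>\<^sup>+x. ennreal (\<bar>f x\<bar> powr p) \<partial>lborel"
  have eq: "Lp_norm (ennreal p) f = (if ?I = \<infinity> then \<infinity> else ennreal (enn2real ?I powr (1 / p)))"
    using p by (simp add: Lp_norm_def nn_integral_completion Let_def)
  with le have fin: "?I \<noteq> \<infinity>" by (auto split: if_splits simp: top_unique)
  with eq le have "enn2real ?I powr (1 / p) \<le> A" using A by (simp add: ennreal_le_iff)
  then have "(enn2real ?I powr (1 / p)) powr p \<le> A powr p" using p by (intro powr_mono2) auto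
  then have "enn2real ?I \<le> A powr p" using p by (simp add: powr_powr)
  then have "ennreal (enn2real ?I) \<le> ennreal (A powr p)" by (rule ennreal_leI)
  then show ?thesis using fin by (simp add: ennreal_enn2real_if)
qed

lemma Lp_norm_le:
  fixes f :: "real^'n \<Rightarrow> real"
  assumes p: "0 < p" and A: "0 \<le> A" and le: "(\<integral>\<^sup>+x. ennreal (\<bar>f x\<bar> powr p) \<partial>lborel) \<le> ennreal A"
  shows "Lp_norm (ennreal p) f \<le> ennreal (A powr (1 / p))"
proof -
  let ?I = "\<integral>\<^sup>+x. ennreal (\<bar>f x\<bar> powr p) \<partial>lborel"
  have eq: "Lp_norm (ennreal p) f = (if ?I = \<infinity> then \<infinity> else ennreal (enn2real ?I powr (1 / p)))"
    using p by (simp add: Lp_norm_def nn_integral_completion Let_def)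
  have fin: "?I \<noteq> \<infinity>" using le by (auto simp: top_unique)
  have "enn2real ?I \<le> A" using le A fin by (simp add: enn2real_leI)
  then have "enn2real ?I powr (1 / p) \<le> A powr (1 / p)" using p by (intro powr_mono2) auto
  then show ?thesis using eq fin by (simp add: ennreal_leI)
qed

lemma conjugate_exponents:
  fixes p q :: ennreal
  assumes "1 \<le> p" "p < \<infinity>" "1 / p + 1 / q = 1"
  obtains "p = 1" "q = \<infinity>"
  | p' q' where "p = ennreal p'" "q = ennreal q'" "1 < p'" "1 < q'" "1 / p' + 1 / q' = 1"
proof -
  obtain p' where p': "p = ennreal p'" "1 \<le> p'"
    using assms(1,2) by (cases p) (auto simp: ennreal_le_iff2 simp flip: ennreal_1)
  have inv_p: "1 / p = ennreal (1 / p')" using p' by (simp add: divide_ennreal flip: ennreal_1)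
  show ?thesis
  proof (cases "p' = 1")
    case True
    then have "1 + 1 / q = 1 + 0" using assms(3) p' by simp
    then have "1 / q = 0" unfolding ennreal_add_left_cancel by simp
    then have "q = \<infinity>" by (cases q) (auto simp: ennreal_divide_eq_0_iff)
    then show ?thesis using True p' that(1) by simp
  next
    case False
    then have p1: "1 < p'" using p' by simp
    have "q \<noteq> \<infinity>"
    proof
      assume "q = \<infinity>"
      then have "ennreal (1 / p') = ennreal 1" using assms(3) by (simp add: inv_p)
      then have "1 / p' = 1" using p1 by (subst (asm) ennreal_inj) auto
      then show False using p1 by simp
    qed
    moreover have "q \<noteq> 0" using assms(3) by (auto simp: ennreal_divide_zero)
    ultimately obtain q' where q': "q = ennreal q'" "0 < q'" by (cases q) auto
    have "1 / q = ennreal (1 / q')" using q' by (simp add: divide_ennreal flip: ennreal_1)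
    then have "ennreal (1 / p' + 1 / q') = ennreal 1" using assms(3) inv_p p1 q' by (simp add: ennreal_plus)
    then have sum: "1 / p' + 1 / q' = 1" using p1 q' by (subst (asm) ennreal_inj) (auto intro!: add_nonneg_nonneg)
    have "0 < 1 / p'" using p1 by simp
    then have "1 / q' < 1" using sum by linarith
    then have "1 < q'" using q' by simp
    then show ?thesis using that(2) p'(1) q'(1) p1 sum by blast
  qed
qed

text \<open>For real exponents Young's inequality is applied to \<open>\<bar>f x\<bar> / A\<close>
  and \<open>\<bar>w x\<bar> / B\<close> and integrated; the weights \<open>1 / p'\<close> and
  \<open>1 / q'\<close> add up to 1. At the endpoint the essential supremum bounds \<open>w\<close>
  almost everywhere. Positive bounds in place of the norms allow the division.\<close>

lemma holder_le:
  fixes f w :: "real^'n \<Rightarrow> real"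
  assumes conj: "1 \<le> p" "p < \<infinity>" "1 / p + 1 / q = 1"
    and [measurable]: "f \<in> borel_measurable borel" "w \<in> borel_measurable borel"
    and A: "0 < A" "Lp_norm p f \<le> ennreal A" and B: "0 < B" "Lp_norm q w \<le> ennreal B"
  shows "(\<integral>\<^sup>+x. ennreal \<bar>f x * w x\<bar> \<partial>lborel) \<le> ennreal (A * B)"
proof (rule conjugate_exponents[OF conj])
  assume pq: "p = 1" "q = \<infinity>"
  have f: "(\<integral>\<^sup>+x. ennreal \<bar>f x\<bar> \<partial>lborel) \<le> ennreal A"
    using nn_integral_powr_le_Lp_norm[of 1 A f] A pq by simp
  have "esssup lebesgue (\<lambda>x. ennreal \<bar>w x\<bar>) \<le> ennreal B" using B pq by (simp add: Lp_norm_def)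
  then have "AE x in lebesgue. ennreal \<bar>w x\<bar> \<le> ennreal B"
    using esssup_AE[where M=lebesgue and f="\<lambda>x. ennreal \<bar>w x\<bar>"] by (auto elim!: eventually_mono order_trans)
  then have w: "AE x in lborel. \<bar>w x\<bar> \<le> B" using B by (simp add: AE_completion_iff)
  have "(\<integral>\<^sup>+x. ennreal \<bar>f x * w x\<bar> \<partial>lborel) \<le> (\<integral>\<^sup>+x. ennreal B * ennreal \<bar>f x\<bar> \<partial>lborel)"
  proof (intro nn_integral_mono_AE)
    show "AE x in lborel. ennreal \<bar>f x * w x\<bar> \<le> ennreal B * ennreal \<bar>f x\<bar>"
      using w
    proof eventually_elim
      case (elim x)
      then have "\<bar>f x * w x\<bar> \<le> B * \<bar>f x\<bar>"
        using mult_left_mono[OF elim abs_ge_zero[of "f x"]] by (simp add: abs_mult mult.commute)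
      then show ?case using B by (simp add: ennreal_mult'[symmetric] ennreal_leI)
    qed
  qed
  also have "\<dots> = ennreal B * (\<integral>\<^sup>+x. ennreal \<bar>f x\<bar> \<partial>lborel)" by (intro nn_integral_cmult) measurable
  also have "\<dots> \<le> ennreal B * ennreal A" by (intro mult_left_mono f) auto
  finally show ?thesis using A B by (simp add: ennreal_mult'[symmetric] mult.commute)
next
  fix p' q' :: real
  assume pq: "p = ennreal p'" "q = ennreal q'" "1 < p'" "1 < q'" "1 / p' + 1 / q' = 1"
  have f: "(\<integral>\<^sup>+x. ennreal (\<bar>f x\<bar> powr p') \<partial>lborel) \<le> ennreal (A powr p')"
    using nn_integral_powr_le_Lp_norm[of p' A f] A pq by simp
  have w: "(\<integral>\<^sup>+x. ennreal (\<bar>w x\<bar> powr q') \<partial>lborel) \<le> ennreal (B powr q')"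
    using nn_integral_powr_le_Lp_norm[of q' B w] B pq by simp
  let ?a = "A * B / (p' * A powr p')" and ?b = "A * B / (q' * B powr q')"
  have ab: "0 \<le> ?a" "0 \<le> ?b" using A B pq by auto
  have "(\<integral>\<^sup>+x. ennreal \<bar>f x * w x\<bar> \<partial>lborel) \<le> (\<integral>\<^sup>+x. ennreal ?a * ennreal (\<bar>f x\<bar> powr p') + ennreal ?b * ennreal (\<bar>w x\<bar> powr q') \<partial>lborel)"
  proof (intro nn_integral_mono)
    fix x
    have "(\<bar>f x\<bar> / A) * (\<bar>w x\<bar> / B) \<le> (\<bar>f x\<bar> / A) powr p' / p' + (\<bar>w x\<bar> / B) powr q' / q'"
      using A B pq by (intro Youngs_inequality) auto
    then have "(A * B) * ((\<bar>f x\<bar> / A) * (\<bar>w x\<bar> / B)) \<le> (A * B) * ((\<bar>f x\<bar> / A) powr p' / p' + (\<bar>w x\<bar> / B) powr q' / q')"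
      using A B by (intro mult_left_mono) auto
    also have "(A * B) * ((\<bar>f x\<bar> / A) * (\<bar>w x\<bar> / B)) = \<bar>f x * w x\<bar>"
      using A B by (simp add: abs_mult)
    also have "(A * B) * ((\<bar>f x\<bar> / A) powr p' / p' + (\<bar>w x\<bar> / B) powr q' / q') = ?a * \<bar>f x\<bar> powr p' + ?b * \<bar>w x\<bar> powr q'"
      using A B by (simp add: powr_divide distrib_left mult_ac)
    finally have "ennreal \<bar>f x * w x\<bar> \<le> ennreal (?a * \<bar>f x\<bar> powr p' + ?b * \<bar>w x\<bar> powr q')" by (rule ennreal_leI)
    also have "\<dots> = ennreal (?a * \<bar>f x\<bar> powr p') + ennreal (?b * \<bar>w x\<bar> powr q')"
      using ab by (intro ennreal_plus mult_nonneg_nonneg) auto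
    also have "\<dots> = ennreal ?a * ennreal (\<bar>f x\<bar> powr p') + ennreal ?b * ennreal (\<bar>w x\<bar> powr q')"
      by (intro arg_cong2[where f="(+)"] ennreal_mult' ab)
    finally show "ennreal \<bar>f x * w x\<bar> \<le> ennreal ?a * ennreal (\<bar>f x\<bar> powr p') + ennreal ?b * ennreal (\<bar>w x\<bar> powr q')" .
  qed
  also have "\<dots> = ennreal ?a * (\<integral>\<^sup>+x. ennreal (\<bar>f x\<bar> powr p') \<partial>lborel) + ennreal ?b * (\<integral>\<^sup>+x. ennreal (\<bar>w x\<bar> powr q') \<partial>lborel)"
    by (simp add: nn_integral_add nn_integral_cmult)
  also have "\<dots> \<le> ennreal ?a * ennreal (A powr p') + ennreal ?b * ennreal (B powr q')"
    by (intro add_mono mult_left_mono f w) auto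
  also have "\<dots> = ennreal (?a * A powr p') + ennreal (?b * B powr q')"
    by (intro arg_cong2[where f="(+)"] ennreal_mult'[symmetric] ab)
  also have "\<dots> = ennreal (?a * A powr p' + ?b * B powr q')"
    using ab by (intro ennreal_plus[symmetric] mult_nonneg_nonneg) auto
  also have "?a * A powr p' + ?b * B powr q' = A * B * (1 / p' + 1 / q')"
    using A B by (simp add: distrib_left)
  finally show ?thesis using pq by simp
qed

lemma holder:
  fixes f w :: "real^'n \<Rightarrow> real"
  assumes conj: "1 \<le> p" "p < \<infinity>" "1 / p + 1 / q = 1"
    and meas: "f \<in> borel_measurable borel" "w \<in> borel_measurable borel"
    and A: "0 < A" "Lp_norm p f \<le> ennreal A"
  shows "(\<integral>\<^sup>+x. ennreal \<bar>f x * w x\<bar> \<partial>lborel) \<le> ennreal A * Lp_norm q w"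
proof (cases "Lp_norm q w")
  case (real b)
  show ?thesis
  proof (rule ennreal_le_epsilon)
    \<comment> \<open>The bound for \<open>w\<close> has to be positive, but its norm
      \<open>b\<close> may be 0; the added \<open>e / A\<close> contributes exactly
      \<open>e\<close>.\<close>
    fix e :: real assume e: "0 < e"
    have "(\<integral>\<^sup>+x. ennreal \<bar>f x * w x\<bar> \<partial>lborel) \<le> ennreal (A * (b + e / A))"
      by (rule holder_le[OF conj meas A]) (use e A real in \<open>auto intro!: add_nonneg_pos ennreal_leI simp del: ennreal_plus\<close>)
    also have "A * (b + e / A) = A * b + e" using A by (simp add: distrib_left)
    also have "ennreal (A * b + e) = ennreal A * ennreal b + ennreal e"
      using A real e by (simp add: ennreal_mult')
    finally show "(\<integral>\<^sup>+x. ennreal \<bar>f x * w x\<bar> \<partial>lborel) \<le> ennreal A * Lp_norm q w + ennreal e"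
      by (simp add: real)
  qed
next
  case top
  then show ?thesis using A by (simp add: ennreal_mult_eq_top_iff ennreal_mult_top)
qed

section \<open>Passing between functions that agree almost everywhere\<close>

lemma Lp_norm_cong_AE:
  fixes u v :: "real^'n \<Rightarrow> real"
  assumes "AE x in lebesgue. u x = v x" "u \<in> borel_measurable lebesgue" "v \<in> borel_measurable lebesgue"
  shows "Lp_norm q u = Lp_norm q v"
proof -
  have "esssup lebesgue (\<lambda>x. ennreal (norm (u x))) = esssup lebesgue (\<lambda>x. ennreal (norm (v x)))"
    using assms by (intro esssup_AE_cong) auto
  moreover have "(\<integral>\<^sup>+x. ennreal (norm (u x) powr enn2real q) \<partial>lebesgue) = (\<integral>\<^sup>+x. ennreal (norm (v x) powr enn2real q) \<partial>lebesgue)"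
    using assms(1) by (intro nn_integral_cong_AE) auto
  ultimately show ?thesis by (simp add: Lp_norm_def)
qed

lemma AE_lborel_shift:
  fixes h :: "'a::euclidean_space"
  assumes "AE x in lborel. P x" shows "AE x in lborel. P (x + h)"
proof -
  obtain N where N: "N \<in> sets borel" "{x. \<not> P x} \<subseteq> N" "emeasure lborel N = 0"
    using assms by (auto elim!: AE_E)
  have "emeasure lborel {x. x + h \<in> N} = (\<integral>\<^sup>+x. indicator N (x + h) \<partial>lborel)"
  proof -
    have "{x. x + h \<in> N} \<in> sets lborel"
      using measurable_sets[of "\<lambda>x. x + h" borel borel N] N by (auto simp: vimage_def)
    then have "emeasure lborel {x. x + h \<in> N} = (\<integral>\<^sup>+x. indicator {x. x + h \<in> N} x \<partial>lborel)" by simp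
    then show ?thesis by (simp add: indicator_def)
  qed
  also have "\<dots> = (\<integral>\<^sup>+x. indicator N x \<partial>lborel)"
    using N by (intro nn_integral_lborel_shift borel_measurable_indicator)
  also have "\<dots> = 0" using N by simp
  finally have "emeasure lborel {x. x + h \<in> N} = 0" .
  moreover have "{x. x + h \<in> N} \<in> sets lborel"
    using measurable_sets[of "\<lambda>x. x + h" borel borel N] N by (auto simp: vimage_def)
  ultimately show ?thesis using N(2) by (intro AE_I[where N="{x. x + h \<in> N}"]) auto
qed

text \<open>Measurability in \<open>h\<close> of the inner norm is never established; this is why \<open>nn_integral_cmult_le\<close> below
  has no measurability assumption.\<close>

definition besov_seminorm :: "real \<Rightarrow> ennreal \<Rightarrow> (real^'n \<Rightarrow> real) \<Rightarrow> ennreal" where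
  "besov_seminorm \<alpha> q v = (\<integral>\<^sup>+h. ennreal (riesz_kernel \<alpha> h) * Lp_norm q (\<lambda>x. v (x + h) - v x) \<partial>lborel)"

lemma besov_seminorm_finite:
  fixes \<eta> v :: "real^'n \<Rightarrow> real"
  assumes \<eta>: "\<eta> \<in> besov \<alpha> q" and v: "v \<in> borel_measurable borel" "AE x in lebesgue. \<eta> x = v x"
  shows "besov_seminorm \<alpha> q v < \<infinity>"
proof -
  have \<eta>m: "\<eta> \<in> borel_measurable lebesgue" using \<eta> by (simp add: besov_def Lp_def)
  have eq: "Lp_norm q (\<lambda>x. v (x + h) - v x) = Lp_norm q (\<lambda>x. \<eta> (x + h) - \<eta> x)" for h
  proof (rule Lp_norm_cong_AE)
    have ae: "AE x in lborel. \<eta> x = v x" using v(2) by (simp add: AE_completion_iff)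
    have ae': "AE x in lborel. \<eta> (x + h) = v (x + h)" by (rule AE_lborel_shift[OF ae])
    have "AE x in lborel. v (x + h) - v x = \<eta> (x + h) - \<eta> x" using ae ae' by eventually_elim simp
    then show ae2: "AE x in lebesgue. v (x + h) - v x = \<eta> (x + h) - \<eta> x" by (simp add: AE_completion_iff)
    show vm: "(\<lambda>x. v (x + h) - v x) \<in> borel_measurable lebesgue"
      using v(1) by (intro measurable_completion) simp
    \<comment> \<open>Completeness of Lebesgue measure: the difference agrees almost everywhere with
      a Borel function.\<close>
    show "(\<lambda>x. \<eta> (x + h) - \<eta> x) \<in> borel_measurable lebesgue"
    proof -
      from ae2 vm show ?thesis by (rule borel_measurable_AE[rotated])
    qed
  qed
  have "besov_seminorm \<alpha> q v \<le> (\<integral>\<^sup>+h. Lp_norm q (\<lambda>x. \<eta> (x + h) - \<eta> x) / ennreal (norm h powr (real CARD('n) + \<alpha>)) \<partial>lborel)"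
    unfolding besov_seminorm_def
  proof (intro nn_integral_mono)
    fix h :: "real^'n"
    show "ennreal (riesz_kernel \<alpha> h) * Lp_norm q (\<lambda>x. v (x + h) - v x) \<le> Lp_norm q (\<lambda>x. \<eta> (x + h) - \<eta> x) / ennreal (norm h powr (real CARD('n) + \<alpha>))"
    proof (cases "h = 0")
      case False
      then have "ennreal (riesz_kernel \<alpha> h) = inverse (ennreal (norm h powr (real CARD('n) + \<alpha>)))"
        unfolding riesz_kernel_def powr_minus by (subst inverse_ennreal) auto
      then show ?thesis by (simp add: eq divide_ennreal_def mult.commute)
    qed (simp add: riesz_kernel_def)
  qed
  also have "\<dots> < \<infinity>" using \<eta> by (simp add: besov_def nn_integral_completion)
  finally show ?thesis .
qed

lemma unit_ball_vol_neq_0 [simp]: "unit_ball_vol (real k) \<noteq> 0"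
  by (metis less_irrefl of_nat_0_le_iff unit_ball_vol_pos)

text \<open>The integral is a supremum over simple functions, and dividing one that lies below
  \<open>c * f\<close> by \<open>c\<close> gives one below \<open>f\<close>; so the constant comes
  out for arbitrary \<open>f\<close>.\<close>

lemma nn_integral_cmult_le:
  assumes c: "0 < c"
  shows "(\<integral>\<^sup>+x. ennreal c * f x \<partial>M) \<le> ennreal c * (\<integral>\<^sup>+x. f x \<partial>M)"
proof -
  have one: "ennreal c * ennreal (1 / c) = 1"
    using c by (subst ennreal_mult'[symmetric]) auto
  have "integral\<^sup>S M s \<le> ennreal c * (\<integral>\<^sup>+x. f x \<partial>M)"
    if s: "simple_function M s" "s \<le> (\<lambda>x. ennreal c * f x)" for s
  proof -
    have s': "simple_function M (\<lambda>x. ennreal (1 / c) * s x)" using s(1) by (intro simple_function_mult) auto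
    have "integral\<^sup>S M s = (\<integral>\<^sup>+x. s x \<partial>M)" using s(1) by (rule nn_integral_eq_simple_integral[symmetric])
    also have "\<dots> = (\<integral>\<^sup>+x. ennreal c * (ennreal (1 / c) * s x) \<partial>M)"
      by (simp only: mult.assoc[symmetric] one mult_1_left)
    also have "\<dots> = ennreal c * (\<integral>\<^sup>+x. ennreal (1 / c) * s x \<partial>M)"
      using s' by (intro nn_integral_cmult borel_measurable_simple_function)
    also have "\<dots> \<le> ennreal c * (\<integral>\<^sup>+x. f x \<partial>M)"
    proof (intro mult_left_mono nn_integral_mono)
      fix x
      have "ennreal (1 / c) * s x \<le> ennreal (1 / c) * (ennreal c * f x)"
        using s(2) by (intro mult_left_mono) (auto simp: le_fun_def)
      also have "\<dots> = (ennreal c * ennreal (1 / c)) * f x" by (simp only: mult_ac)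
      finally show "ennreal (1 / c) * s x \<le> f x" by (simp only: one mult_1_left)
    qed auto
    finally show ?thesis .
  qed
  then show ?thesis unfolding nn_integral_def[of M "\<lambda>x. ennreal c * f x"] by (intro SUP_least) auto
qed

section \<open>Besov bounds on balls\<close>

lemma Lp_norm_indicator_ball:
  assumes p: "1 \<le> p" and s: "0 \<le> s"
  shows "Lp_norm (ennreal p) (indicat_real (ball (x::real^'n) s)) \<le> ennreal ((unit_ball_vol (real CARD('n)) * s ^ CARD('n)) powr (1 / p))"
proof (rule Lp_norm_le)
  have "(\<integral>\<^sup>+y. ennreal (\<bar>indicat_real (ball x s) y\<bar> powr p) \<partial>lborel) = (\<integral>\<^sup>+y. indicator (ball x s) y \<partial>lborel)"
    by (intro nn_integral_cong) (auto simp: indicator_def)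
  also have "\<dots> = ennreal (unit_ball_vol (real CARD('n)) * s ^ CARD('n))" using s by (simp add: emeasure_ball)
  finally show "(\<integral>\<^sup>+y. ennreal (\<bar>indicat_real (ball x s) y\<bar> powr p) \<partial>lborel) \<le> ennreal (unit_ball_vol (real CARD('n)) * s ^ CARD('n))"
    by simp
qed (use p s in auto)

lemma holder_ball:
  fixes w :: "real^'n \<Rightarrow> real"
  assumes p: "1 \<le> p" and conj: "1 / ennreal p + 1 / q = 1"
    and [measurable]: "w \<in> borel_measurable borel" and s: "0 < s"
  shows "(\<integral>\<^sup>+y. ennreal \<bar>w y\<bar> * indicator (ball x s) y \<partial>lborel)
    \<le> ennreal ((unit_ball_vol (real CARD('n)) * s ^ CARD('n)) powr (1 / p)) * Lp_norm q w"
proof -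
  have "(\<integral>\<^sup>+y. ennreal \<bar>w y\<bar> * indicator (ball x s) y \<partial>lborel) = (\<integral>\<^sup>+y. ennreal \<bar>indicat_real (ball x s) y * w y\<bar> \<partial>lborel)"
    by (intro nn_integral_cong) (auto simp: indicator_def)
  also have "\<dots> \<le> ennreal ((unit_ball_vol (real CARD('n)) * s ^ CARD('n)) powr (1 / p)) * Lp_norm q w"
  proof (rule holder[where p="ennreal p", OF _ _ conj])
    show "1 \<le> ennreal p" using p by (simp add: ennreal_leI flip: ennreal_1)
    show "0 < (unit_ball_vol (real CARD('n)) * s ^ CARD('n)) powr (1 / p)" using s by simp
    show "Lp_norm (ennreal p) (indicat_real (ball x s)) \<le> ennreal ((unit_ball_vol (real CARD('n)) * s ^ CARD('n)) powr (1 / p))"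
      using p s by (intro Lp_norm_indicator_ball) auto
  qed (auto intro!: borel_measurable_indicator)
  finally show ?thesis .
qed

text \<open>Dropping the shell restriction on \<open>h\<close> and exchanging the integrals leaves,
  for each \<open>h\<close>, the integral of an increment over a ball. Hoelder's inequality bounds
  it by the \<open>q\<close> norm of the increment times the volume to the power
  \<open>1 / p\<close>.\<close>

lemma shell_diff_besov:
  fixes v :: "real^'n \<Rightarrow> real"
  assumes p: "1 \<le> p" and conj: "1 / ennreal p + 1 / q = 1"
    and [measurable]: "v \<in> borel_measurable borel" and s: "0 < s"
  shows "(\<integral>\<^sup>+y. shell_diff \<alpha> v s y * indicator (ball x s) y \<partial>lborel)
    \<le> ennreal ((unit_ball_vol (real CARD('n)) * s ^ CARD('n)) powr (1 / p)) * besov_seminorm \<alpha> q v"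
proof -
  let ?I = "\<lambda>h. \<integral>\<^sup>+y. ennreal \<bar>v (y + h) - v y\<bar> * indicator (ball x s) y \<partial>lborel"
  let ?J = "\<lambda>y. \<integral>\<^sup>+h. ennreal (riesz_kernel \<alpha> h * \<bar>v (y + h) - v y\<bar>) * indicator (ball x s) y \<partial>lborel"
  let ?N = "\<lambda>h. Lp_norm q (\<lambda>y. v (y + h) - v y)"
  let ?c = "(unit_ball_vol (real CARD('n)) * s ^ CARD('n)) powr (1 / p)"
  have [measurable]: "ball x s \<in> sets borel" by auto
  have c: "0 < ?c" using s by simp
  have "(\<integral>\<^sup>+y. shell_diff \<alpha> v s y * indicator (ball x s) y \<partial>lborel)
    \<le> (\<integral>\<^sup>+y. ?J y \<partial>lborel)"
  proof (intro nn_integral_mono)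
    fix y
    have "shell_diff \<alpha> v s y * indicator (ball x s) y = (\<integral>\<^sup>+h. ennreal (riesz_kernel \<alpha> h * \<bar>v (y + h) - v y\<bar>) * indicator {h. s \<le> norm h \<and> norm h \<le> 5 * s} h * indicator (ball x s) y \<partial>lborel)"
      unfolding shell_diff_def by (intro nn_integral_multc[symmetric]) measurable
    also have "\<dots> \<le> ?J y"
      by (intro nn_integral_mono) (auto simp: indicator_def)
    finally show "shell_diff \<alpha> v s y * indicator (ball x s) y \<le> ?J y" .
  qed
  also have "\<dots> = (\<integral>\<^sup>+h. (\<integral>\<^sup>+y. ennreal (riesz_kernel \<alpha> h * \<bar>v (y + h) - v y\<bar>) * indicator (ball x s) y \<partial>lborel) \<partial>lborel)"
    by (rule lborel_pair.Fubini') measurable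
  also have "\<dots> = (\<integral>\<^sup>+h. ennreal (riesz_kernel \<alpha> h) * ?I h \<partial>lborel)"
    by (subst nn_integral_cmult[symmetric]) (auto simp: ennreal_mult' mult.assoc)
  also have "\<dots> \<le> (\<integral>\<^sup>+h. ennreal ?c * (ennreal (riesz_kernel \<alpha> h) * ?N h) \<partial>lborel)"
  proof (intro nn_integral_mono)
    fix h
    have "?I h \<le> ennreal ?c * ?N h"
      by (rule holder_ball[OF p conj _ s]) measurable
    then have "ennreal (riesz_kernel \<alpha> h) * ?I h \<le> ennreal (riesz_kernel \<alpha> h) * (ennreal ?c * ?N h)"
      by (intro mult_left_mono) auto
    then show "ennreal (riesz_kernel \<alpha> h) * ?I h
      \<le> ennreal ?c * (ennreal (riesz_kernel \<alpha> h) * ?N h)"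
      by (simp only: mult.left_commute)
  qed
  also have "\<dots> \<le> ennreal ?c * besov_seminorm \<alpha> q v"
    unfolding besov_seminorm_def by (rule nn_integral_cmult_le[OF c])
  finally show ?thesis .
qed

lemma integrable_Lp_bounded_support:
  fixes v :: "real^'n \<Rightarrow> real"
  assumes p: "1 \<le> p" and conj: "1 / ennreal p + 1 / q = 1"
    and [measurable]: "v \<in> borel_measurable borel" and L: "0 < L" "\<And>x. x \<notin> ball 0 L \<Longrightarrow> v x = 0"
    and q: "Lp_norm q v < \<infinity>"
  shows "integrable lborel v"
proof -
  have "(\<integral>\<^sup>+x. ennreal \<bar>v x\<bar> \<partial>lborel) = (\<integral>\<^sup>+x. ennreal \<bar>v x\<bar> * indicator (ball 0 L) x \<partial>lborel)"
    using L(2) by (intro nn_integral_cong) (force simp: indicator_def)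
  also have "\<dots> \<le> ennreal ((unit_ball_vol (real CARD('n)) * L ^ CARD('n)) powr (1 / p)) * Lp_norm q v"
    by (rule holder_ball[OF p conj _ L(1)]) simp
  also have "\<dots> < \<infinity>" using q by (simp add: ennreal_mult_less_top)
  finally show ?thesis by (intro integrableI_bounded) auto
qed

text \<open>Increments with \<open>norm h < 1\<close> vanish outside \<open>ball 0 (L + 1)\<close>,
  so Hoelder's inequality there passes from the \<open>q\<close> norm to the \<open>L1\<close> norm.
  For larger \<open>h\<close> twice the \<open>L1\<close> norm of \<open>v\<close> meets the
  integrable tail of the kernel.\<close>

lemma gagliardo_besov:
  fixes v :: "real^'n \<Rightarrow> real"
  assumes \<alpha>: "0 < \<alpha>" and p: "1 \<le> p" and conj: "1 / ennreal p + 1 / q = 1"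
    and [measurable]: "v \<in> borel_measurable borel" and L: "0 < L" "\<And>x. x \<notin> ball 0 L \<Longrightarrow> v x = 0"
    and q: "Lp_norm q v < \<infinity>" and bs: "besov_seminorm \<alpha> q v < \<infinity>"
  shows "gagliardo \<alpha> v < \<infinity>"
proof -
  let ?V = "\<integral>\<^sup>+x. ennreal \<bar>v x\<bar> \<partial>lborel" and ?N = "\<lambda>h. Lp_norm q (\<lambda>y. v (y + h) - v y)"
  obtain C where C: "0 < C" "\<And>r. 0 < r \<Longrightarrow>
    (\<integral>\<^sup>+h. ennreal (riesz_kernel \<alpha> (h::real^'n)) * indicator (- ball 0 r) h \<partial>lborel) \<le> ennreal (C * r powr (- \<alpha>))"
    using riesz_kernel_far[OF \<alpha>] by blast
  let ?c = "(unit_ball_vol (real CARD('n)) * (L + 1) ^ CARD('n)) powr (1 / p)"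
  have c: "0 < ?c" using L by simp
  have [measurable]: "ball (0::real^'n) 1 \<in> sets borel" "- ball (0::real^'n) 1 \<in> sets borel" by auto
  have "gagliardo \<alpha> v = (\<integral>\<^sup>+h. ennreal (riesz_kernel \<alpha> h) * shift_diff v h * indicator (ball 0 1) h + ennreal (riesz_kernel \<alpha> h) * shift_diff v h * indicator (- ball 0 1) h \<partial>lborel)"
    unfolding gagliardo_def by (intro nn_integral_cong) (auto simp: indicator_def)
  also have "\<dots> = (\<integral>\<^sup>+h. ennreal (riesz_kernel \<alpha> h) * shift_diff v h * indicator (ball 0 1) h \<partial>lborel)
      + (\<integral>\<^sup>+h. ennreal (riesz_kernel \<alpha> h) * shift_diff v h * indicator (- ball 0 1) h \<partial>lborel)"
    by (intro nn_integral_add) measurable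
  also have "(\<integral>\<^sup>+h. ennreal (riesz_kernel \<alpha> h) * shift_diff v h * indicator (ball 0 1) h \<partial>lborel)
    \<le> (\<integral>\<^sup>+h. ennreal ?c * (ennreal (riesz_kernel \<alpha> h) * ?N h) \<partial>lborel)"
  proof (intro nn_integral_mono)
    fix h :: "real^'n"
    show "ennreal (riesz_kernel \<alpha> h) * shift_diff v h * indicator (ball 0 1) h \<le> ennreal ?c * (ennreal (riesz_kernel \<alpha> h) * ?N h)"
    proof (cases "norm h < 1")
      case True
      have zero: "v (y + h) - v y = 0" if y: "y \<notin> ball 0 (L + 1)" for y
      proof -
        have "L \<le> norm (y + h)" using y True norm_triangle_ineq4[of "y + h" h] by simp
        moreover have "L \<le> norm y" using y by simp
        ultimately show ?thesis using L(2) by simp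
      qed
      have "shift_diff v h = (\<integral>\<^sup>+y. ennreal \<bar>v (y + h) - v y\<bar> * indicator (ball 0 (L + 1)) y \<partial>lborel)"
        unfolding shift_diff_def by (intro nn_integral_cong) (use zero in \<open>force simp: indicator_def\<close>)
      also have "\<dots> \<le> ennreal ?c * ?N h"
        by (rule holder_ball[OF p conj]) (use L in auto)
      finally have "ennreal (riesz_kernel \<alpha> h) * shift_diff v h \<le> ennreal (riesz_kernel \<alpha> h) * (ennreal ?c * ?N h)"
        by (intro mult_left_mono) auto
      then show ?thesis using True by (simp add: mult.left_commute)
    qed auto
  qed
  also have "\<dots> \<le> ennreal ?c * besov_seminorm \<alpha> q v"
    unfolding besov_seminorm_def by (rule nn_integral_cmult_le[OF c])
  also have "(\<integral>\<^sup>+h. ennreal (riesz_kernel \<alpha> h) * shift_diff v h * indicator (- ball 0 1) h \<partial>lborel)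
    \<le> (\<integral>\<^sup>+h. (2 * ?V) * (ennreal (riesz_kernel \<alpha> (h::real^'n)) * indicator (- ball 0 1) h) \<partial>lborel)"
  proof (intro nn_integral_mono)
    fix h :: "real^'n"
    have "ennreal (riesz_kernel \<alpha> h) * indicator (- ball 0 1) h * shift_diff v h \<le> ennreal (riesz_kernel \<alpha> h) * indicator (- ball 0 1) h * (2 * ?V)"
      by (intro mult_left_mono shift_diff_le_integral) auto
    then show "ennreal (riesz_kernel \<alpha> h) * shift_diff v h * indicator (- ball 0 1) h \<le> (2 * ?V) * (ennreal (riesz_kernel \<alpha> h) * indicator (- ball 0 1) h)"
      by (simp only: mult_ac)
  qed
  also have "\<dots> = (2 * ?V) * (\<integral>\<^sup>+h. (ennreal (riesz_kernel \<alpha> (h::real^'n)) * indicator (- ball 0 1) h) \<partial>lborel)"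
    by (intro nn_integral_cmult) measurable
  also have "\<dots> \<le> (2 * ?V) * ennreal C"
    using C(2)[of 1] by (intro mult_left_mono) auto
  finally have le: "gagliardo \<alpha> v \<le> ennreal ?c * besov_seminorm \<alpha> q v + (2 * ?V) * ennreal C"
    by (simp add: add_mono)
  have "?V < \<infinity>"
    using integrable_Lp_bounded_support[OF p conj _ L q] by (simp add: integrable_iff_bounded)
  then have "ennreal ?c * besov_seminorm \<alpha> q v + (2 * ?V) * ennreal C < \<infinity>"
    using bs by (simp add: ennreal_mult_less_top)
  with le show ?thesis by (rule le_less_trans)
qed

text \<open>A Morrey argument: averages at consecutive dyadic radii differ by a constant times
  \<open>((1 / 2) powr t) ^ k\<close>, uniformly in \<open>x\<close>, with \<open>t > 0\<close>. The
  uniform limit is continuous, and it equals \<open>v\<close> almost everywhere because the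
  \<open>L1\<close> errors of the averages are summable.\<close>

lemma besov_continuous:
  fixes v :: "real^'n \<Rightarrow> real"
  assumes \<alpha>: "0 < \<alpha>" and p: "1 \<le> p" and conj: "1 / ennreal p + 1 / q = 1"
    and \<theta>: "real CARD('n) * (1 - 1 / p) < \<alpha>"
    and [measurable]: "v \<in> borel_measurable borel" and L: "0 < L" "\<And>x. x \<notin> ball 0 L \<Longrightarrow> v x = 0"
    and q: "Lp_norm q v < \<infinity>" and bs: "besov_seminorm \<alpha> q v < \<infinity>"
  obtains w where "continuous_on UNIV w" "AE x in lborel. w x = v x"
proof -
  have int: "integrable lborel v" by (rule integrable_Lp_bounded_support[OF p conj _ L q]) simp
  have li: "locally_integrable v" using int by (intro locally_integrable_integrable) auto
  have gag: "gagliardo \<alpha> v < \<infinity>" by (rule gagliardo_besov[OF \<alpha> p conj _ L q bs]) simp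
  obtain G where G: "gagliardo \<alpha> v = ennreal G" "0 \<le> G" using gag by (cases "gagliardo \<alpha> v") auto
  obtain b where b: "besov_seminorm \<alpha> q v = ennreal b" "0 \<le> b" using bs by (cases "besov_seminorm \<alpha> q v") auto
  define n where "n = real CARD('n)"
  define \<omega> where "\<omega> = unit_ball_vol n"
  have \<omega>: "0 < \<omega>" by (simp add: \<omega>_def n_def)
  \<comment> \<open>The oscillation estimate contributes \<open>\<alpha> - n\<close> and the Hoelder
    volume factor \<open>n / p\<close>; together they give \<open>\<alpha> - n / q\<close>.\<close>
  define t where "t = \<alpha> - n + n / p"
  have t: "0 < t" using \<theta> p by (simp add: t_def n_def right_diff_distrib)
  define c where "c = 2 * (5 powr (n + \<alpha>) * 2 powr n / \<omega>\<^sup>2)"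
  have c: "0 < c" using \<omega> by (simp add: c_def)
  define a where "a k x = ball_average v x (1 / 2 ^ k)" for k x
  have osc: "\<bar>a (Suc k) x - a k x\<bar> \<le> c * \<omega> powr (1 / p) * b * ((1 / 2) powr t) ^ k" for k x
  proof -
    let ?s = "1 / 2 ^ k :: real"
    have s: "0 < ?s" by simp
    have "ennreal \<bar>a (Suc k) x - a k x\<bar> \<le> ennreal (c * ?s powr (\<alpha> - n)) * (\<integral>\<^sup>+y. shell_diff \<alpha> v ?s y * indicator (ball x ?s) y \<partial>lborel)"
      unfolding a_def c_def \<omega>_def n_def by (rule ball_average_oscillation[OF li \<alpha> s]) (auto simp: field_simps)
    also have "\<dots> \<le> ennreal (c * ?s powr (\<alpha> - n)) * (ennreal ((\<omega> * ?s ^ CARD('n)) powr (1 / p)) * besov_seminorm \<alpha> q v)"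
      unfolding \<omega>_def n_def by (intro mult_left_mono shell_diff_besov[OF p conj _ s]) auto
    also have "\<dots> = ennreal (c * ?s powr (\<alpha> - n) * ((\<omega> * ?s ^ CARD('n)) powr (1 / p) * b))"
      using c b by (simp only: b(1)) (subst ennreal_mult'[symmetric], auto intro!: ennreal_mult'[symmetric])
    also have "(\<omega> * ?s ^ CARD('n)) powr (1 / p) = \<omega> powr (1 / p) * ?s powr (n / p)"
      using \<omega> by (simp add: powr_mult powr_powr n_def flip: powr_realpow)
    also have "c * ?s powr (\<alpha> - n) * (\<omega> powr (1 / p) * ?s powr (n / p) * b) = c * \<omega> powr (1 / p) * b * (?s powr (\<alpha> - n) * ?s powr (n / p))"
      by (simp only: mult_ac)
    also have "?s powr (\<alpha> - n) * ?s powr (n / p) = ?s powr t" by (simp add: t_def flip: powr_add)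
    also have "?s = (1 / 2) powr real k" by (simp add: powr_realpow power_one_over)
    also have "((1 / 2) powr real k) powr t = ((1 / 2) powr t) ^ k"
      by (simp add: powr_powr mult.commute flip: powr_realpow)
    finally show ?thesis using c b by (subst (asm) ennreal_le_iff) auto
  qed
  have small: "(1 / 2) powr t < 1" using powr_less_mono2[of t "1 / 2" 1] t by simp
  have summ: "summable (\<lambda>k. c * \<omega> powr (1 / p) * b * ((1 / 2) powr t) ^ k)"
    using small by (intro summable_mult summable_geometric) simp
  define w where "w x = a 0 x + (\<Sum>i. a (Suc i) x - a i x)" for x
  have "uniform_limit UNIV (\<lambda>n x. \<Sum>i<n. a (Suc i) x - a i x) (\<lambda>x. \<Sum>i. a (Suc i) x - a i x) sequentially"
    by (rule Weierstrass_m_test[OF _ summ]) (use osc in simp)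
  then have "uniform_limit UNIV (\<lambda>n x. a n x - a 0 x) (\<lambda>x. \<Sum>i. a (Suc i) x - a i x) sequentially"
  proof -
    have "(\<Sum>i<n. a (Suc i) x - a i x) = a n x - a 0 x" for n x
      by (rule sum_lessThan_telescope)
    then show "uniform_limit UNIV (\<lambda>n x. \<Sum>i<n. a (Suc i) x - a i x) (\<lambda>x. \<Sum>i. a (Suc i) x - a i x) sequentially \<Longrightarrow> ?thesis"
      by simp
  qed
  then have unif: "uniform_limit UNIV (\<lambda>n x. a 0 x + (a n x - a 0 x)) w sequentially"
    unfolding w_def[abs_def] by (intro uniform_limit_add uniform_limit_const)
  then have unif: "uniform_limit UNIV a w sequentially" by simp
  have cont_a: "continuous_on UNIV (a k)" for k
    unfolding a_def by (rule ball_average_continuous[OF int]) simp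
  have cont: "continuous_on UNIV w"
    by (rule uniform_limit_theorem[OF _ unif]) (use cont_a in auto)
  have am [measurable]: "a k \<in> borel_measurable borel" for k by (rule borel_measurable_continuous_onI[OF cont_a])
  have "(\<integral>\<^sup>+x. (\<Sum>k. ennreal \<bar>a k x - v x\<bar>) \<partial>lborel) = (\<Sum>k. \<integral>\<^sup>+x. ennreal \<bar>a k x - v x\<bar> \<partial>lborel)"
    by (intro nn_integral_suminf) measurable
  also have "\<dots> \<le> (\<Sum>k. ennreal (1 / \<omega> * G * ((1 / 2) powr \<alpha>) ^ k))"
  proof (intro suminf_le summableI)
    fix k
    have "(\<integral>\<^sup>+x. ennreal \<bar>a k x - v x\<bar> \<partial>lborel) \<le> ennreal ((1 / 2 ^ k) powr \<alpha> / \<omega>) * ennreal G"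
      unfolding a_def \<omega>_def n_def G(1)[symmetric] by (rule ball_average_L1_gagliardo[OF li _ \<alpha>]) simp
    also have "\<dots> = ennreal ((1 / 2 ^ k) powr \<alpha> / \<omega> * G)" using \<omega> by (subst ennreal_mult') auto
    also have "(1 / 2 ^ k :: real) = (1 / 2) powr real k" by (simp add: powr_realpow power_one_over)
    also have "((1 / 2) powr real k) powr \<alpha> = ((1 / 2) powr \<alpha>) ^ k"
      by (simp add: powr_powr mult.commute flip: powr_realpow)
    finally show "(\<integral>\<^sup>+x. ennreal \<bar>a k x - v x\<bar> \<partial>lborel) \<le> ennreal (1 / \<omega> * G * ((1 / 2) powr \<alpha>) ^ k)"
      by (simp add: mult_ac)
  qed
  also have "\<dots> < \<infinity>"
  proof -
    have "summable (\<lambda>k. 1 / \<omega> * G * ((1 / 2) powr \<alpha>) ^ k)"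
      using powr_less_mono2[of \<alpha> "1 / 2" 1] \<alpha> by (intro summable_mult summable_geometric) simp
    then have "(\<Sum>k. ennreal (1 / \<omega> * G * ((1 / 2) powr \<alpha>) ^ k)) = ennreal (\<Sum>k. 1 / \<omega> * G * ((1 / 2) powr \<alpha>) ^ k)"
      using G \<omega> by (intro suminf_ennreal2) auto
    then show ?thesis by simp
  qed
  finally have "AE x in lborel. (\<Sum>k. ennreal \<bar>a k x - v x\<bar>) \<noteq> \<infinity>"
    by (intro nn_integral_noteq_infinite) auto
  then have "AE x in lborel. w x = v x"
  proof eventually_elim
    case (elim x)
    then have "summable (\<lambda>k. \<bar>a k x - v x\<bar>)" by (intro summable_suminf_not_top) auto
    then have "(\<lambda>k. \<bar>a k x - v x\<bar>) \<longlonglongrightarrow> 0" by (rule summable_LIMSEQ_zero)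
    then have "(\<lambda>k. a k x) \<longlonglongrightarrow> v x" by (simp add: tendsto_rabs_zero_iff LIM_zero_iff)
    moreover have "(\<lambda>k. a k x) \<longlonglongrightarrow> w x" using unif by (rule tendsto_uniform_limitI) simp
    ultimately show ?case by (metis LIMSEQ_unique)
  qed
  with cont show ?thesis by (rule that)
qed

section \<open>The continuous, compactly supported representative\<close>

lemma continuous_AE_eq:
  fixes u w :: "real^'n \<Rightarrow> real"
  assumes "open S" "continuous_on S u" "continuous_on S w" and ae: "AE x in lborel. x \<in> S \<longrightarrow> u x = w x" and x: "x \<in> S"
  shows "u x = w x"
proof (rule ccontr)
  assume ne: "u x \<noteq> w x"
  have cont: "continuous_on S (\<lambda>x. u x - w x)" using assms by (intro continuous_intros)
  have "open (S \<inter> (\<lambda>x. u x - w x) -` (- {0}))"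
    using cont \<open>open S\<close> by (intro continuous_open_preimage) auto
  moreover have "x \<in> S \<inter> (\<lambda>x. u x - w x) -` (- {0})" using ne x by simp
  ultimately obtain e where e: "0 < e" "ball x e \<subseteq> S \<inter> (\<lambda>x. u x - w x) -` (- {0})"
    by (metis open_contains_ball)
  have "AE y in lborel. y \<notin> ball x e" using ae e(2) by (auto elim!: eventually_mono)
  then have "emeasure lborel (ball x e) = 0"
    by (subst (asm) AE_iff_measurable[where N="ball x e"]) (auto simp del: mem_ball)
  moreover have "emeasure lborel (ball x e) = ennreal (unit_ball_vol (real CARD('n)) * e ^ CARD('n))"
    using e by (simp add: emeasure_ball)
  moreover have "0 < unit_ball_vol (real CARD('n)) * e ^ CARD('n)" using e(1) by simp
  ultimately show False by (metis ennreal_eq_0_iff not_le)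
qed

text \<open>A Borel representative cut off outside the essential support is replaced by the function
  from \<open>besov_continuous\<close>. It vanishes off a closed ball because continuous functions
  that agree almost everywhere on an open set agree there; the same uniqueness resolves the definite
  description in \<open>continuous_rep\<close>.\<close>

lemma besov_representative:
  fixes \<eta> :: "real^'n \<Rightarrow> real"
  assumes \<alpha>: "0 < \<alpha>" and p: "1 \<le> p" and conj: "1 / ennreal p + 1 / q = 1"
    and \<theta>: "real CARD('n) * (1 - 1 / p) < \<alpha>"
    and \<eta>: "\<eta> \<in> besov \<alpha> q" "ess_compact_support \<eta>"
  obtains v L M where "continuous_on UNIV v" "continuous_rep \<eta> = v" "AE x in lebesgue. \<eta> x = v x"
    "0 < L" "\<And>x. x \<notin> ball 0 L \<Longrightarrow> v x = 0" "\<And>x. \<bar>v x\<bar> \<le> M" "integrable lborel v" "gagliardo \<alpha> v < \<infinity>" "besov_seminorm \<alpha> q v < \<infinity>"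
proof -
  have \<eta>q: "\<eta> \<in> borel_measurable lebesgue" "Lp_norm q \<eta> < \<infinity>" using \<eta> by (auto simp: besov_def Lp_def)
  obtain K where K: "compact K" "AE x in lebesgue. x \<notin> K \<longrightarrow> \<eta> x = 0" using \<eta>(2) by (auto simp: ess_compact_support_def)
  obtain L where L: "0 < L" "K \<subseteq> ball 0 L"
    using K(1) compact_imp_bounded bounded_subset_ballD by metis
  obtain v0 where v0: "v0 \<in> borel_measurable lborel" "AE x in lborel. \<eta> x = v0 x"
    using completion_ex_borel_measurable_real[OF \<eta>q(1)] by auto
  define v where "v x = v0 x * indicator K x" for x
  have vm [measurable]: "v \<in> borel_measurable borel"
    unfolding v_def using v0(1) borel_compact[OF K(1)] by (intro borel_measurable_times borel_measurable_indicator) auto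
  have "AE x in lborel. x \<notin> K \<longrightarrow> \<eta> x = 0" using K(2) by (simp add: AE_completion_iff)
  with v0(2) have "AE x in lborel. \<eta> x = v x" by eventually_elim (auto simp: v_def indicator_def)
  then have \<eta>v: "AE x in lebesgue. \<eta> x = v x" by (simp add: AE_completion_iff)
  have fin: "Lp_norm q u < \<infinity>" "besov_seminorm \<alpha> q u < \<infinity>" if "u \<in> borel_measurable borel" "AE x in lebesgue. \<eta> x = u x" for u
  proof -
    have "u \<in> borel_measurable lebesgue" using that(1) by (intro measurable_completion) simp
    then have "Lp_norm q \<eta> = Lp_norm q u" by (rule Lp_norm_cong_AE[OF that(2) \<eta>q(1)])
    then show "Lp_norm q u < \<infinity>" using \<eta>q(2) by (simp only:)
    show "besov_seminorm \<alpha> q u < \<infinity>" by (rule besov_seminorm_finite[OF \<eta>(1) that])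
  qed
  have v_out: "v x = 0" if "x \<notin> ball 0 L" for x using that L(2) by (auto simp: v_def indicator_def)
  obtain w where w: "continuous_on UNIV w" "AE x in lborel. w x = v x"
    using besov_continuous[OF \<alpha> p conj \<theta> vm L(1) v_out fin[OF vm \<eta>v]] by metis
  have wm: "w \<in> borel_measurable borel" using w(1) by (rule borel_measurable_continuous_onI)
  have \<eta>w: "AE x in lebesgue. \<eta> x = w x"
    using \<eta>v AE_completion[OF w(2)] by eventually_elim simp
  have w_out': "w x = 0" if "x \<in> - cball 0 L" for x
  proof (rule continuous_AE_eq[of "- cball 0 L" w "\<lambda>_. 0"])
    show "continuous_on (- cball 0 L) w" using w(1) by (rule continuous_on_subset) auto
    show "AE x in lborel. x \<in> - cball 0 L \<longrightarrow> w x = 0"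
      using w(2) by eventually_elim (use v_out in auto)
  qed (use that in auto)
  \<comment> \<open>Vanishing is known off the closed ball; a radius larger by 1 restores the form
    with an open ball.\<close>
  have w_out: "w x = 0" if "x \<notin> ball 0 (L + 1)" for x using that by (intro w_out') auto
  have L1: "0 < L + 1" using L by simp
  have "bounded (w ` cball 0 L)"
    by (intro compact_imp_bounded compact_continuous_image continuous_on_subset[OF w(1)]) auto
  then obtain M where M: "\<And>x. x \<in> cball 0 L \<Longrightarrow> \<bar>w x\<bar> \<le> M"
    unfolding bounded_iff real_norm_def by blast
  have M': "\<bar>w x\<bar> \<le> max M 0" for x using M[of x] w_out'[of x] by (cases "x \<in> cball 0 L") (auto simp: max_def)
  have rep: "continuous_rep \<eta> = w"
    unfolding continuous_rep_def
  proof (rule the_equality)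
    show "continuous_on UNIV w \<and> (AE x in lebesgue. w x = \<eta> x)" using w(1) \<eta>w by (auto elim!: eventually_mono)
    fix u assume u: "continuous_on UNIV u \<and> (AE x in lebesgue. u x = \<eta> x)"
    then have "AE x in lebesgue. u x = w x" using \<eta>w by (auto elim: eventually_elim2)
    then have "AE x in lborel. x \<in> UNIV \<longrightarrow> u x = w x" by (simp add: AE_completion_iff)
    then have "u x = w x" for x using u w(1) by (intro continuous_AE_eq[of UNIV u w]) auto
    then show "u = w" by (rule ext)
  qed
  show ?thesis
    using that[OF w(1) rep \<eta>w L1 w_out M' integrable_Lp_bounded_support[OF p conj wm L1 w_out fin(1)[OF wm \<eta>w]]
      gagliardo_besov[OF \<alpha> p conj wm L1 w_out fin[OF wm \<eta>w]] fin(2)[OF wm \<eta>w]] by blast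
qed

section \<open>The product rule\<close>

text \<open>For \<open>x\<close> in \<open>ball 0 L\<close> and increments up to 5 both endpoints
  lie in the bounded open set \<open>ball 0 (L + 6)\<close>, where the double integral of
  \<open>W1_loc\<close> is finite; exchanging \<open>g\<close> for \<open>u\<close> alters the
  integrands only on null sets.\<close>

lemma W1_loc_locally_gagliardo:
  fixes g u :: "real^'n \<Rightarrow> real"
  assumes g: "g \<in> W1_loc \<alpha>" and [measurable]: "u \<in> borel_measurable borel" and ae: "AE x in lborel. g x = u x"
  shows "locally_gagliardo \<alpha> u"
  unfolding locally_gagliardo_def
proof
  fix L :: real
  let ?U = "ball (0::real^'n) (L + 6)"
  let ?k = "\<lambda>x y. \<bar>g x - g y\<bar> / norm (x - y) powr (real CARD('n) + \<alpha>)"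
  have kernel: "riesz_kernel \<alpha> h * c = c / norm h powr (real CARD('n) + \<alpha>)" for h :: "real^'n" and c
    unfolding riesz_kernel_def powr_minus_divide by simp
  have "(\<integral>\<^sup>+y. near_energy \<alpha> u y * indicator (ball 0 L) y \<partial>lborel)
    \<le> (\<integral>\<^sup>+x\<in>?U. (\<integral>\<^sup>+y\<in>?U. ennreal (?k x y) \<partial>lborel) \<partial>lborel)"
  proof (rule nn_integral_mono_AE)
    show "AE x in lborel. near_energy \<alpha> u x * indicator (ball 0 L) x
      \<le> (\<integral>\<^sup>+y\<in>?U. ennreal (?k x y) \<partial>lborel) * indicator ?U x"
      using ae
    proof eventually_elim
      case (elim x)
      show ?case
      proof (cases "x \<in> ball 0 L")
        case True
        have "near_energy \<alpha> u x
          \<le> (\<integral>\<^sup>+h. ennreal (riesz_kernel \<alpha> (h + x - x) * \<bar>u (h + x) - u x\<bar>) * indicator ?U (h + x) \<partial>lborel)"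
          unfolding near_energy_def
        proof (intro nn_integral_mono)
          fix h :: "real^'n"
          have "norm (h + x) < L + 6" if "norm h \<le> 5" using norm_triangle_ineq[of h x] that True by simp
          then show "ennreal (riesz_kernel \<alpha> h * \<bar>u (x + h) - u x\<bar>) * indicator (cball 0 5) h \<le> ennreal (riesz_kernel \<alpha> (h + x - x) * \<bar>u (h + x) - u x\<bar>) * indicator ?U (h + x)"
            by (auto simp: indicator_def add.commute)
        qed
        also have "\<dots> = (\<integral>\<^sup>+y. ennreal (riesz_kernel \<alpha> (y - x) * \<bar>u y - u x\<bar>) * indicator ?U y \<partial>lborel)"
          by (rule nn_integral_lborel_shift[where f="\<lambda>y. ennreal (riesz_kernel \<alpha> (y - x) * \<bar>u y - u x\<bar>) * indicator ?U y"])
             (auto intro!: borel_measurable_times_ennreal borel_measurable_indicator)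
        also have "\<dots> = (\<integral>\<^sup>+y\<in>?U. ennreal (?k x y) \<partial>lborel)"
        proof (rule nn_integral_cong_AE)
          show "AE y in lborel. ennreal (riesz_kernel \<alpha> (y - x) * \<bar>u y - u x\<bar>) * indicator ?U y = ennreal (?k x y) * indicator ?U y"
            using ae by eventually_elim (simp add: elim kernel abs_minus_commute norm_minus_commute)
        qed
        finally show ?thesis using True by (auto simp: indicator_def)
      qed simp
    qed
  qed
  also have "\<dots> = (\<integral>\<^sup>+x\<in>?U. (\<integral>\<^sup>+y\<in>?U. ennreal (?k x y) \<partial>lebesgue) \<partial>lebesgue)"
    by (simp add: nn_integral_completion)
  also have "\<dots> < \<infinity>" using g unfolding W1_loc_def by auto
  finally show "(\<integral>\<^sup>+y. near_energy \<alpha> u y * indicator (ball 0 L) y \<partial>lborel) < \<infinity>" .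
qed

text \<open>Increments up to size 5 fall under the near energy on the support of \<phi>. Beyond that
  the increment of \<open>g\<close> is at most \<open>2 * B\<close>, and the kernel tail is
  integrable uniformly in \<open>x\<close>.\<close>

lemma locally_gagliardo_weighted:
  fixes g \<phi> :: "real^'n \<Rightarrow> real"
  assumes \<alpha>: "0 < \<alpha>" and [measurable]: "g \<in> borel_measurable borel" "\<phi> \<in> borel_measurable borel"
    and B: "\<And>x. \<bar>g x\<bar> \<le> B" and lg: "locally_gagliardo \<alpha> g"
    and \<phi>: "\<And>x. \<bar>\<phi> x\<bar> \<le> M" "\<And>x. x \<notin> ball 0 L \<Longrightarrow> \<phi> x = 0"
  shows "(\<integral>\<^sup>+z. ennreal (\<bar>\<phi> (fst z)\<bar> * (riesz_kernel \<alpha> (snd z) * \<bar>g (fst z + snd z) - g (fst z)\<bar>)) \<partial>(lborel \<Otimes>\<^sub>M lborel)) < \<infinity>"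
proof -
  let ?d = "\<lambda>x h. riesz_kernel \<alpha> h * \<bar>g (x + h) - g x\<bar>"
  let ?S = "\<lambda>x h. ennreal (?d x h) * indicator (cball 0 5) h + ennreal (2 * B) * (ennreal (riesz_kernel \<alpha> h) * indicator (- ball 0 5) h)"
  have B0: "0 \<le> B" using B[of 0] by linarith
  have M0: "0 \<le> M" using \<phi>(1)[of 0] by linarith
  obtain C where C: "0 < C" "\<And>r. 0 < r \<Longrightarrow>
    (\<integral>\<^sup>+h. ennreal (riesz_kernel \<alpha> (h::real^'n)) * indicator (- ball 0 r) h \<partial>lborel) \<le> ennreal (C * r powr (- \<alpha>))"
    using riesz_kernel_far[OF \<alpha>] by blast
  define c where "c = C * 5 powr (- \<alpha>)"
  have [measurable]: "cball (0::real^'n) 5 \<in> sets borel" "- ball (0::real^'n) 5 \<in> sets borel" "ball (0::real^'n) L \<in> sets borel" by auto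
  let ?N = "near_energy \<alpha> g"
  have inner: "(\<integral>\<^sup>+h. ennreal (\<bar>\<phi> x\<bar> * (?d x h)) \<partial>lborel) \<le> ennreal M * (?N x * indicator (ball 0 L) x) + ennreal (M * (2 * B * c)) * indicator (ball 0 L) x" for x
  proof (cases "x \<in> ball 0 L")
    case True
    have "(\<integral>\<^sup>+h. ennreal (\<bar>\<phi> x\<bar> * (?d x h)) \<partial>lborel)
      \<le> (\<integral>\<^sup>+h. ennreal M * (?S x h) \<partial>lborel)"
    proof (intro nn_integral_mono)
      fix h :: "real^'n"
      have "ennreal (\<bar>\<phi> x\<bar> * (?d x h)) \<le> ennreal (M * (?d x h))"
        using \<phi>(1)[of x] by (intro ennreal_leI mult_right_mono) auto
      also have "\<dots> = ennreal M * ennreal (?d x h)" using M0 by (rule ennreal_mult')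
      also have "\<dots> \<le> ennreal M * (?S x h)"
      proof (intro mult_left_mono)
        show "ennreal (?d x h) \<le> ?S x h"
        proof (cases "h \<in> cball 0 5")
          case False
          have "\<bar>g (x + h) - g x\<bar> \<le> 2 * B" using B[of "x + h"] B[of x] by linarith
          then have "riesz_kernel \<alpha> h * \<bar>g (x + h) - g x\<bar> \<le> 2 * B * riesz_kernel \<alpha> h"
            using mult_left_mono[OF _ riesz_kernel_nonneg[of \<alpha> h]] by (metis mult.commute)
          then have "ennreal (?d x h) \<le> ennreal (2 * B) * ennreal (riesz_kernel \<alpha> h)"
            using B0 by (subst ennreal_mult'[symmetric]) (auto intro: ennreal_leI)
          moreover have "h \<in> - ball 0 5" using False by simp
          ultimately show ?thesis using False by simp
        qed simp
      qed simp
      finally show "ennreal (\<bar>\<phi> x\<bar> * (?d x h)) \<le> ennreal M * (?S x h)" .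
    qed
    also have "\<dots> = ennreal M * (?N x + ennreal (2 * B) * (\<integral>\<^sup>+h. ennreal (riesz_kernel \<alpha> (h::real^'n)) * indicator (- ball 0 5) h \<partial>lborel))"
      by (simp add: near_energy_def nn_integral_cmult nn_integral_add)
    also have "\<dots> \<le> ennreal M * (?N x + ennreal (2 * B) * ennreal c)"
      unfolding c_def by (intro mult_left_mono add_left_mono C(2)) auto
    also have "\<dots> = ennreal M * ?N x + ennreal (M * (2 * B * c))"
      using M0 B0 by (simp add: distrib_left ennreal_mult')
    finally show ?thesis using True by simp
  qed (simp add: \<phi>(2))
  have "(\<integral>\<^sup>+z. ennreal (\<bar>\<phi> (fst z)\<bar> * (riesz_kernel \<alpha> (snd z) * \<bar>g (fst z + snd z) - g (fst z)\<bar>)) \<partial>(lborel \<Otimes>\<^sub>M lborel))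
    = (\<integral>\<^sup>+x. (\<integral>\<^sup>+h. ennreal (\<bar>\<phi> x\<bar> * (?d x h)) \<partial>lborel) \<partial>lborel)"
    by (subst lborel.nn_integral_fst[symmetric]) auto
  also have "\<dots> \<le> (\<integral>\<^sup>+x. ennreal M * (?N x * indicator (ball 0 L) x) + ennreal (M * (2 * B * c)) * indicator (ball 0 L) x \<partial>lborel)"
    by (intro nn_integral_mono inner)
  also have "\<dots> = ennreal M * (\<integral>\<^sup>+x. ?N x * indicator (ball 0 L) x \<partial>lborel) + ennreal (M * (2 * B * c)) * emeasure lborel (ball (0::real^'n) L)"
    by (simp add: nn_integral_add nn_integral_cmult nn_integral_cmult_indicator)
  also have "\<dots> < \<infinity>"
    using lg[unfolded locally_gagliardo_def, rule_format, of L] emeasure_lborel_ball_finite[of "0::real^'n" L]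
    by (simp add: ennreal_mult_less_top)
  finally show ?thesis .
qed

section \<open>Product rule, translation invariance and symmetry of the bilinear form\<close>

lemma riesz_form_integrable_weighted:
  fixes g \<phi> :: "real^'n \<Rightarrow> real"
  assumes \<alpha>: "0 < \<alpha>" and g[measurable]: "g \<in> borel_measurable borel" and \<phi>m[measurable]: "\<phi> \<in> borel_measurable borel"
    and [measurable]: "w \<in> borel_measurable (borel \<Otimes>\<^sub>M borel)"
    and B: "\<And>x. \<bar>g x\<bar> \<le> B" and lg: "locally_gagliardo \<alpha> g" and w: "\<And>z. \<bar>w z\<bar> \<le> A"
    and \<phi>: "\<And>x. \<bar>\<phi> x\<bar> \<le> M" "\<And>x. x \<notin> ball 0 L \<Longrightarrow> \<phi> x = 0"
  shows "integrable (lborel \<Otimes>\<^sub>M lborel) (\<lambda>z. w z * \<phi> (fst z) * (grad_kernel \<alpha> i (snd z) * (g (fst z + snd z) - g (fst z))))"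
proof (rule Bochner_Integration.integrable_bound)
  have A: "0 \<le> A" using w[of undefined] by linarith
  show "integrable (lborel \<Otimes>\<^sub>M lborel) (\<lambda>z. A * (\<bar>\<phi> (fst z)\<bar> * (riesz_kernel \<alpha> (snd z) * \<bar>g (fst z + snd z) - g (fst z)\<bar>)))"
    using locally_gagliardo_weighted[OF \<alpha> g \<phi>m B lg \<phi>]
    by (intro integrable_mult_right integrableI_bounded) (auto simp: abs_mult)
  show "AE z in lborel \<Otimes>\<^sub>M lborel. norm (w z * \<phi> (fst z) * (grad_kernel \<alpha> i (snd z) * (g (fst z + snd z) - g (fst z))))
     \<le> norm (A * (\<bar>\<phi> (fst z)\<bar> * (riesz_kernel \<alpha> (snd z) * \<bar>g (fst z + snd z) - g (fst z)\<bar>)))"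
  proof (rule AE_I2)
    fix z
    have "\<bar>w z\<bar> * (\<bar>\<phi> (fst z)\<bar> * (\<bar>grad_kernel \<alpha> i (snd z)\<bar> * \<bar>g (fst z + snd z) - g (fst z)\<bar>))
        \<le> A * (\<bar>\<phi> (fst z)\<bar> * (riesz_kernel \<alpha> (snd z) * \<bar>g (fst z + snd z) - g (fst z)\<bar>))"
      using A by (intro mult_mono w abs_grad_kernel_le) auto
    then show "norm (w z * \<phi> (fst z) * (grad_kernel \<alpha> i (snd z) * (g (fst z + snd z) - g (fst z))))
     \<le> norm (A * (\<bar>\<phi> (fst z)\<bar> * (riesz_kernel \<alpha> (snd z) * \<bar>g (fst z + snd z) - g (fst z)\<bar>)))"
      using A by (simp add: abs_mult mult.assoc)
  qed
qed measurable

text \<open>In the product rule the increment of \<open>g\<close> is weighted by \<phi>, which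
  localises it, and the increment of \<phi> by \<open>g\<close>, which is bounded.\<close>

lemma gagliardo_mult:
  fixes g \<phi> :: "real^'n \<Rightarrow> real"
  assumes \<alpha>: "0 < \<alpha>" and g[measurable]: "g \<in> borel_measurable borel" and \<phi>m[measurable]: "\<phi> \<in> borel_measurable borel"
    and B: "\<And>x. \<bar>g x\<bar> \<le> B" and lg: "locally_gagliardo \<alpha> g"
    and \<phi>: "\<And>x. \<bar>\<phi> x\<bar> \<le> M" "\<And>x. x \<notin> ball 0 L \<Longrightarrow> \<phi> x = 0" and fin: "gagliardo \<alpha> \<phi> < \<infinity>"
  shows "gagliardo \<alpha> (\<lambda>x. g x * \<phi> x) < \<infinity>"
proof -
  have B0: "0 \<le> B" using B[of 0] by linarith
  have "gagliardo \<alpha> (\<lambda>x. g x * \<phi> x) \<le> (\<integral>\<^sup>+z. ennreal (\<bar>\<phi> (fst z)\<bar> * (riesz_kernel \<alpha> (snd z) * \<bar>g (fst z + snd z) - g (fst z)\<bar>))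
     + ennreal B * ennreal (riesz_kernel \<alpha> (snd z) * \<bar>\<phi> (fst z + snd z) - \<phi> (fst z)\<bar>) \<partial>(lborel \<Otimes>\<^sub>M lborel))"
    unfolding gagliardo_eq_pair[of "\<lambda>x. g x * \<phi> x", OF borel_measurable_times[OF g \<phi>m]]
  proof (intro nn_integral_mono)
    fix z :: "(real^'n) \<times> (real^'n)"
    obtain x h where z: "z = (x, h)" by (cases z)
    have "\<bar>g (x + h) * \<phi> (x + h) - g x * \<phi> x\<bar> \<le> \<bar>\<phi> x * (g (x + h) - g x)\<bar> + \<bar>g (x + h) * (\<phi> (x + h) - \<phi> x)\<bar>"
      by (rule order_trans[OF _ abs_triangle_ineq]) (simp add: algebra_simps)
    also have "\<dots> \<le> \<bar>\<phi> x\<bar> * \<bar>g (x + h) - g x\<bar> + B * \<bar>\<phi> (x + h) - \<phi> x\<bar>"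
      unfolding abs_mult by (intro add_left_mono mult_right_mono B) auto
    finally have "riesz_kernel \<alpha> h * \<bar>g (x + h) * \<phi> (x + h) - g x * \<phi> x\<bar> \<le> riesz_kernel \<alpha> h * (\<bar>\<phi> x\<bar> * \<bar>g (x + h) - g x\<bar> + B * \<bar>\<phi> (x + h) - \<phi> x\<bar>)"
      by (intro mult_left_mono) auto
    also have "\<dots> = \<bar>\<phi> x\<bar> * (riesz_kernel \<alpha> h * \<bar>g (x + h) - g x\<bar>) + B * (riesz_kernel \<alpha> h * \<bar>\<phi> (x + h) - \<phi> x\<bar>)"
      by (simp add: algebra_simps)
    finally have "ennreal (riesz_kernel \<alpha> h * \<bar>g (x + h) * \<phi> (x + h) - g x * \<phi> x\<bar>) \<le> ennreal (\<bar>\<phi> x\<bar> * (riesz_kernel \<alpha> h * \<bar>g (x + h) - g x\<bar>)) + ennreal (B * (riesz_kernel \<alpha> h * \<bar>\<phi> (x + h) - \<phi> x\<bar>))"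
      using B0 by (intro order_trans[OF ennreal_leI eq_refl[OF ennreal_plus]]) auto
    then show "ennreal (riesz_kernel \<alpha> (snd z) * \<bar>g (fst z + snd z) * \<phi> (fst z + snd z) - g (fst z) * \<phi> (fst z)\<bar>)
      \<le> ennreal (\<bar>\<phi> (fst z)\<bar> * (riesz_kernel \<alpha> (snd z) * \<bar>g (fst z + snd z) - g (fst z)\<bar>))
     + ennreal B * ennreal (riesz_kernel \<alpha> (snd z) * \<bar>\<phi> (fst z + snd z) - \<phi> (fst z)\<bar>)"
      using B0 by (simp add: z ennreal_mult')
  qed
  also have "\<dots> = (\<integral>\<^sup>+z. ennreal (\<bar>\<phi> (fst z)\<bar> * (riesz_kernel \<alpha> (snd z) * \<bar>g (fst z + snd z) - g (fst z)\<bar>)) \<partial>(lborel \<Otimes>\<^sub>M lborel))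
     + ennreal B * gagliardo \<alpha> \<phi>"
    by (simp add: nn_integral_add nn_integral_cmult gagliardo_eq_pair)
  also have "\<dots> < \<infinity>"
    using locally_gagliardo_weighted[OF \<alpha> g \<phi>m B lg \<phi>] fin by (simp add: ennreal_mult_less_top)
  finally show ?thesis .
qed

text \<open>Both pieces of the product rule are absolutely integrable over pairs, which permits
  splitting the integral. Placing \<phi> at \<open>x\<close> and \<open>g\<close> at
  \<open>x + h\<close> turns the first piece, for a weight that depends on \<open>x\<close> alone,
  into a pairing with the singular integral of \<open>g\<close>.\<close>

lemma riesz_form_mult:
  fixes g \<phi> :: "real^'n \<Rightarrow> real"
  assumes \<alpha>: "0 < \<alpha>" and g[measurable]: "g \<in> borel_measurable borel" and \<phi>m[measurable]: "\<phi> \<in> borel_measurable borel"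
    and wm[measurable]: "w \<in> borel_measurable (borel \<Otimes>\<^sub>M borel)"
    and B: "\<And>x. \<bar>g x\<bar> \<le> B" and lg: "locally_gagliardo \<alpha> g" and w: "\<And>z. \<bar>w z\<bar> \<le> A"
    and \<phi>: "\<And>x. \<bar>\<phi> x\<bar> \<le> M" "\<And>x. x \<notin> ball 0 L \<Longrightarrow> \<phi> x = 0" and fin: "gagliardo \<alpha> \<phi> < \<infinity>"
  shows "riesz_form \<alpha> i w (\<lambda>x. g x * \<phi> x) = riesz_form \<alpha> i (\<lambda>z. w z * \<phi> (fst z)) g + riesz_form \<alpha> i (\<lambda>z. w z * g (fst z + snd z)) \<phi>"
proof -
  have B0: "0 \<le> B" using B[of 0] by linarith
  have A: "0 \<le> A" using w[of undefined] by linarith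
  have i1: "integrable (lborel \<Otimes>\<^sub>M lborel) (\<lambda>z. w z * \<phi> (fst z) * (grad_kernel \<alpha> i (snd z) * (g (fst z + snd z) - g (fst z))))"
    by (rule riesz_form_integrable_weighted[OF \<alpha> g \<phi>m wm B lg w \<phi>])
  have i2: "integrable (lborel \<Otimes>\<^sub>M lborel) (\<lambda>z. w z * g (fst z + snd z) * (grad_kernel \<alpha> i (snd z) * (\<phi> (fst z + snd z) - \<phi> (fst z))))"
    by (rule riesz_form_integrable[where B="A * B"]) (use fin in \<open>auto simp: abs_mult intro!: mult_mono w B A\<close>)
  show ?thesis
    unfolding riesz_form_def Bochner_Integration.integral_add[OF i1 i2, symmetric]
    by (intro Bochner_Integration.integral_cong) (auto simp: algebra_simps)
qed

text \<open>For fixed \<open>h\<close> the integral of \<open>u (x + h) - u x\<close> over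
  \<open>x\<close> vanishes by translation invariance; finite energy justifies integrating in this
  order.\<close>

lemma riesz_form_one:
  fixes u :: "real^'n \<Rightarrow> real"
  assumes [measurable]: "u \<in> borel_measurable borel" and u: "integrable lborel u" and fin: "gagliardo \<alpha> u < \<infinity>"
  shows "riesz_form \<alpha> i (\<lambda>_. 1) u = 0"
proof -
  have "riesz_form \<alpha> i (\<lambda>_. 1) u = (LINT z|(lborel \<Otimes>\<^sub>M lborel). grad_kernel \<alpha> i (snd z) * (u (fst z + snd z) - u (fst z)))"
    by (simp add: riesz_form_def)
  also have "\<dots> = (LINT h|lborel. (LINT x|lborel. grad_kernel \<alpha> i h * (u (x + h) - u x)))"
    using riesz_form_integrable[of u "\<lambda>_. 1" 1 \<alpha> i] fin
    by (subst lborel_pair.integral_snd) (auto simp: case_prod_beta')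
  also have "\<dots> = (LINT h|(lborel :: (real^'n) measure). 0)"
    using u integral_lborel_shift[of u] integrable_lborel_shift[OF u]
    by (intro Bochner_Integration.integral_cong[OF refl]) (auto simp: Bochner_Integration.integral_diff)
  finally show ?thesis by simp
qed

text \<open>Substituting \<open>x + h\<close> for \<open>x\<close> and \<open>- h\<close> for
  \<open>h\<close> changes the sign of the odd kernel and of the increment, while the weight moves
  from one endpoint to the other.\<close>

lemma riesz_form_flip:
  fixes g u :: "real^'n \<Rightarrow> real"
  assumes g[measurable]: "g \<in> borel_measurable borel" and u[measurable]: "u \<in> borel_measurable borel"
    and B: "\<And>x. \<bar>g x\<bar> \<le> B" and fin: "gagliardo \<alpha> u < \<infinity>"
  shows "riesz_form \<alpha> i (\<lambda>z. g (fst z + snd z)) u = riesz_form \<alpha> i (\<lambda>z. g (fst z)) u"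
proof -
  have "riesz_form \<alpha> i (\<lambda>z. g (fst z + snd z)) u = (LINT h|lborel. (LINT x|lborel. g (x + h) * (grad_kernel \<alpha> i h * (u (x + h) - u x))))"
    unfolding riesz_form_def
    using riesz_form_integrable[of u "\<lambda>z. g (fst z + snd z)" B \<alpha> i] B fin
    by (subst lborel_pair.integral_snd) (auto simp: case_prod_beta')
  also have "\<dots> = (LINT h|lborel. (LINT x|lborel. g (x + - h) * (grad_kernel \<alpha> i (- h) * (u (x + - h) - u x))))"
    by (rule integral_lborel_uminus[symmetric]) measurable
  also have "\<dots> = (LINT h|lborel. (LINT x|lborel. g x * (grad_kernel \<alpha> i h * (u (x + h) - u x))))"
  proof (rule Bochner_Integration.integral_cong[OF refl])
    fix h :: "real^'n"
    have "(LINT x|lborel. g (x + - h) * (grad_kernel \<alpha> i (- h) * (u (x + - h) - u x)))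
      = (LINT x|lborel. g (x + h + - h) * (grad_kernel \<alpha> i (- h) * (u (x + h + - h) - u (x + h))))"
      by (rule integral_lborel_shift[where f="\<lambda>x. g (x + - h) * (grad_kernel \<alpha> i (- h) * (u (x + - h) - u x))", symmetric]) measurable
    also have "\<dots> = (LINT x|lborel. g x * (grad_kernel \<alpha> i h * (u (x + h) - u x)))"
      by (intro Bochner_Integration.integral_cong) (auto simp: algebra_simps)
    finally show "(LINT x|lborel. g (x + - h) * (grad_kernel \<alpha> i (- h) * (u (x + - h) - u x))) = (LINT x|lborel. g x * (grad_kernel \<alpha> i h * (u (x + h) - u x)))" .
  qed
  also have "\<dots> = riesz_form \<alpha> i (\<lambda>z. g (fst z)) u"
    unfolding riesz_form_def
    using riesz_form_integrable[of u "\<lambda>z. g (fst z)" B \<alpha> i] B fin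
    by (subst lborel_pair.integral_snd) (auto simp: case_prod_beta')
  finally show ?thesis .
qed

text \<open>The pointwise singular integral. For bounded \<open>g\<close> with locally finite energy
  it converges absolutely at almost every \<open>x\<close>; where it does not, the Bochner integral
  takes its default value 0.\<close>

definition frac_grad :: "real \<Rightarrow> 'n \<Rightarrow> (real^'n \<Rightarrow> real) \<Rightarrow> real^'n \<Rightarrow> real" where
  "frac_grad \<alpha> i g x = frac_const CARD('n) \<alpha> * (LINT h|lborel. grad_kernel \<alpha> i h * (g (x + h) - g x))"

lemma frac_grad_measurable [measurable]:
  assumes [measurable]: "g \<in> borel_measurable borel"
  shows "frac_grad \<alpha> i g \<in> borel_measurable borel"
  unfolding frac_grad_def[abs_def] by measurable

lemma integral_frac_grad:
  fixes g \<phi> :: "real^'n \<Rightarrow> real"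
  assumes \<alpha>: "0 < \<alpha>" and g[measurable]: "g \<in> borel_measurable borel" and \<phi>m[measurable]: "\<phi> \<in> borel_measurable borel"
    and B: "\<And>x. \<bar>g x\<bar> \<le> B" and lg: "locally_gagliardo \<alpha> g"
    and \<phi>: "\<And>x. \<bar>\<phi> x\<bar> \<le> M" "\<And>x. x \<notin> ball 0 L \<Longrightarrow> \<phi> x = 0"
  shows "integrable lborel (\<lambda>x. \<phi> x * frac_grad \<alpha> i g x)"
    and "(LINT x|lborel. \<phi> x * frac_grad \<alpha> i g x) = frac_const CARD('n) \<alpha> * riesz_form \<alpha> i (\<lambda>z. \<phi> (fst z)) g"
proof -
  have int: "integrable (lborel \<Otimes>\<^sub>M lborel) (\<lambda>z. \<phi> (fst z) * (grad_kernel \<alpha> i (snd z) * (g (fst z + snd z) - g (fst z))))"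
    using riesz_form_integrable_weighted[OF \<alpha> g \<phi>m, of "\<lambda>_. 1" B 1 M L i] B lg \<phi> by simp
  have eq: "\<phi> x * frac_grad \<alpha> i g x = frac_const CARD('n) \<alpha> * (LINT h|lborel. \<phi> x * (grad_kernel \<alpha> i h * (g (x + h) - g x)))" for x
    by (simp add: frac_grad_def)
  show "integrable lborel (\<lambda>x. \<phi> x * frac_grad \<alpha> i g x)"
    unfolding eq using lborel_pair.integrable_fst'[OF int] by simp
  show "(LINT x|lborel. \<phi> x * frac_grad \<alpha> i g x) = frac_const CARD('n) \<alpha> * riesz_form \<alpha> i (\<lambda>z. \<phi> (fst z)) g"
    unfolding eq riesz_form_def using lborel_pair.integral_fst'[OF int] by simp
qed

text \<open>The form of the integrable function \<open>g x * \<phi> x\<close> with weight 1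
  vanishes. The product rule splits this 0 into the pairing of \<phi> with the gradient of
  \<open>g\<close> and a term with \<open>g\<close> at \<open>x + h\<close>, which the symmetry of
  the form turns into the divergence pairing.\<close>

lemma frac_grad_by_parts:
  fixes g \<phi> :: "real^'n \<Rightarrow> real"
  assumes \<alpha>: "0 < \<alpha>" and g[measurable]: "g \<in> borel_measurable borel" and \<phi>m[measurable]: "\<phi> \<in> borel_measurable borel"
    and B: "\<And>x. \<bar>g x\<bar> \<le> B" and lg: "locally_gagliardo \<alpha> g"
    and \<phi>: "\<And>x. \<bar>\<phi> x\<bar> \<le> M" "\<And>x. x \<notin> ball 0 L \<Longrightarrow> \<phi> x = 0" and fin: "gagliardo \<alpha> \<phi> < \<infinity>"
  shows "(LINT x|lborel. \<phi> x * frac_grad \<alpha> i g x) = - (LINT x|lborel. g x * frac_div \<alpha> (\<lambda>x. \<phi> x *\<^sub>R axis i 1) x)"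
proof -
  have B0: "0 \<le> B" using B[of 0] by linarith
  have "integrable lborel (\<lambda>x. g x * \<phi> x)"
    by (rule integrable_bounded_support[where B="B * M" and a=0 and r=L]) (auto simp: abs_mult \<phi>(2) intro!: mult_mono B \<phi>(1) B0)
  moreover have "gagliardo \<alpha> (\<lambda>x. g x * \<phi> x) < \<infinity>" by (rule gagliardo_mult[OF \<alpha> g \<phi>m B lg \<phi> fin])
  ultimately have "riesz_form \<alpha> i (\<lambda>_. 1) (\<lambda>x. g x * \<phi> x) = 0" by (intro riesz_form_one) auto
  then have "riesz_form \<alpha> i (\<lambda>z. \<phi> (fst z)) g + riesz_form \<alpha> i (\<lambda>z. g (fst z + snd z)) \<phi> = 0"
    using riesz_form_mult[OF \<alpha> g \<phi>m, of "\<lambda>_. 1" B 1 M L i] B lg \<phi> fin by simp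
  then have "riesz_form \<alpha> i (\<lambda>z. \<phi> (fst z)) g = - riesz_form \<alpha> i (\<lambda>z. g (fst z)) \<phi>"
    using riesz_form_flip[OF g \<phi>m B fin, where i=i] by simp
  then show ?thesis
    using integral_frac_grad(2)[OF \<alpha> g \<phi>m B lg \<phi>, where i=i] integral_frac_div_axis[OF g \<phi>m B fin, where i=i] by simp
qed

section \<open>Smooth box functions\<close>

lemma C_k_Suc_imp:
  fixes f :: "'a::real_normed_vector \<Rightarrow> 'b::real_normed_vector"
  shows "C_k (Suc k) f \<Longrightarrow> C_k k f"
proof (induction k arbitrary: f)
  case 0
  then show ?case
    by (auto simp: continuous_on_eq_continuous_at intro: differentiable_imp_continuous_within)
qed auto

lemma C_k_Suc_I:
  fixes f :: "'a::real_normed_vector \<Rightarrow> 'b::real_normed_vector"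
  assumes "\<And>x. (f has_derivative f' x) (at x)" "\<And>v. C_k k (\<lambda>x. f' x v)"
  shows "C_k (Suc k) f"
proof -
  have "frechet_derivative f (at x) = f' x" for x
    using frechet_derivative_at[OF assms(1)] by simp
  then show ?thesis using assms by (auto simp: differentiable_def)
qed

lemma C_k_SucD:
  fixes f :: "'a::real_normed_vector \<Rightarrow> 'b::real_normed_vector"
  assumes "C_k (Suc k) f"
  shows "(f has_derivative frechet_derivative f (at x)) (at x)" "C_k k (\<lambda>x. frechet_derivative f (at x) v)"
  using assms by (auto simp: frechet_derivative_works)

lemma C_k_const: "C_k k (\<lambda>x. c)"
proof (induction k arbitrary: c)
  case (Suc k)
  show ?case by (rule C_k_Suc_I[OF has_derivative_const]) (rule Suc)
qed simp

lemma C_k_add: "C_k k f \<Longrightarrow> C_k k g \<Longrightarrow> C_k k (\<lambda>x. f x + g x)"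
proof (induction k arbitrary: f g)
  case 0
  then show ?case by (simp add: continuous_on_add)
next
  case (Suc k)
  show ?case
    by (rule C_k_Suc_I[OF has_derivative_add]) (use C_k_SucD[OF Suc.prems(1)] C_k_SucD[OF Suc.prems(2)] Suc.IH in auto)
qed

text \<open>The derivative of a product contains undifferentiated factors, so the induction also
  uses both factors at order \<open>k\<close>, supplied by \<open>C_k_Suc_imp\<close>.\<close>

lemma C_k_mult:
  fixes f g :: "'a::real_normed_vector \<Rightarrow> real"
  shows "C_k k f \<Longrightarrow> C_k k g \<Longrightarrow> C_k k (\<lambda>x. f x * g x)"
proof (induction k arbitrary: f g)
  case 0
  then show ?case by (simp add: continuous_on_mult)
next
  case (Suc k)
  show ?case
  proof (rule C_k_Suc_I[where f'="\<lambda>x v. f x * frechet_derivative g (at x) v + frechet_derivative f (at x) v * g x"])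
    show "((\<lambda>x. f x * g x) has_derivative (\<lambda>v. f x * frechet_derivative g (at x) v + frechet_derivative f (at x) v * g x)) (at x)" for x
      by (intro has_derivative_mult C_k_SucD(1)[OF Suc.prems(1)] C_k_SucD(1)[OF Suc.prems(2)])
    fix v
    show "C_k k (\<lambda>x. f x * frechet_derivative g (at x) v + frechet_derivative f (at x) v * g x)"
      using C_k_SucD(2)[OF Suc.prems(1)] C_k_SucD(2)[OF Suc.prems(2)] Suc.prems[THEN C_k_Suc_imp]
      by (intro C_k_add Suc.IH)
  qed
qed

lemma C_k_prod:
  fixes f :: "'i \<Rightarrow> 'a::real_normed_vector \<Rightarrow> real"
  shows "(\<And>i. i \<in> I \<Longrightarrow> C_k k (f i)) \<Longrightarrow> C_k k (\<lambda>x. \<Prod>i\<in>I. f i x)"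
  by (induction I rule: infinite_finite_induct) (auto intro: C_k_const C_k_mult)

lemma C_k_scaleR_const:
  fixes f :: "'a::real_normed_vector \<Rightarrow> real"
  shows "C_k k f \<Longrightarrow> C_k k (\<lambda>x. f x *\<^sub>R c)"
proof (induction k arbitrary: f)
  case 0
  then show ?case by (auto intro!: continuous_intros)
next
  case (Suc k)
  show ?case
    by (rule C_k_Suc_I[OF has_derivative_scaleR_left]) (use C_k_SucD[OF Suc.prems] Suc.IH in auto)
qed

text \<open>The derivative of \<open>flat m\<close> is \<open>flat (m + 2) - m * flat (m + 1)\<close>, so the family is closed under
  differentiation up to linear combinations.\<close>

definition flat :: "nat \<Rightarrow> real \<Rightarrow> real" where
  "flat m t = (if 0 < t then exp (- (1 / t)) / t ^ m else 0)"

lemma tendsto_flat_0: "(flat m \<longlongrightarrow> 0) (at_right 0)"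
proof -
  have "((\<lambda>s::real. s ^ m / exp s) \<longlongrightarrow> 0) at_top" by (rule tendsto_power_div_exp_0)
  then have "((\<lambda>t::real. inverse t ^ m / exp (inverse t)) \<longlongrightarrow> 0) (at_right 0)"
    by (rule filterlim_compose) (rule filterlim_inverse_at_top_right)
  moreover have "eventually (\<lambda>t. inverse t ^ m / exp (inverse t) = flat m t) (at_right 0)"
    by (auto simp: eventually_at_right[of 0 1] flat_def exp_minus field_simps power_inverse intro!: exI[of _ 1])
  ultimately show ?thesis by (rule Lim_transform_eventually)
qed

text \<open>The delicate point is the origin: the difference quotient is 0 on the left and
  \<open>flat (m + 1)\<close> on the right, which tends to 0.\<close>

lemma DERIV_flat: "(flat m has_real_derivative (flat (m + 2) t - real m * flat (m + 1) t)) (at t)"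
proof -
  consider "0 < t" | "t < 0" | "t = 0" by linarith
  then show ?thesis
  proof cases
    case 1
    have "((\<lambda>t. exp (- (1 / t)) / t ^ m) has_real_derivative (flat (m + 2) t - real m * flat (m + 1) t)) (at t)"
    proof -
      \<comment> \<open>The power rule yields the exponent \<open>m - 1\<close>, a truncated
        subtraction; the cases make the exponents explicit.\<close>
      consider "m = 0" | "m = Suc 0" | k where "m = Suc (Suc k)" by (metis not0_implies_Suc)
      then show ?thesis
        using 1 by cases (auto intro!: derivative_eq_intros simp: flat_def field_simps power2_eq_square, metis One_nat_def power_eq_if)
    qed
    then show ?thesis
      by (rule DERIV_cong_ev[THEN iffD1, rotated -1])
         (use 1 in \<open>auto simp: flat_def eventually_nhds intro!: exI[of _ "{0<..}"]\<close>)
  next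
    case 2
    have "((\<lambda>t. 0) has_real_derivative 0) (at t)" by simp
    then have "(flat m has_real_derivative 0) (at t)"
      by (rule DERIV_cong_ev[THEN iffD1, rotated -1])
         (use 2 in \<open>auto simp: flat_def eventually_nhds intro!: exI[of _ "{..<0}"]\<close>)
    then show ?thesis using 2 by (simp add: flat_def)
  next
    case 3
    have "((\<lambda>h. (flat m (0 + h) - flat m 0) / h) \<longlongrightarrow> 0) (at 0)"
      unfolding filterlim_at_split
    proof
      have "eventually (\<lambda>h. 0 = (flat m (0 + h) - flat m 0) / h) (at_left 0)"
        by (auto simp: eventually_at_left[of "-1" 0] flat_def intro!: exI[of _ "-1"])
      then show "((\<lambda>h. (flat m (0 + h) - flat m 0) / h) \<longlongrightarrow> 0) (at_left 0)"
        by (rule Lim_transform_eventually[OF tendsto_const])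
      have "eventually (\<lambda>h. flat (m + 1) h = (flat m (0 + h) - flat m 0) / h) (at_right 0)"
        by (auto simp: eventually_at_right[of 0 1] flat_def field_simps intro!: exI[of _ 1])
      then show "((\<lambda>h. (flat m (0 + h) - flat m 0) / h) \<longlongrightarrow> 0) (at_right 0)"
        by (rule Lim_transform_eventually[OF tendsto_flat_0])
    qed
    then show ?thesis using 3 by (simp add: DERIV_def flat_def)
  qed
qed

lemma C_k_flat: "C_k k (\<lambda>x::real^'n. flat m (c * x $ j + d))"
proof (induction k arbitrary: m)
  case 0
  have "continuous_on UNIV (flat m)"
    by (auto simp: continuous_on_eq_continuous_at intro!: DERIV_isCont DERIV_flat)
  then show ?case
    by (auto intro!: continuous_on_compose2[of UNIV "flat m"] continuous_intros)
next
  case (Suc k)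
  let ?a = "\<lambda>x::real^'n. c * x $ j + d"
  show ?case
  proof (rule C_k_Suc_I)
    fix x :: "real^'n"
    have "(?a has_derivative (\<lambda>v. c * v $ j)) (at x)"
      by (auto intro!: derivative_eq_intros bounded_linear_imp_has_derivative bounded_linear_vec_nth)
    from has_derivative_compose[where g="flat m", OF this DERIV_flat[of m "?a x", unfolded has_field_derivative_def]]
    show "((\<lambda>x. flat m (?a x)) has_derivative (\<lambda>v. (flat (m + 2) (?a x) + (- real m) * flat (m + 1) (?a x)) * (c * v $ j))) (at x)"
      by simp
  next
    fix v :: "real^'n"
    show "C_k k (\<lambda>x. (flat (m + 2) (?a x) + (- real m) * flat (m + 1) (?a x)) * (c * v $ j))"
      by (intro C_k_mult C_k_add C_k_const Suc.IH)
  qed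
qed

section \<open>Smooth approximations of indicators of boxes\<close>

lemma flat0_bounds: "0 \<le> flat 0 t" "flat 0 t \<le> 1"
  by (auto simp: flat_def)

text \<open>The derivative of \<open>flat 0\<close> is \<open>flat 2\<close>, and the quadratic
  Taylor bound for \<open>exp (1 / t)\<close> shows that it is at most 2.\<close>

lemma flat0_lipschitz: "\<bar>flat 0 s - flat 0 t\<bar> \<le> 2 * \<bar>s - t\<bar>"
proof -
  have bound: "\<bar>flat 2 t\<bar> \<le> 2" for t
  proof (cases "0 < t")
    case True
    have "1 + 1 / t + (1 / t)\<^sup>2 / 2 \<le> exp (1 / t)" using True by (intro exp_lower_Taylor_quadratic) auto
    moreover have "0 < 1 / t" using True by simp
    ultimately have "(1 / t)\<^sup>2 \<le> 2 * exp (1 / t)" by linarith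
    then show ?thesis using True by (simp add: flat_def exp_minus field_simps power2_eq_square)
  qed (simp add: flat_def)
  have "norm (flat 0 s - flat 0 t) \<le> 2 * norm (s - t)"
    by (rule field_differentiable_bound[of UNIV "flat 0" "flat 2"])
       (use DERIV_flat[of 0] bound in \<open>auto intro: has_field_derivative_at_within simp: numeral_2_eq_2\<close>)
  then show ?thesis by simp
qed

text \<open>In each coordinate one factor switches off smoothly at the lower face and one at the
  upper face. As \<open>N\<close> grows every factor tends to 1 inside, so the products tend to the
  indicator of the open box.\<close>

definition smooth_box :: "real^'n \<Rightarrow> real^'n \<Rightarrow> real \<Rightarrow> real^'n \<Rightarrow> real" where
  "smooth_box a b N x = (\<Prod>j\<in>UNIV. flat 0 (N * (x $ j - a $ j)) * flat 0 (N * (b $ j - x $ j)))"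

lemma smooth_box_bounds: "0 \<le> smooth_box a b N x" "smooth_box a b N x \<le> 1"
  unfolding smooth_box_def by (auto intro!: prod_nonneg prod_le_1 mult_nonneg_nonneg mult_le_one flat0_bounds)

lemma smooth_box_outside:
  assumes N: "0 < N" and "x \<notin> box a b" shows "smooth_box a b N x = 0"
proof -
  obtain j where j: "x $ j \<le> a $ j \<or> b $ j \<le> x $ j" using assms by (auto simp: mem_box_cart not_less)
  then have "flat 0 (N * (x $ j - a $ j)) * flat 0 (N * (b $ j - x $ j)) = 0"
    using N by (auto simp: flat_def zero_less_mult_iff)
  then show ?thesis unfolding smooth_box_def by (intro prod_zero) auto
qed

lemma tendsto_flat0_scaled:
  assumes "0 < t" shows "(\<lambda>k. flat 0 (real (Suc k) * t)) \<longlonglongrightarrow> 1"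
proof -
  have "(\<lambda>k. exp (- (1 / real (Suc k) * (1 / t)))) \<longlonglongrightarrow> exp (- (0 * (1 / t)))"
    by (intro tendsto_exp tendsto_minus tendsto_mult tendsto_const)
       (rule filterlim_compose[OF lim_1_over_n filterlim_Suc])
  moreover have "flat 0 (real (Suc k) * t) = exp (- (1 / real (Suc k) * (1 / t)))" for k
    using assms by (auto simp: flat_def zero_less_mult_iff)
  ultimately show ?thesis by simp
qed

lemma smooth_box_tendsto: "(\<lambda>k. smooth_box a b (real (Suc k)) x) \<longlonglongrightarrow> indicator (box a b) x"
proof (cases "x \<in> box a b")
  case True
  have "(\<lambda>k. smooth_box a b (real (Suc k)) x) \<longlonglongrightarrow> (\<Prod>j\<in>(UNIV :: 'a set). 1 * 1)"
    unfolding smooth_box_def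
  proof (intro tendsto_prod tendsto_mult)
    fix j :: 'a
    have "0 < x $ j - a $ j" "0 < b $ j - x $ j" using True by (auto simp: mem_box_cart)
    from this[THEN tendsto_flat0_scaled]
    show "(\<lambda>k. flat 0 (real (Suc k) * (x $ j - a $ j))) \<longlonglongrightarrow> 1"
      "(\<lambda>k. flat 0 (real (Suc k) * (b $ j - x $ j))) \<longlonglongrightarrow> 1" .
  qed
  then show ?thesis using True by simp
qed (simp add: smooth_box_outside)

lemma smooth_box_C_k: "C_k m (smooth_box a b N)"
proof -
  have "C_k m (\<lambda>x. \<Prod>j\<in>UNIV. flat 0 (N * x $ j + - (N * a $ j)) * flat 0 ((- N) * x $ j + N * b $ j))"
    by (intro C_k_prod C_k_mult C_k_flat)
  also have "(\<lambda>x. \<Prod>j\<in>UNIV. flat 0 (N * x $ j + - (N * a $ j)) * flat 0 ((- N) * x $ j + N * b $ j)) = smooth_box a b N"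
    unfolding smooth_box_def[abs_def] by (simp add: right_diff_distrib)
  finally show ?thesis .
qed

lemma smooth_box_Cc_infinity:
  assumes "0 < N" shows "(\<lambda>x. smooth_box a b N x *\<^sub>R axis i 1) \<in> Cc_infinity"
proof -
  have "{x. smooth_box a b N x *\<^sub>R axis i (1::real) \<noteq> 0} \<subseteq> box a b"
    using smooth_box_outside[OF assms, of _ a b] by auto
  then have "bounded {x. smooth_box a b N x *\<^sub>R axis i (1::real) \<noteq> 0}" by (rule bounded_subset[OF bounded_box])
  then show ?thesis
    unfolding Cc_infinity_def compact_support_def by (auto simp: compact_closure intro: C_k_scaleR_const smooth_box_C_k)
qed

text \<open>A product of factors bounded by 1 changes by at most the sum of the changes of its
  factors; every coordinate contributes two functions with Lipschitz constant
  \<open>2 * N\<close>.\<close>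

lemma smooth_box_lipschitz:
  fixes x y :: "real^'n"
  assumes N: "0 < N"
  shows "\<bar>smooth_box a b N x - smooth_box a b N y\<bar> \<le> real CARD('n) * (4 * N) * norm (x - y)"
proof -
  let ?f = "\<lambda>x j. flat 0 (N * (x $ j - a $ j))" and ?g = "\<lambda>x j. flat 0 (N * (b $ j - x $ j))"
  have flat: "\<bar>flat 0 s - flat 0 t\<bar> \<le> 2 * N * norm (x - y)" if "\<bar>s - t\<bar> = \<bar>N * (x - y) $ j\<bar>" for s t j
  proof -
    have "\<bar>flat 0 s - flat 0 t\<bar> \<le> 2 * \<bar>N * (x - y) $ j\<bar>"
      using flat0_lipschitz[of s t] that by simp
    also have "\<dots> = 2 * N * \<bar>(x - y) $ j\<bar>" using N by (simp add: abs_mult)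
    also have "\<dots> \<le> 2 * N * norm (x - y)" using N by (intro mult_left_mono component_le_norm_cart) auto
    finally show ?thesis .
  qed
  have f: "\<bar>?f x j - ?f y j\<bar> \<le> 2 * N * norm (x - y)" for j
    by (rule flat[of _ _ j]) (simp add: algebra_simps)
  have g: "\<bar>?g x j - ?g y j\<bar> \<le> 2 * N * norm (x - y)" for j
    by (rule flat[of _ _ j]) (simp add: algebra_simps abs_minus_commute)
  have fg: "\<bar>?f x j * ?g x j - ?f y j * ?g y j\<bar> \<le> 4 * N * norm (x - y)" for j
  proof -
    have "\<bar>?f x j * ?g x j - ?f y j * ?g y j\<bar> \<le> \<bar>(?f x j - ?f y j) * ?g x j\<bar> + \<bar>?f y j * (?g x j - ?g y j)\<bar>"
      by (rule order_trans[OF _ abs_triangle_ineq]) (simp add: algebra_simps)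
    also have "\<dots> \<le> 2 * N * norm (x - y) * 1 + 1 * (2 * N * norm (x - y))"
      unfolding abs_mult using N by (intro add_mono mult_mono f g) (auto simp: flat0_bounds abs_of_nonneg)
    finally show ?thesis by simp
  qed
  have "norm (smooth_box a b N x - smooth_box a b N y) \<le> (\<Sum>j\<in>UNIV. norm (?f x j * ?g x j - ?f y j * ?g y j))"
    unfolding smooth_box_def
    by (rule norm_prod_diff) (auto simp: abs_mult intro!: mult_le_one simp: flat0_bounds abs_of_nonneg)
  also have "\<dots> \<le> (\<Sum>j\<in>(UNIV::'n set). 4 * N * norm (x - y))"
    unfolding real_norm_def by (intro sum_mono fg)
  finally show ?thesis by simp
qed

text \<open>The measures with densities \<open>f\<^sup>+\<close> and \<open>f\<^sup>-\<close> agree on boxes, hence everywhere.\<close>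

lemma AE_zero_if_integral_box_zero:
  fixes f :: "real^'n \<Rightarrow> real"
  assumes [measurable]: "f \<in> borel_measurable borel"
    and int: "\<And>a b. integrable lborel (\<lambda>x. indicator (box a b) x * f x)"
    and zero: "\<And>a b. (LINT x|lborel. indicator (box a b) x * f x) = 0"
  shows "AE x in lborel. f x = 0"
proof -
  let ?P = "density lborel (\<lambda>x. ennreal (f x))" and ?N = "density lborel (\<lambda>x. ennreal (- f x))"
  have em: "emeasure ?P (box a b) = emeasure ?N (box a b) \<and> emeasure ?P (box a b) \<noteq> \<infinity>" for a b
  proof -
    let ?u = "\<lambda>x. indicator (box a b) x * f x"
    have [measurable]: "?u \<in> borel_measurable borel" by (intro borel_measurable_times borel_measurable_indicator) auto
    have P: "emeasure ?P (box a b) = (\<integral>\<^sup>+x. ennreal (?u x) \<partial>lborel)"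
      by (subst emeasure_density) (auto intro!: nn_integral_cong simp: indicator_def)
    have N: "emeasure ?N (box a b) = (\<integral>\<^sup>+x. ennreal (- ?u x) \<partial>lborel)"
      by (subst emeasure_density) (auto intro!: nn_integral_cong simp: indicator_def)
    have fin: "(\<integral>\<^sup>+x. ennreal (?u x) \<partial>lborel) \<noteq> \<infinity>" "(\<integral>\<^sup>+x. ennreal (- ?u x) \<partial>lborel) \<noteq> \<infinity>"
      using int[of a b] unfolding real_integrable_def by auto
    have "enn2real (\<integral>\<^sup>+x. ennreal (?u x) \<partial>lborel) = enn2real (\<integral>\<^sup>+x. ennreal (- ?u x) \<partial>lborel)"
      using zero[of a b] real_lebesgue_integral_def[OF int[of a b]] by simp
    then have "(\<integral>\<^sup>+x. ennreal (?u x) \<partial>lborel) = (\<integral>\<^sup>+x. ennreal (- ?u x) \<partial>lborel)"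
      using fin by (cases "\<integral>\<^sup>+x. ennreal (?u x) \<partial>lborel"; cases "\<integral>\<^sup>+x. ennreal (- ?u x) \<partial>lborel") auto
    then show ?thesis using fin P N by simp
  qed
  have em1: "emeasure ?P (box a b) = emeasure ?N (box a b)" and em2: "emeasure ?N (box a b) \<noteq> \<infinity>" for a b
    using em[of a b] by metis+
  have "?P = ?N"
  proof (rule measure_eqI_generator_eq[where E="range (\<lambda>(a, b). box a b)" and \<Omega>=UNIV and A="\<lambda>k. box (\<chi> i. - real k) (\<chi> i. real k)"])
    \<comment> \<open>Open boxes, the empty one included, are stable under intersection, and the
      cubes \<open>A k\<close> exhaust the space with finite mass; agreement on boxes therefore
      determines the measures.\<close>
    show "Int_stable (range (\<lambda>(a, b). box a b :: (real^'n) set))"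
      unfolding Int_stable_def
    proof (intro ballI)
      fix A B :: "(real^'n) set" assume "A \<in> range (\<lambda>(a, b). box a b)" "B \<in> range (\<lambda>(a, b). box a b)"
      then obtain a b c d where "A = box a b" "B = box c d" by auto
      then have "A \<inter> B = (\<lambda>(a, b). box a b) (\<Sum>i\<in>Basis. max (a \<bullet> i) (c \<bullet> i) *\<^sub>R i, \<Sum>i\<in>Basis. min (b \<bullet> i) (d \<bullet> i) *\<^sub>R i)"
        by (simp add: box_Int_box)
      then show "A \<inter> B \<in> range (\<lambda>(a, b). box a b)" by (rule range_eqI)
    qed
    show "(\<Union>k. box (\<chi> i. - real k) (\<chi> i. real k)) = (UNIV :: (real^'n) set)"
    proof (intro equalityI subsetI)
      fix x :: "real^'n"
      obtain k :: nat where k: "norm x < real k" using reals_Archimedean2 by blast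
      have "- real k < x $ i \<and> x $ i < real k" for i using component_le_norm_cart[of x i] k by linarith
      then have "x \<in> box (\<chi> i. - real k) (\<chi> i. real k)" by (simp add: mem_box_cart)
      then show "x \<in> (\<Union>k. box (\<chi> i. - real k) (\<chi> i. real k))" by blast
    qed auto
  qed (use em1 em2 in \<open>auto simp: borel_eq_box\<close>)
  then have "AE x in lborel. ennreal (f x) = ennreal (- f x)"
    by (intro sigma_finite_measure.density_unique[OF sigma_finite_lborel]) auto
  then show ?thesis
  proof eventually_elim
    case (elim x)
    then show ?case
      by (cases "0 \<le> f x") (auto simp: ennreal_neg ennreal_eq_0_iff)
  qed
qed

section \<open>Fractional gradients and fractional variation measures\<close>

lemma L1_loc_measurable:
  assumes "G \<in> L1_loc" shows "G \<in> borel_measurable lebesgue"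
proof (rule borel_measurable_LIMSEQ_metric)
  show "(\<lambda>x. indicat_real (cball 0 (real k)) x *\<^sub>R G x) \<in> borel_measurable lebesgue" for k :: nat
  proof -
    have "integrable lebesgue (\<lambda>x. indicat_real (cball 0 (real k)) x *\<^sub>R G x)"
      using assms compact_cball[of 0 "real k"] unfolding L1_loc_def set_integrable_def by blast
    then show ?thesis by (rule borel_measurable_integrable)
  qed
  show "(\<lambda>k. indicat_real (cball 0 (real k)) x *\<^sub>R G x) \<longlonglongrightarrow> G x" for x
  proof (rule tendsto_eventually)
    obtain m :: nat where "norm x < real m" using reals_Archimedean2 by blast
    then have "indicat_real (cball 0 (real k)) x *\<^sub>R G x = G x" if "m \<le> k" for k
      using that by (auto simp: indicator_def)
    then show "eventually (\<lambda>k. indicat_real (cball 0 (real k)) x *\<^sub>R G x = G x) sequentially"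
      unfolding eventually_sequentially by blast
  qed
qed

lemma gagliardo_lipschitz_finite:
  fixes \<psi> :: "real^'n \<Rightarrow> real"
  assumes \<alpha>: "0 < \<alpha>" "\<alpha> < 1" and L: "\<And>x y. \<bar>\<psi> x - \<psi> y\<bar> \<le> L * norm (x - y)" and B: "\<And>x. \<bar>\<psi> x\<bar> \<le> B"
    and \<rho>: "\<And>x. x \<notin> ball 0 \<rho> \<Longrightarrow> \<psi> x = 0"
  shows "gagliardo \<alpha> \<psi> < \<infinity>"
proof -
  obtain C where "0 < C" and C: "\<And>(u :: real^'n \<Rightarrow> real) L B a \<rho> r.
    \<lbrakk>\<And>x y. \<bar>u x - u y\<bar> \<le> L * norm (x - y); \<And>x. \<bar>u x\<bar> \<le> B; \<And>x. x \<notin> cball a \<rho> \<Longrightarrow> u x = 0; 0 \<le> \<rho>; 0 < r\<rbrakk>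
    \<Longrightarrow> gagliardo \<alpha> u \<le> ennreal (C * \<rho> ^ CARD('n) * (L * r powr (1 - \<alpha>) + B * r powr (- \<alpha>)))"
    using gagliardo_lipschitz[OF \<alpha>, where ?'n='n] by blast
  have "gagliardo \<alpha> \<psi> \<le> ennreal (C * max 0 \<rho> ^ CARD('n) * (L * 1 powr (1 - \<alpha>) + B * 1 powr (- \<alpha>)))"
    by (rule C[where a=0]) (use L B \<rho> in auto)
  also have "\<dots> < \<infinity>" by simp
  finally show ?thesis .
qed

text \<open>Tested with \<open>smooth_box a b N x *\<^sub>R axis i 1\<close>, the weak gradient and
  the singular integral give the same pairing, by definition and by parts respectively. Dominated
  convergence replaces smooth boxes by indicators, and a function with zero integral over all boxes
  is zero almost everywhere.\<close>

lemma weak_frac_gradient_eq_frac_grad: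
  fixes g0 g :: "real^'n \<Rightarrow> real"
  assumes \<alpha>: "0 < \<alpha>" "\<alpha> < 1" and g[measurable]: "g \<in> borel_measurable borel" and B: "\<And>x. \<bar>g x\<bar> \<le> B"
    and lg: "locally_gagliardo \<alpha> g" and ae: "AE x in lborel. g0 x = g x" and g0: "g0 \<in> borel_measurable lebesgue"
    and G: "is_weak_frac_gradient \<alpha> g0 G"
  shows "AE x in lebesgue. G x $ i = frac_grad \<alpha> i g x"
proof -
  have GL: "G \<in> L1_loc" using G by (simp add: is_weak_frac_gradient_def)
  have Gi: "(\<lambda>x. G x $ i) \<in> borel_measurable lebesgue"
    using borel_measurable_continuous_onI[of "\<lambda>v::real^'n. v $ i"] L1_loc_measurable[OF GL]
    by (intro measurable_compose[of G lebesgue borel "\<lambda>v. v $ i"]) (auto intro!: continuous_intros)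
  \<comment> \<open>A Borel version of the component lets all integrals move from the completed
    measure to \<open>lborel\<close>, over which the product measures are formed.\<close>
  obtain H where H0: "H \<in> borel_measurable lborel" and H: "AE x in lborel. G x $ i = H x"
    using completion_ex_borel_measurable_real[OF Gi] by auto
  have [measurable]: "H \<in> borel_measurable borel" using H0 by simp
  define f where "f x = H x - frac_grad \<alpha> i g x" for x
  have [measurable]: "f \<in> borel_measurable borel" unfolding f_def[abs_def] by measurable
  have boxm [measurable]: "box a b \<in> sets borel" for a b :: "real^'n" by auto
  have intH: "integrable lborel (\<lambda>x. indicat_real (box a b) x * H x)" for a b
  proof -
    have "integrable lebesgue (\<lambda>x. indicat_real (cbox a b) x *\<^sub>R G x)"
      using GL compact_cbox[of a b] unfolding L1_loc_def set_integrable_def by auto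
    then have "integrable lebesgue (\<lambda>x. (indicat_real (cbox a b) x *\<^sub>R G x) $ i)"
      by (rule integrable_bounded_linear[OF bounded_linear_vec_nth])
    then have "integrable lebesgue (\<lambda>x. indicat_real (box a b) x *\<^sub>R (indicat_real (cbox a b) x * G x $ i))"
      by (intro integrable_mult_indicator) auto
    moreover have "AE x in lebesgue. indicat_real (box a b) x *\<^sub>R (indicat_real (cbox a b) x * G x $ i) = indicat_real (box a b) x * H x"
      using AE_completion[OF H] by eventually_elim (use box_subset_cbox[of a b] in \<open>auto simp: indicator_def\<close>)
    ultimately have "integrable lebesgue (\<lambda>x. indicat_real (box a b) x * H x)"
      by (subst integrable_cong_AE[symmetric, of _ lebesgue]) (auto intro!: measurable_completion)
    then show ?thesis by (subst (asm) integrable_completion) auto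
  qed
  have ex_ball: "\<exists>L. box a b \<subseteq> ball 0 L" for a b :: "real^'n"
    using bounded_box[of a b] bounded_subset_ballD by blast
  have intF: "integrable lborel (\<lambda>x. indicat_real (box a b) x * frac_grad \<alpha> i g x)" for a b
  proof -
    obtain L where "box a b \<subseteq> ball 0 L" using ex_ball by blast
    then show ?thesis
      by (intro integral_frac_grad(1)[OF \<alpha>(1) g _ B lg, where M=1 and L=L]) (auto simp: indicator_def)
  qed
  have int: "integrable lborel (\<lambda>x. indicator (box a b) x * f x)" for a b
    using Bochner_Integration.integrable_diff[OF intH intF, of a b a b] by (simp add: f_def right_diff_distrib)
  have "AE x in lborel. f x = 0"
  proof (rule AE_zero_if_integral_box_zero[OF _ int])
    fix a b :: "real^'n"
    define \<psi> where "\<psi> k = smooth_box a b (real (Suc k))" for k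
    have \<psi>lip: "\<bar>\<psi> k x - \<psi> k y\<bar> \<le> real CARD('n) * (4 * real (Suc k)) * norm (x - y)" for k x y
      unfolding \<psi>_def by (rule smooth_box_lipschitz) simp
    have \<psi>m [measurable]: "\<psi> k \<in> borel_measurable borel" for k
      using smooth_box_C_k[of 0 a b "real (Suc k)"] by (auto simp: \<psi>_def intro: borel_measurable_continuous_onI)
    have \<psi>1: "\<bar>\<psi> k x\<bar> \<le> 1" for k x using smooth_box_bounds[of a b _ x] by (simp add: \<psi>_def abs_of_nonneg)
    have \<psi>out: "\<psi> k x = 0" if "x \<notin> box a b" for k x using that by (simp add: \<psi>_def smooth_box_outside)
    obtain L where L: "box a b \<subseteq> ball 0 L" using ex_ball by blast
    have L': "\<psi> k x = 0" if "x \<notin> ball 0 L" for k x using \<psi>out[of x k] that L by blast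
    have dom: "\<bar>\<psi> k x * u x\<bar> \<le> \<bar>indicat_real (box a b) x * u x\<bar>" for k x and u :: "real^'n \<Rightarrow> real"
      using \<psi>1[of k x] \<psi>out[of x k] by (auto simp: indicator_def abs_mult intro: mult_left_le_one_le)
    have \<psi>int: "integrable lborel (\<lambda>x. \<psi> k x * u x)" if "integrable lborel (\<lambda>x. indicat_real (box a b) x * u x)" "u \<in> borel_measurable borel" for u k
      by (rule Bochner_Integration.integrable_bound[OF that(1)]) (use dom that(2) in auto)
    have zero: "(LINT x|lborel. \<psi> k x * f x) = 0" for k
    proof -
      have gag: "gagliardo \<alpha> (\<psi> k) < \<infinity>"
        by (rule gagliardo_lipschitz_finite[OF \<alpha> \<psi>lip \<psi>1 L'])
      have fdm [measurable]: "frac_div \<alpha> (\<lambda>x. \<psi> k x *\<^sub>R axis i 1) \<in> borel_measurable borel"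
        unfolding frac_div_axis[OF \<psi>m, abs_def] by measurable
      have "(LINT x|lebesgue. g0 x * frac_div \<alpha> (\<lambda>x. \<psi> k x *\<^sub>R axis i 1) x) = - (LINT x|lebesgue. (\<psi> k x *\<^sub>R axis i 1) \<bullet> G x)"
        using G smooth_box_Cc_infinity[of "real (Suc k)" a b i] unfolding is_weak_frac_gradient_def \<psi>_def by auto
      moreover have "(LINT x|lebesgue. g0 x * frac_div \<alpha> (\<lambda>x. \<psi> k x *\<^sub>R axis i 1) x) = (LINT x|lborel. g x * frac_div \<alpha> (\<lambda>x. \<psi> k x *\<^sub>R axis i 1) x)"
      proof -
        have "(LINT x|lebesgue. g0 x * frac_div \<alpha> (\<lambda>x. \<psi> k x *\<^sub>R axis i 1) x) = (LINT x|lebesgue. g x * frac_div \<alpha> (\<lambda>x. \<psi> k x *\<^sub>R axis i 1) x)"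
          using AE_completion[OF ae] by (intro integral_cong_AE borel_measurable_times g0 measurable_completion) (auto elim!: eventually_mono)
        then show ?thesis by (simp add: integral_completion)
      qed
      moreover have "(LINT x|lebesgue. (\<psi> k x *\<^sub>R axis i 1) \<bullet> G x) = (LINT x|lborel. \<psi> k x * H x)"
      proof -
        have "(LINT x|lebesgue. (\<psi> k x *\<^sub>R axis i 1) \<bullet> G x) = (LINT x|lebesgue. \<psi> k x * G x $ i)"
          by (simp add: inner_axis' )
        also have "\<dots> = (LINT x|lebesgue. \<psi> k x * H x)"
          using AE_completion[OF H] by (intro integral_cong_AE borel_measurable_times Gi measurable_completion) (auto elim!: eventually_mono)
        finally show ?thesis by (simp add: integral_completion)
      qed
      moreover have "(LINT x|lborel. \<psi> k x * frac_grad \<alpha> i g x) = - (LINT x|lborel. g x * frac_div \<alpha> (\<lambda>x. \<psi> k x *\<^sub>R axis i 1) x)"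
        by (rule frac_grad_by_parts[OF \<alpha>(1) g \<psi>m B lg \<psi>1 L' gag])
      ultimately have "(LINT x|lborel. \<psi> k x * H x) = (LINT x|lborel. \<psi> k x * frac_grad \<alpha> i g x)" by simp
      then show ?thesis
        using \<psi>int[OF intH[of a b]] \<psi>int[OF intF[of a b]] by (simp add: f_def right_diff_distrib)
    qed
    have "(\<lambda>k. LINT x|lborel. \<psi> k x * f x) \<longlonglongrightarrow> (LINT x|lborel. indicator (box a b) x * f x)"
    proof (rule integral_dominated_convergence)
      show "integrable lborel (\<lambda>x. \<bar>indicator (box a b) x * f x\<bar>)" using int by (rule integrable_abs)
      show "AE x in lborel. (\<lambda>k. \<psi> k x * f x) \<longlonglongrightarrow> indicator (box a b) x * f x"
        unfolding \<psi>_def by (intro AE_I2 tendsto_mult smooth_box_tendsto tendsto_const)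
      show "AE x in lborel. norm (\<psi> k x * f x) \<le> \<bar>indicator (box a b) x * f x\<bar>" for k
        using dom by simp
    qed measurable
    then show "(LINT x|lborel. indicator (box a b) x * f x) = 0" by (simp add: zero LIMSEQ_const_iff)
  qed measurable
  then have "AE x in lborel. G x $ i = frac_grad \<alpha> i g x"
    using H by eventually_elim (simp add: f_def)
  then show ?thesis by (rule AE_completion)
qed

section \<open>Testing the components of the fractional variation measure\<close>

lemma signed_integral_uminus: "signed_integral (\<lambda>A. - m A) u = - signed_integral m u"
  by (simp add: signed_integral_def negative_part_def)

lemma signed_integral_zero [simp]: "signed_integral m (\<lambda>x. 0) = 0"
  by (simp add: signed_integral_def)

text \<open>The field \<open>\<psi> x *\<^sub>R axis i 1\<close> belongs to \<open>Lip_c\<close>,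
  and only component \<open>i\<close> of the vector integral survives; finite energy identifies the
  divergence pairing with the bilinear form.\<close>

lemma signed_integral_frac_variation:
  fixes f0 f \<psi> :: "real^'n \<Rightarrow> real"
  assumes D: "is_frac_variation_measure \<alpha> f0 D" and f[measurable]: "f \<in> borel_measurable borel" and A: "\<And>x. \<bar>f x\<bar> \<le> A"
    and f0: "f0 \<in> borel_measurable lebesgue" and ae: "AE x in lborel. f0 x = f x"
    and lip: "L-lipschitz_on UNIV \<psi>" and cs: "compact_support \<psi>" and fin: "gagliardo \<alpha> \<psi> < \<infinity>"
  shows "signed_integral (\<lambda>A. D A $ i) \<psi> = - (frac_const CARD('n) \<alpha> * riesz_form \<alpha> i (\<lambda>z. f (fst z)) \<psi>)"
proof -
  let ?\<phi> = "\<lambda>x. \<psi> x *\<^sub>R axis i (1::real)"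
  have \<psi>m [measurable]: "\<psi> \<in> borel_measurable borel"
    using lip by (intro borel_measurable_continuous_onI lipschitz_on_continuous_on)
  have "?\<phi> \<in> Lip_c"
  proof -
    have "L-lipschitz_on UNIV ?\<phi>"
    proof (rule lipschitz_onI)
      show "dist (?\<phi> x) (?\<phi> y) \<le> L * dist x y" for x y
        using lipschitz_onD[OF lip, of x y] unfolding dist_norm scaleR_diff_left[symmetric] by (simp add: norm_axis_1)
      show "0 \<le> L" using lip by (rule lipschitz_on_nonneg)
    qed
    moreover have "{x. ?\<phi> x \<noteq> 0} = {x. \<psi> x \<noteq> 0}" by (auto simp: axis_eq_0_iff)
    then have "compact_support ?\<phi>" using cs unfolding compact_support_def by simp
    ultimately show ?thesis unfolding Lip_c_def by blast
  qed
  then have "(LINT x|lebesgue. f0 x * frac_div \<alpha> ?\<phi> x) = - vector_dot_integral D ?\<phi>"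
    using D unfolding is_frac_variation_measure_def by blast
  moreover have "vector_dot_integral D ?\<phi> = signed_integral (\<lambda>A. D A $ i) \<psi>"
  proof -
    have "vector_dot_integral D ?\<phi> = (\<Sum>j\<in>UNIV. if j = i then signed_integral (\<lambda>A. D A $ i) \<psi> else 0)"
      unfolding vector_dot_integral_def by (intro sum.cong) (auto simp: axis_def)
    then show ?thesis by simp
  qed
  moreover have "(LINT x|lebesgue. f0 x * frac_div \<alpha> ?\<phi> x) = (LINT x|lborel. f x * frac_div \<alpha> ?\<phi> x)"
  proof -
    have [measurable]: "frac_div \<alpha> ?\<phi> \<in> borel_measurable borel"
      unfolding frac_div_axis[OF \<psi>m, abs_def] by measurable
    have "(LINT x|lebesgue. f0 x * frac_div \<alpha> ?\<phi> x) = (LINT x|lebesgue. f x * frac_div \<alpha> ?\<phi> x)"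
      using AE_completion[OF ae] by (intro integral_cong_AE borel_measurable_times f0 measurable_completion) (auto elim!: eventually_mono)
    then show ?thesis by (simp add: integral_completion)
  qed
  ultimately show ?thesis using integral_frac_div_axis[OF f \<psi>m A fin, where i=i] by simp
qed

text \<open>Boundedness of \<open>f\<close> turns the testing identity into the energy estimate
  required by \<open>positive_part_density_le\<close>, so almost every point lies in
  \<open>density_le\<close> for some \<open>M\<close>; on each of these sets precise values exist
  almost everywhere. The estimate is unchanged under negation of the measure, which covers the
  negative part.\<close>

lemma AE_has_precise_value:
  fixes f0 f g :: "real^'n \<Rightarrow> real" and D :: "(real^'n) set \<Rightarrow> real^'n"
  assumes \<alpha>: "0 < \<alpha>" "\<alpha> < 1" and D: "is_frac_variation_measure \<alpha> f0 D"
    and f[measurable]: "f \<in> borel_measurable borel" and A: "\<And>x. \<bar>f x\<bar> \<le> A"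
    and f0: "f0 \<in> borel_measurable lebesgue" and ae: "AE x in lborel. f0 x = f x"
    and g[measurable]: "g \<in> borel_measurable borel" and B: "\<And>x. \<bar>g x\<bar> \<le> B" and lg: "locally_gagliardo \<alpha> g"
  shows "AE x in positive_part (\<lambda>A. D A $ i). has_precise_value g x"
    and "AE x in negative_part (\<lambda>A. D A $ i). has_precise_value g x"
proof -
  let ?c = "\<bar>frac_const CARD('n) \<alpha>\<bar>"
  have A0: "0 \<le> A" using A[of 0] by linarith
  have vm: "vector_measure (\<lambda>A. D A $ i)"
    using D by (auto simp: is_frac_variation_measure_def intro: vector_measure_component)
  have li: "locally_integrable g" by (rule locally_integrable_bounded) (auto intro: B)
  have test: "\<bar>signed_integral (\<lambda>A. D A $ i) \<psi>\<bar> \<le> (?c * A) * E"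
    if lip: "L-lipschitz_on UNIV \<psi>" and cs: "compact_support \<psi>" and E: "gagliardo \<alpha> \<psi> \<le> ennreal E" "0 \<le> E" for \<psi> L E
  proof -
    have fin: "gagliardo \<alpha> \<psi> < \<infinity>" using E by (auto simp: le_less_trans)
    have "\<bar>riesz_form \<alpha> i (\<lambda>z. f (fst z)) \<psi>\<bar> \<le> A * E"
      using lip by (intro riesz_form_bound E A borel_measurable_continuous_onI lipschitz_on_continuous_on) auto
    then have "?c * \<bar>riesz_form \<alpha> i (\<lambda>z. f (fst z)) \<psi>\<bar> \<le> ?c * (A * E)" by (intro mult_left_mono) auto
    then show ?thesis
      unfolding signed_integral_frac_variation[OF D f A f0 ae lip cs fin] by (simp add: abs_mult mult.assoc)
  qed
  have main: "AE x in positive_part m. has_precise_value g x"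
    if m: "vector_measure m" and t: "\<And>\<psi> L E. L-lipschitz_on UNIV \<psi> \<Longrightarrow> compact_support \<psi> \<Longrightarrow>
        gagliardo \<alpha> \<psi> \<le> ennreal E \<Longrightarrow> 0 \<le> E \<Longrightarrow> \<bar>signed_integral m \<psi>\<bar> \<le> (?c * A) * E" for m :: "(real^'n) set \<Rightarrow> real"
  proof -
    have "AE x in positive_part m. \<exists>M. x \<in> density_le (real CARD('n) - \<alpha>) (positive_part m) M"
      by (rule positive_part_density_le[OF \<alpha> m _ t]) (use A0 in auto)
    moreover have "AE x in positive_part m. \<forall>M. x \<in> density_le (real CARD('n) - \<alpha>) (positive_part m) M \<longrightarrow> has_precise_value g x"
      unfolding AE_all_countable
      using lg unfolding locally_gagliardo_def
      by (intro allI AE_density_le_has_precise_value[OF li \<alpha>(1) finite_positive_part[OF m]]) auto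
    ultimately show ?thesis by eventually_elim auto
  qed
  show "AE x in positive_part (\<lambda>A. D A $ i). has_precise_value g x" by (rule main[OF vm test])
  show "AE x in negative_part (\<lambda>A. D A $ i). has_precise_value g x"
    unfolding negative_part_def by (rule main[OF vector_measure_uminus[OF vm]]) (simp add: signed_integral_uminus test)
qed

lemma riesz_form_diff:
  fixes u1 u2 :: "real^'n \<Rightarrow> real"
  assumes [measurable]: "u1 \<in> borel_measurable borel" "u2 \<in> borel_measurable borel" "w \<in> borel_measurable (borel \<Otimes>\<^sub>M borel)"
    and w: "\<And>z. \<bar>w z\<bar> \<le> B" and fin: "gagliardo \<alpha> u1 < \<infinity>" "gagliardo \<alpha> u2 < \<infinity>"
  shows "riesz_form \<alpha> i w (\<lambda>x. u1 x - u2 x) = riesz_form \<alpha> i w u1 - riesz_form \<alpha> i w u2"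
  unfolding riesz_form_def
    Bochner_Integration.integral_diff[OF riesz_form_integrable[OF assms(1,3) w fin(1)] riesz_form_integrable[OF assms(2,3) w fin(2)], symmetric]
  by (intro Bochner_Integration.integral_cong) (auto simp: algebra_simps)

text \<open>The product of \<open>g\<close> and \<open>v\<close> need not be Lipschitz, but its ball
  averages are, and the identity holds for them. The bilinear side converges by convergence in
  energy, the measure side by dominated convergence: the averages converge wherever \<open>g\<close>
  has a precise value, and such points have full measure for both Jordan parts.\<close>

lemma signed_integral_precise_rep:
  fixes f0 f g v :: "real^'n \<Rightarrow> real" and D :: "(real^'n) set \<Rightarrow> real^'n"
  assumes \<alpha>: "0 < \<alpha>" "\<alpha> < 1" and D: "is_frac_variation_measure \<alpha> f0 D"
    and f[measurable]: "f \<in> borel_measurable borel" and A: "\<And>x. \<bar>f x\<bar> \<le> A"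
    and f0: "f0 \<in> borel_measurable lebesgue" and ae: "AE x in lborel. f0 x = f x"
    and g[measurable]: "g \<in> borel_measurable borel" and B: "\<And>x. \<bar>g x\<bar> \<le> B" and lg: "locally_gagliardo \<alpha> g"
    and v: "continuous_on UNIV v" "\<And>x. \<bar>v x\<bar> \<le> M" "\<And>x. x \<notin> ball 0 L \<Longrightarrow> v x = 0" "gagliardo \<alpha> v < \<infinity>"
  shows "signed_integral (\<lambda>A. D A $ i) (\<lambda>x. precise_rep g x * v x) = - (frac_const CARD('n) \<alpha> * riesz_form \<alpha> i (\<lambda>z. f (fst z)) (\<lambda>x. g x * v x))"
proof -
  let ?m = "\<lambda>A. D A $ i"
  let ?F = "\<lambda>x. g x * v x"
  have vm [measurable]: "v \<in> borel_measurable borel" using v(1) by (rule borel_measurable_continuous_onI)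
  have B0: "0 \<le> B" using B[of 0] by linarith
  have M0: "0 \<le> M" using v(2)[of 0] by linarith
  have FB: "\<bar>?F x\<bar> \<le> B * M" for x unfolding abs_mult by (intro mult_mono B v B0) auto
  have Fi: "integrable lborel ?F"
    by (rule integrable_bounded_support[where a=0 and r=L]) (use FB v(3) in auto)
  have Fg: "gagliardo \<alpha> ?F < \<infinity>" by (rule gagliardo_mult[OF \<alpha>(1) g vm B lg v(2) v(3) v(4)])
  define r where "r k = 1 / real (Suc k)" for k
  have r: "0 < r k" "r k \<le> 1" for k by (auto simp: r_def)
  have r0: "r \<longlonglongrightarrow> 0" unfolding r_def by (rule filterlim_compose[OF lim_1_over_n filterlim_Suc])
  define w where "w k x = ball_average ?F x (r k)" for k x
  have wl: "(2 * (B * M) * real CARD('n) / r k)-lipschitz_on UNIV (w k)" for k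
    unfolding w_def by (rule ball_average_lipschitz_on) (use FB r in auto)
  have wB: "\<bar>w k x\<bar> \<le> B * M" for k x
    unfolding w_def by (rule abs_ball_average_le) (use FB r in auto)
  \<comment> \<open>Averaging at radius at most 1 enlarges the support by at most 1.\<close>
  have wout: "w k x = 0" if "x \<notin> ball 0 (L + 1)" for k x
    unfolding w_def
  proof (rule ball_average_eq_0)
    fix y assume y: "y \<in> ball x (r k)"
    have "norm x \<le> norm y + dist x y" using norm_triangle_ineq[of y "x - y"] by (simp add: dist_norm)
    then have "y \<notin> ball 0 L" using that y r[of k] by simp
    then show "?F y = 0" by (simp add: v(3))
  qed
  have wm [measurable]: "w k \<in> borel_measurable borel" for k
    using wl[of k] by (intro borel_measurable_continuous_onI lipschitz_on_continuous_on)
  have wcs: "compact_support (w k)" for k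
  proof -
    have "{x. w k x \<noteq> 0} \<subseteq> ball 0 (L + 1)" using wout[of _ k] by blast
    then have "bounded {x. w k x \<noteq> 0}" by (rule bounded_subset[OF bounded_ball])
    then show ?thesis by (simp add: compact_support_def compact_closure)
  qed
  have wg: "gagliardo \<alpha> (w k) < \<infinity>" for k
    by (rule gagliardo_lipschitz_finite[OF \<alpha> lipschitz_onD[OF wl UNIV_I UNIV_I, unfolded dist_norm real_norm_def] wB wout])
  have eq: "signed_integral ?m (w k) = - (frac_const CARD('n) \<alpha> * riesz_form \<alpha> i (\<lambda>z. f (fst z)) (w k))" for k
    by (rule signed_integral_frac_variation[OF D f A f0 ae wl wcs wg])
  have "(\<lambda>k. riesz_form \<alpha> i (\<lambda>z. f (fst z)) (w k)) \<longlonglongrightarrow> riesz_form \<alpha> i (\<lambda>z. f (fst z)) ?F"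
  proof -
    have A0: "0 \<le> A" using A[of 0] by linarith
    have lim: "(\<lambda>k. gagliardo \<alpha> (\<lambda>x. w k x - ?F x)) \<longlonglongrightarrow> 0"
      unfolding w_def by (rule gagliardo_ball_average_tendsto[OF Fi _ \<alpha>(1) Fg r(1) r0]) measurable
    \<comment> \<open>\<open>enn2real\<close> gives a true bound only where the energy is finite,
      which holds eventually.\<close>
    then have ev: "eventually (\<lambda>k. gagliardo \<alpha> (\<lambda>x. w k x - ?F x) < 1) sequentially"
      by (rule order_tendstoD) simp
    have "(\<lambda>k. A * enn2real (gagliardo \<alpha> (\<lambda>x. w k x - ?F x))) \<longlonglongrightarrow> A * 0"
      by (intro tendsto_mult tendsto_const tendsto_enn2real[where l=0, simplified]) (use lim in auto)
    then have lim0: "(\<lambda>k. A * enn2real (gagliardo \<alpha> (\<lambda>x. w k x - ?F x))) \<longlonglongrightarrow> 0" by simp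
    have "(\<lambda>k. riesz_form \<alpha> i (\<lambda>z. f (fst z)) (w k) - riesz_form \<alpha> i (\<lambda>z. f (fst z)) ?F) \<longlonglongrightarrow> 0"
    proof (rule Lim_null_comparison[OF _ lim0])
      show "eventually (\<lambda>k. norm (riesz_form \<alpha> i (\<lambda>z. f (fst z)) (w k) - riesz_form \<alpha> i (\<lambda>z. f (fst z)) ?F) \<le> A * enn2real (gagliardo \<alpha> (\<lambda>x. w k x - ?F x))) sequentially"
        using ev
      proof eventually_elim
        case (elim k)
        have "riesz_form \<alpha> i (\<lambda>z. f (fst z)) (w k) - riesz_form \<alpha> i (\<lambda>z. f (fst z)) ?F = riesz_form \<alpha> i (\<lambda>z. f (fst z)) (\<lambda>x. w k x - ?F x)"
          by (rule riesz_form_diff[where B=A, symmetric]) (use wg[of k] Fg A in auto)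
        moreover have "\<bar>riesz_form \<alpha> i (\<lambda>z. f (fst z)) (\<lambda>x. w k x - ?F x)\<bar> \<le> A * enn2real (gagliardo \<alpha> (\<lambda>x. w k x - ?F x))"
          by (rule riesz_form_bound) (use A elim in \<open>auto simp: ennreal_enn2real_if\<close>)
        ultimately show ?case by simp
      qed
    qed
    then show ?thesis by (rule LIM_zero_cancel)
  qed
  then have lim1: "(\<lambda>k. signed_integral ?m (w k)) \<longlonglongrightarrow> - (frac_const CARD('n) \<alpha> * riesz_form \<alpha> i (\<lambda>z. f (fst z)) ?F)"
    unfolding eq by (intro tendsto_minus tendsto_mult tendsto_const)
  have vmeas: "vector_measure ?m" using D by (auto simp: is_frac_variation_measure_def intro: vector_measure_component)
  interpret P: finite_measure "positive_part ?m" by (rule finite_positive_part[OF vmeas])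
  interpret N: finite_measure "negative_part ?m" by (rule finite_negative_part[OF vmeas])
  note [measurable] = precise_rep_measurable_bounded[OF g B]
  have pointwise: "(\<lambda>k. w k x) \<longlonglongrightarrow> precise_rep g x * v x" if "has_precise_value g x" for x
    unfolding w_def r_def
    by (rule filterlim_compose[OF tendsto_ball_average_mult[OF g B v(1) v(2) that] filterlim_inverse_Suc_at_right])
  have "(\<lambda>k. LINT x|positive_part ?m. w k x) \<longlonglongrightarrow> (LINT x|positive_part ?m. precise_rep g x * v x)"
  proof (rule integral_dominated_convergence)
    show "AE x in positive_part ?m. (\<lambda>k. w k x) \<longlonglongrightarrow> precise_rep g x * v x"
      using AE_has_precise_value(1)[OF \<alpha> D f A f0 ae g B lg, where i=i] by eventually_elim (rule pointwise)
    show "AE x in positive_part ?m. norm (w k x) \<le> B * M" for k using wB by simp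
  qed (auto intro: P.integrable_const)
  moreover have "(\<lambda>k. LINT x|negative_part ?m. w k x) \<longlonglongrightarrow> (LINT x|negative_part ?m. precise_rep g x * v x)"
  proof (rule integral_dominated_convergence)
    show "AE x in negative_part ?m. (\<lambda>k. w k x) \<longlonglongrightarrow> precise_rep g x * v x"
      using AE_has_precise_value(2)[OF \<alpha> D f A f0 ae g B lg, where i=i] by eventually_elim (rule pointwise)
    show "AE x in negative_part ?m. norm (w k x) \<le> B * M" for k using wB by simp
  qed (auto intro: N.integrable_const)
  ultimately have "(\<lambda>k. signed_integral ?m (w k)) \<longlonglongrightarrow> signed_integral ?m (\<lambda>x. precise_rep g x * v x)"
    unfolding signed_integral_def by (rule tendsto_diff)
  with lim1 show ?thesis by (rule LIMSEQ_unique[symmetric])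
qed

section \<open>Scaling and the limit\<close>

lemma AE_lborel_scaleR:
  fixes c :: real
  assumes "AE x in lborel. P (x::'a::euclidean_space)" and c: "c \<noteq> 0"
  shows "AE x in lborel. P (c *\<^sub>R x)"
proof -
  obtain N where N: "N \<in> sets borel" "{x. \<not> P x} \<subseteq> N" "emeasure lborel N = 0"
    using assms by (auto elim!: AE_E)
  have S: "{x. c *\<^sub>R x \<in> N} \<in> sets lborel"
    using measurable_sets[of "\<lambda>x. c *\<^sub>R x" borel borel N] N by (auto simp: vimage_def)
  have "emeasure lborel {x. c *\<^sub>R x \<in> N} = (\<integral>\<^sup>+x. indicator N (c *\<^sub>R x) \<partial>lborel)"
  proof -
    have "emeasure lborel {x. c *\<^sub>R x \<in> N} = (\<integral>\<^sup>+x. indicator {x. c *\<^sub>R x \<in> N} x \<partial>lborel)" using S by simp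
    then show ?thesis by (simp add: indicator_def)
  qed
  also have "\<dots> = 0"
    using N c by (subst nn_integral_lborel_scaleR) (auto intro: borel_measurable_indicator)
  finally have "emeasure lborel {x. c *\<^sub>R x \<in> N} = 0" .
  then show ?thesis using N(2) S by (intro AE_I[where N="{x. c *\<^sub>R x \<in> N}"]) auto
qed

text \<open>Substituting \<open>R *\<^sub>R x\<close> and \<open>R *\<^sub>R h\<close> produces two
  volume factors \<open>R powr n\<close> and a factor \<open>R powr (- (n + \<alpha>))\<close> from
  the kernel; the weight \<open>F\<close> is merely composed with the dilation.\<close>

lemma weighted_gagliardo_scale:
  fixes v :: "real^'n \<Rightarrow> real" and F :: "real^'n \<Rightarrow> ennreal"
  assumes [measurable]: "v \<in> borel_measurable borel" "F \<in> borel_measurable borel" and R: "0 < R"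
  shows "(\<integral>\<^sup>+h. ennreal (riesz_kernel \<alpha> h) * (\<integral>\<^sup>+x. F x * ennreal \<bar>v ((x + h) /\<^sub>R R) - v (x /\<^sub>R R)\<bar> \<partial>lborel) \<partial>lborel)
    = ennreal (R powr (real CARD('n) - \<alpha>)) * (\<integral>\<^sup>+h. ennreal (riesz_kernel \<alpha> h) * (\<integral>\<^sup>+x. F (R *\<^sub>R x) * ennreal \<bar>v (x + h) - v x\<bar> \<partial>lborel) \<partial>lborel)"
proof -
  let ?n = "real CARD('n)"
  let ?\<Phi> = "\<lambda>h. \<integral>\<^sup>+x. F x * ennreal \<bar>v ((x + h) /\<^sub>R R) - v (x /\<^sub>R R)\<bar> \<partial>lborel"
  let ?\<Psi> = "\<lambda>h. \<integral>\<^sup>+x. F (R *\<^sub>R x) * ennreal \<bar>v (x + h) - v x\<bar> \<partial>lborel"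
  have R': "R \<noteq> 0" using R by simp
  have inv: "ennreal (R powr ?n) * ennreal (inverse (\<bar>R\<bar> ^ CARD('n))) = 1"
    using R by (subst ennreal_mult'[symmetric]) (auto simp: powr_realpow)
  have scale: "(\<integral>\<^sup>+x. g x \<partial>lborel) = ennreal (R powr ?n) * (\<integral>\<^sup>+x. g (R *\<^sub>R x) \<partial>lborel)"
    if "g \<in> borel_measurable borel" for g :: "real^'n \<Rightarrow> ennreal"
  proof -
    have "ennreal (R powr ?n) * (\<integral>\<^sup>+x. g (R *\<^sub>R x) \<partial>lborel) = (ennreal (R powr ?n) * ennreal (inverse (\<bar>R\<bar> ^ CARD('n)))) * (\<integral>\<^sup>+x. g x \<partial>lborel)"
      unfolding nn_integral_lborel_scaleR[OF that R'] by (simp add: mult.assoc)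
    then show ?thesis by (simp only: inv mult_1_left)
  qed
  have \<Phi>: "?\<Phi> (R *\<^sub>R h) = ennreal (R powr ?n) * ?\<Psi> h" for h
    using R by (subst scale) (auto simp: scaleR_add_right)
  have "(\<integral>\<^sup>+h. ennreal (riesz_kernel \<alpha> h) * ?\<Phi> h \<partial>lborel)
    = ennreal (R powr ?n) * (\<integral>\<^sup>+h. ennreal (riesz_kernel \<alpha> (R *\<^sub>R h)) * ?\<Phi> (R *\<^sub>R h) \<partial>lborel)"
    by (rule scale) measurable
  also have "\<dots> = ennreal (R powr ?n) * (\<integral>\<^sup>+h. ennreal (R powr (- \<alpha>)) * (ennreal (riesz_kernel \<alpha> h) * ?\<Psi> h) \<partial>lborel)"
  proof -
    have "ennreal (riesz_kernel \<alpha> (R *\<^sub>R h)) * ?\<Phi> (R *\<^sub>R h) = ennreal (R powr (- \<alpha>)) * (ennreal (riesz_kernel \<alpha> h) * ?\<Psi> h)" for h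
    proof -
      have "riesz_kernel \<alpha> (R *\<^sub>R h) * R powr ?n = R powr (- \<alpha>) * riesz_kernel \<alpha> h"
      proof -
        have "riesz_kernel \<alpha> (R *\<^sub>R h) = R powr (- (?n + \<alpha>)) * riesz_kernel \<alpha> h"
          using R by (simp add: riesz_kernel_def powr_mult)
        moreover have "R powr (- (?n + \<alpha>)) * R powr ?n = R powr (- \<alpha>)" by (simp flip: powr_add)
        ultimately show ?thesis by (simp add: mult_ac)
      qed
      then have "ennreal (riesz_kernel \<alpha> (R *\<^sub>R h)) * ennreal (R powr ?n) = ennreal (R powr (- \<alpha>)) * ennreal (riesz_kernel \<alpha> h)"
        by (simp flip: ennreal_mult')
      then show ?thesis unfolding \<Phi> by (simp only: mult.assoc[symmetric])
    qed
    then show ?thesis by simp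
  qed
  also have "\<dots> = ennreal (R powr ?n) * (ennreal (R powr (- \<alpha>)) * (\<integral>\<^sup>+h. ennreal (riesz_kernel \<alpha> h) * ?\<Psi> h \<partial>lborel))"
    by (subst nn_integral_cmult) auto
  also have "\<dots> = ennreal (R powr ?n * R powr (- \<alpha>)) * (\<integral>\<^sup>+h. ennreal (riesz_kernel \<alpha> h) * ?\<Psi> h \<partial>lborel)"
    by (simp add: ennreal_mult' mult.assoc)
  also have "R powr ?n * R powr (- \<alpha>) = R powr (?n - \<alpha>)" by (simp flip: powr_add)
  finally show ?thesis .
qed

lemma gagliardo_scale_finite:
  fixes v :: "real^'n \<Rightarrow> real"
  assumes [measurable]: "v \<in> borel_measurable borel" and R: "0 < R" and fin: "gagliardo \<alpha> v < \<infinity>"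
  shows "gagliardo \<alpha> (\<lambda>x. v (x /\<^sub>R R)) < \<infinity>"
  using weighted_gagliardo_scale[of v "\<lambda>_. 1" R \<alpha>] R fin
  by (simp add: gagliardo_def shift_diff_def ennreal_mult_less_top)

text \<open>The factor \<open>g (x + h)\<close> is replaced by its bound, while \<open>f\<close>
  stays inside the integral, where its \<open>p\<close> norm can be paired with the \<open>q\<close>
  norm of the increments.\<close>

lemma riesz_form_weighted_bound:
  fixes f g u :: "real^'n \<Rightarrow> real"
  assumes [measurable]: "f \<in> borel_measurable borel" "g \<in> borel_measurable borel" "u \<in> borel_measurable borel"
    and A: "\<And>x. \<bar>f x\<bar> \<le> A" and B: "\<And>x. \<bar>g x\<bar> \<le> B" and fin: "gagliardo \<alpha> u < \<infinity>"
  shows "ennreal \<bar>riesz_form \<alpha> i (\<lambda>z. f (fst z) * g (fst z + snd z)) u\<bar>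
    \<le> ennreal B * (\<integral>\<^sup>+h. ennreal (riesz_kernel \<alpha> h) * (\<integral>\<^sup>+x. ennreal \<bar>f x\<bar> * ennreal \<bar>u (x + h) - u x\<bar> \<partial>lborel) \<partial>lborel)"
proof -
  let ?G = "\<lambda>z. ennreal (riesz_kernel \<alpha> (snd z)) * (ennreal \<bar>f (fst z)\<bar> * ennreal \<bar>u (fst z + snd z) - u (fst z)\<bar>)"
  let ?H = "\<lambda>z. riesz_kernel \<alpha> (snd z) * (\<bar>f (fst z)\<bar> * \<bar>u (fst z + snd z) - u (fst z)\<bar>)"
  have A0: "0 \<le> A" using A[of 0] by linarith
  have B0: "0 \<le> B" using B[of 0] by linarith
  let ?F = "\<lambda>z. f (fst z) * g (fst z + snd z) * (grad_kernel \<alpha> i (snd z) * (u (fst z + snd z) - u (fst z)))"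
  have int: "integrable (lborel \<Otimes>\<^sub>M lborel) ?F"
    by (rule riesz_form_integrable[where B="A * B"]) (use fin in \<open>auto simp: abs_mult intro!: mult_mono A B A0\<close>)
  have "ennreal \<bar>riesz_form \<alpha> i (\<lambda>z. f (fst z) * g (fst z + snd z)) u\<bar> \<le> (\<integral>\<^sup>+z. ennreal \<bar>?F z\<bar> \<partial>(lborel \<Otimes>\<^sub>M lborel))"
    unfolding riesz_form_def using integral_norm_bound_ennreal[OF int] by simp
  also have "\<dots> \<le> (\<integral>\<^sup>+z. ennreal B * ?G z \<partial>(lborel \<Otimes>\<^sub>M lborel))"
  proof (intro nn_integral_mono)
    fix z :: "(real^'n) \<times> (real^'n)"
    have "\<bar>g (fst z + snd z)\<bar> * (\<bar>grad_kernel \<alpha> i (snd z)\<bar> * (\<bar>f (fst z)\<bar> * \<bar>u (fst z + snd z) - u (fst z)\<bar>))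
      \<le> B * ?H z"
      using B0 by (intro mult_mono B abs_grad_kernel_le) auto
    then have "\<bar>?F z\<bar> \<le> B * ?H z"
      by (simp add: abs_mult mult_ac)
    then have "ennreal \<bar>?F z\<bar> \<le> ennreal (B * ?H z)"
      by (rule ennreal_leI)
    also have "\<dots> = ennreal B * ?G z"
      using B0 by (simp add: ennreal_mult')
    finally show "ennreal \<bar>?F z\<bar> \<le> ennreal B * ?G z" .
  qed
  also have "\<dots> = ennreal B * (\<integral>\<^sup>+z. ?G z \<partial>(lborel \<Otimes>\<^sub>M lborel))"
    by (intro nn_integral_cmult) measurable
  also have "(\<integral>\<^sup>+z. ?G z \<partial>(lborel \<Otimes>\<^sub>M lborel))
    = (\<integral>\<^sup>+h. (\<integral>\<^sup>+x. ennreal (riesz_kernel \<alpha> h) * (ennreal \<bar>f x\<bar> * ennreal \<bar>u (x + h) - u x\<bar>) \<partial>lborel) \<partial>lborel)"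
    by (subst lborel_pair.nn_integral_snd[symmetric]) auto
  also have "\<dots> = (\<integral>\<^sup>+h. ennreal (riesz_kernel \<alpha> h) * (\<integral>\<^sup>+x. ennreal \<bar>f x\<bar> * ennreal \<bar>u (x + h) - u x\<bar> \<partial>lborel) \<partial>lborel)"
    by (intro nn_integral_cong nn_integral_cmult) measurable
  finally show ?thesis .
qed

text \<open>After rescaling, Hoelder's inequality pairs \<open>f (R *\<^sub>R x)\<close>, whose norm
  carries the factor \<open>R powr (- n / p)\<close>, with increments of \<open>v\<close> at unit
  scale. Together with \<open>R powr (n - \<alpha>)\<close> this gives the exponent
  \<open>n / q - \<alpha>\<close>.\<close>

lemma weighted_gagliardo_le_besov:
  fixes f v :: "real^'n \<Rightarrow> real"
  assumes p: "1 \<le> p" and conj: "1 / ennreal p + 1 / q = 1" and fm[measurable]: "f \<in> borel_measurable borel" and vm[measurable]: "v \<in> borel_measurable borel"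
    and A: "0 < A" "Lp_norm (ennreal p) f \<le> ennreal A" and R: "0 < R"
  shows "(\<integral>\<^sup>+h. ennreal (riesz_kernel \<alpha> h) * (\<integral>\<^sup>+x. ennreal \<bar>f x\<bar> * ennreal \<bar>v ((x + h) /\<^sub>R R) - v (x /\<^sub>R R)\<bar> \<partial>lborel) \<partial>lborel)
    \<le> ennreal (A * R powr (real CARD('n) * (1 - 1 / p) - \<alpha>)) * besov_seminorm \<alpha> q v"
proof -
  let ?I = "\<lambda>h. \<integral>\<^sup>+x. ennreal \<bar>f (R *\<^sub>R x)\<bar> * ennreal \<bar>v (x + h) - v x\<bar> \<partial>lborel" and ?N = "\<lambda>h. Lp_norm q (\<lambda>x. v (x + h) - v x)"
  let ?n = "real CARD('n)"
  define c where "c = (R powr (- ?n) * A powr p) powr (1 / p)"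
  have c: "c = R powr (- ?n / p) * A" using p A R by (simp add: c_def powr_mult powr_powr)
  have c0: "0 < c" unfolding c using A R by simp
  have "(\<integral>\<^sup>+x. ennreal (\<bar>f (R *\<^sub>R x)\<bar> powr p) \<partial>lborel) = ennreal (inverse (\<bar>R\<bar> ^ CARD('n))) * (\<integral>\<^sup>+x. ennreal (\<bar>f x\<bar> powr p) \<partial>lborel)"
    using R by (subst nn_integral_lborel_scaleR[where f="\<lambda>x. ennreal (\<bar>f x\<bar> powr p)"]) auto
  also have "\<dots> \<le> ennreal (inverse (\<bar>R\<bar> ^ CARD('n))) * ennreal (A powr p)"
    using nn_integral_powr_le_Lp_norm[OF _ A] p by (intro mult_left_mono) auto
  also have "\<dots> = ennreal (R powr (- ?n) * A powr p)"
    using R by (subst ennreal_mult'[symmetric]) (auto simp: powr_minus powr_realpow)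
  finally have "Lp_norm (ennreal p) (\<lambda>x. f (R *\<^sub>R x)) \<le> ennreal c"
    unfolding c_def using p by (intro Lp_norm_le) auto
  then have hold: "?I h \<le> ennreal c * ?N h" for h
    using holder[of "ennreal p" q "\<lambda>x. f (R *\<^sub>R x)" "\<lambda>x. v (x + h) - v x" c] p conj c0
    by (simp add: abs_mult ennreal_mult' ennreal_leI flip: ennreal_1)
  have "(\<integral>\<^sup>+h. ennreal (riesz_kernel \<alpha> h) * (\<integral>\<^sup>+x. ennreal \<bar>f x\<bar> * ennreal \<bar>v ((x + h) /\<^sub>R R) - v (x /\<^sub>R R)\<bar> \<partial>lborel) \<partial>lborel)
    = ennreal (R powr (?n - \<alpha>)) * (\<integral>\<^sup>+h. ennreal (riesz_kernel \<alpha> h) * ?I h \<partial>lborel)"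
    by (rule weighted_gagliardo_scale[where F="\<lambda>x. ennreal \<bar>f x\<bar>"]) (use R in auto)
  also have "\<dots> \<le> ennreal (R powr (?n - \<alpha>)) * (\<integral>\<^sup>+h. ennreal c * (ennreal (riesz_kernel \<alpha> h) * ?N h) \<partial>lborel)"
  proof (intro mult_left_mono nn_integral_mono)
    fix h
    have "ennreal (riesz_kernel \<alpha> h) * ?I h \<le> ennreal (riesz_kernel \<alpha> h) * (ennreal c * ?N h)"
      by (intro mult_left_mono hold) auto
    then show "ennreal (riesz_kernel \<alpha> h) * ?I h \<le> ennreal c * (ennreal (riesz_kernel \<alpha> h) * ?N h)"
      by (simp only: mult.left_commute)
  qed auto
  also have "\<dots> \<le> ennreal (R powr (?n - \<alpha>)) * (ennreal c * besov_seminorm \<alpha> q v)"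
    unfolding besov_seminorm_def by (intro mult_left_mono nn_integral_cmult_le c0) auto
  also have "\<dots> = ennreal (R powr (?n - \<alpha>) * c) * besov_seminorm \<alpha> q v"
    by (simp add: ennreal_mult' mult.assoc)
  also have "R powr (?n - \<alpha>) * c = A * R powr (?n * (1 - 1 / p) - \<alpha>)"
  proof -
    have "R powr (?n - \<alpha>) * R powr (- ?n / p) = R powr (?n * (1 - 1 / p) - \<alpha>)"
      by (simp add: algebra_simps flip: powr_add)
    then show ?thesis by (simp add: c mult_ac)
  qed
  finally show ?thesis .
qed

text \<open>Clamping a Borel version to the essential bound makes the bound hold at every point, as
  the estimates on weights require.\<close>

lemma Lp_infinity_bounded_representative:
  fixes f :: "real^'n \<Rightarrow> real"
  assumes "f \<in> Lp \<infinity>"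
  obtains u A where "u \<in> borel_measurable borel" "\<And>x. \<bar>u x\<bar> \<le> A" "AE x in lborel. f x = u x"
proof -
  have fm: "f \<in> borel_measurable lebesgue" and fin: "esssup lebesgue (\<lambda>x. ennreal \<bar>f x\<bar>) < \<infinity>"
    using assms by (auto simp: Lp_def Lp_norm_def)
  obtain A where A: "esssup lebesgue (\<lambda>x. ennreal \<bar>f x\<bar>) = ennreal A" "0 \<le> A"
    using fin by (cases "esssup lebesgue (\<lambda>x. ennreal \<bar>f x\<bar>)") auto
  have "AE x in lebesgue. ennreal \<bar>f x\<bar> \<le> ennreal A"
    using esssup_AE[where M=lebesgue and f="\<lambda>x. ennreal \<bar>f x\<bar>"] A(1) by simp
  then have fA: "AE x in lborel. \<bar>f x\<bar> \<le> A" using A(2) by (simp add: AE_completion_iff)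
  obtain u0 where u0: "u0 \<in> borel_measurable lborel" "AE x in lborel. f x = u0 x"
    using completion_ex_borel_measurable_real[OF fm] by auto
  have [measurable]: "u0 \<in> borel_measurable borel" using u0(1) by simp
  show ?thesis
  proof (rule that[of "\<lambda>x. max (- A) (min A (u0 x))" A])
    show "AE x in lborel. f x = max (- A) (min A (u0 x))"
      using fA u0(2) by eventually_elim auto
  qed (use A(2) in auto)
qed

text \<open>Equality holds at every centre and radius. This matters because precise values are
  needed almost everywhere for a measure that may be singular to Lebesgue measure.\<close>

lemma ball_average_cong_AE:
  fixes g u :: "real^'n \<Rightarrow> real"
  assumes "g \<in> borel_measurable lebesgue" "u \<in> borel_measurable borel" "AE x in lborel. g x = u x"
  shows "ball_average g = ball_average u"
proof (intro ext)
  fix x r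
  have "(LINT y:ball x r|lebesgue. g y) = (LINT y:ball x r|lebesgue. u y)"
    unfolding set_lebesgue_integral_def
    using AE_completion[OF assms(3)] assms(1,2)
    by (intro integral_cong_AE borel_measurable_scaleR borel_measurable_indicator measurable_completion[of u lborel])
       (auto elim!: eventually_mono)
  then show "ball_average g x r = ball_average u x r" by (simp add: ball_average_def)
qed

theorem theorem1p7:
  fixes \<alpha> :: real and p q :: ennreal
    and \<eta> f g :: "real^'n \<Rightarrow> real"
    and D :: "(real^'n) set \<Rightarrow> real^'n"
    and G :: "real^'n \<Rightarrow> real^'n"
  assumes "0 < \<alpha>" and "\<alpha> < 1"
    and "1 \<le> p" and "p < ennreal (real CARD('n) / (real CARD('n) - \<alpha>))"
    and "ennreal (real CARD('n) / \<alpha>) < q"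
    and "1 / p + 1 / q = 1"
    and "\<eta> \<in> besov \<alpha> q" and "ess_compact_support \<eta>"
    and "f \<in> BV_frac \<alpha> p \<inter> Lp \<infinity>"
    and "is_frac_variation_measure \<alpha> f D"
    and "g \<in> W1_loc \<alpha> \<inter> Lp \<infinity>"
    and "is_weak_frac_gradient \<alpha> g G"
  shows "(AE x in total_variation D. has_precise_value g x) \<and>
         ((\<lambda>R. LINT x|lebesgue. (\<eta> (x /\<^sub>R R) * f x) *\<^sub>R G x) \<longlongrightarrow>
            - (continuous_rep \<eta> 0 *\<^sub>R vector_integral D (precise_rep g))) at_top"
proof -
  note \<alpha> = assms(1,2) and D = assms(10) and wG = assms(12)
  let ?n = "real CARD('n)" and ?c = "frac_const CARD('n) \<alpha>"
  have n1: "1 \<le> ?n" by (simp add: Suc_leI)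
  obtain p' where p': "p = ennreal p'" "1 \<le> p'" "p' < ?n / (?n - \<alpha>)"
  proof -
    have "p < \<infinity>" using assms(4) by (rule less_trans) simp
    then obtain r where r: "p = ennreal r" "0 \<le> r" by (cases p) auto
    have "ennreal 1 \<le> ennreal r" using assms(3) r by simp
    then have "1 \<le> r" using r(2) by (subst (asm) ennreal_le_iff) auto
    moreover have "r < ?n / (?n - \<alpha>)" using assms(4) r by (simp add: ennreal_less_iff)
    ultimately show ?thesis using that r(1) by blast
  qed
  \<comment> \<open>The exponent \<open>n / q - \<alpha>\<close> of the remainder; the next fact
    says that it is negative.\<close>
  define t where "t = ?n * (1 - 1 / p') - \<alpha>"
  have \<theta>: "?n * (1 - 1 / p') < \<alpha>"
  proof -
    have "p' * (?n - \<alpha>) < ?n" using p'(3) n1 \<alpha> by (simp add: pos_less_divide_eq)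
    then have "?n - \<alpha> < ?n / p'" using p'(2) by (simp add: pos_less_divide_eq mult.commute)
    then show ?thesis by (simp add: right_diff_distrib)
  qed
  have conj: "1 / ennreal p' + 1 / q = 1" using assms(6) p'(1) by simp
  obtain v L M where v: "continuous_on UNIV v" "continuous_rep \<eta> = v" "AE x in lebesgue. \<eta> x = v x"
    "0 < L" "\<And>x. x \<notin> ball 0 L \<Longrightarrow> v x = 0" "\<And>x. \<bar>v x\<bar> \<le> M" "integrable lborel v" "gagliardo \<alpha> v < \<infinity>" "besov_seminorm \<alpha> q v < \<infinity>"
    by (rule besov_representative[OF \<alpha>(1) p'(2) conj \<theta> assms(7,8)]) (rule that; blast)
  have vm [measurable]: "v \<in> borel_measurable borel" using v(1) by (rule borel_measurable_continuous_onI)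
  obtain b where b: "besov_seminorm \<alpha> q v = ennreal b" "0 \<le> b" using v(9) by (cases "besov_seminorm \<alpha> q v") auto
  obtain F A where F[measurable]: "F \<in> borel_measurable borel" and A: "\<And>x. \<bar>F x\<bar> \<le> A" and fF: "AE x in lborel. f x = F x"
    using Lp_infinity_bounded_representative[of f] assms(9) by blast
  obtain u B where u[measurable]: "u \<in> borel_measurable borel" and B: "\<And>x. \<bar>u x\<bar> \<le> B" and gu: "AE x in lborel. g x = u x"
    using Lp_infinity_bounded_representative[of g] assms(11) by blast
  have A0: "0 \<le> A" using A[of 0] by linarith
  have B0: "0 \<le> B" using B[of 0] by linarith
  have M0: "0 \<le> M" using v(6)[of 0] by linarith
  have fm: "f \<in> borel_measurable lebesgue" and gm: "g \<in> borel_measurable lebesgue"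
    using assms(9,11) by (auto simp: Lp_def)
  have lg: "locally_gagliardo \<alpha> u" using assms(11) by (intro W1_loc_locally_gagliardo[OF _ _ gu]) auto
  obtain Af where Af: "0 < Af" "Lp_norm (ennreal p') F \<le> ennreal Af"
  proof -
    have "Lp_norm p f < \<infinity>" using assms(9) by (simp add: BV_frac_def Lp_def)
    moreover have "Lp_norm p f = Lp_norm p F"
      by (intro Lp_norm_cong_AE[OF AE_completion[OF fF] fm] measurable_completion) simp
    ultimately obtain a where "Lp_norm p F = ennreal a" "0 \<le> a" by (cases "Lp_norm p F") auto
    \<comment> \<open>The norm may be 0, while the Hoelder estimate asks for a positive
      bound.\<close>
    then show ?thesis using that[of "a + 1"] p'(1) by (auto intro!: ennreal_leI simp del: ennreal_plus)
  qed
  have ba: "ball_average g = ball_average u" by (rule ball_average_cong_AE[OF gm u gu])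
  have hpv: "has_precise_value g = has_precise_value u" unfolding has_precise_value_def ba ..
  have pr: "precise_rep g = precise_rep u" unfolding precise_rep_def[abs_def] ba hpv ..
  have \<nu>: "vector_measure D" using D by (simp add: is_frac_variation_measure_def)
  note aeP = AE_has_precise_value[OF \<alpha> D F A fm fF u B lg]
  have "AE x in total_variation D. has_precise_value g x"
    unfolding hpv by (rule AE_total_variation[OF \<nu>]) (rule aeP)+
  moreover have "((\<lambda>R. LINT x|lebesgue. (\<eta> (x /\<^sub>R R) * f x) *\<^sub>R G x) \<longlongrightarrow>
            - (continuous_rep \<eta> 0 *\<^sub>R vector_integral D (precise_rep g))) at_top"
  proof (rule vec_tendstoI)
    fix i
    let ?m = "\<lambda>A. D A $ i"
    have Gi: "AE x in lebesgue. G x $ i = frac_grad \<alpha> i u x"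
      by (rule weak_frac_gradient_eq_frac_grad[OF \<alpha> u B lg gu gm wG])
    define vR where "vR R x = v (x /\<^sub>R R)" for R and x :: "real^'n"
    define S where "S R = signed_integral ?m (\<lambda>x. precise_rep u x * vR R x)" for R
    define e where "e R = riesz_form \<alpha> i (\<lambda>z. F (fst z) * u (fst z + snd z)) (vR R)" for R
    have vRm [measurable]: "vR R \<in> borel_measurable borel" for R unfolding vR_def[abs_def] by measurable
    have vRM: "\<bar>vR R x\<bar> \<le> M" for R x by (simp add: vR_def v(6))
    have vRc: "continuous_on UNIV (vR R)" for R
      unfolding vR_def[abs_def] by (auto intro!: continuous_on_compose2[OF v(1)] continuous_intros)
    have vRg: "gagliardo \<alpha> (vR R) < \<infinity>" if "0 < R" for R
      unfolding vR_def[abs_def] by (rule gagliardo_scale_finite[OF vm that v(8)])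
    have vRout: "vR R x = 0" if "0 < R" "x \<notin> ball 0 (R * L)" for R x
      unfolding vR_def using that by (intro v(5)) (auto simp: field_simps)
    \<comment> \<open>An exact identity at each finite \<open>R\<close>: the measure side is
      collected in \<open>S R\<close> and the remainder of the product rule in \<open>e R\<close>,
      so the limit can be taken in each term.\<close>
    have main: "(LINT x|lebesgue. (\<eta> (x /\<^sub>R R) * f x) *\<^sub>R G x) $ i = - S R - ?c * e R" if R: "0 < R" for R
    proof -
      \<comment> \<open>Dilations preserve null sets, so the equality of \<eta> with its continuous
        representative survives rescaling.\<close>
      have ae\<eta>: "AE x in lebesgue. \<eta> (x /\<^sub>R R) = vR R x"
        using AE_lborel_scaleR[of "\<lambda>x. \<eta> x = v x" "inverse R"] v(3) R by (simp add: AE_completion_iff vR_def)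
      let ?H = "\<lambda>x. (vR R x * F x) *\<^sub>R G x"
      have ae: "AE x in lebesgue. ?H x = (\<eta> (x /\<^sub>R R) * f x) *\<^sub>R G x"
        using ae\<eta> AE_completion[OF fF] by eventually_elim simp
      have GL: "G \<in> L1_loc" using wG by (simp add: is_weak_frac_gradient_def)
      have cm: "vR R \<in> borel_measurable lebesgue" "F \<in> borel_measurable lebesgue"
        by (intro measurable_completion; simp)+
      have Hm: "?H \<in> borel_measurable lebesgue"
        by (intro borel_measurable_scaleR borel_measurable_times cm L1_loc_measurable[OF GL])
      have Hi: "integrable lebesgue ?H"
      proof (rule Bochner_Integration.integrable_bound)
        have "integrable lebesgue (\<lambda>x. indicat_real (cball 0 (R * L)) x *\<^sub>R G x)"
          using GL compact_cball[of "0::real^'n" "R * L"] unfolding L1_loc_def set_integrable_def by blast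
        then show "integrable lebesgue (\<lambda>x. (M * A) *\<^sub>R (indicat_real (cball 0 (R * L)) x *\<^sub>R G x))"
          by (rule integrable_scaleR_right)
        show "AE x in lebesgue. norm (?H x) \<le> norm ((M * A) *\<^sub>R (indicat_real (cball 0 (R * L)) x *\<^sub>R G x))"
        proof (rule AE_I2)
          fix x
          show "norm (?H x) \<le> norm ((M * A) *\<^sub>R (indicat_real (cball 0 (R * L)) x *\<^sub>R G x))"
          proof (cases "x \<in> ball 0 (R * L)")
            case True
            have "\<bar>vR R x\<bar> * \<bar>F x\<bar> \<le> M * A" by (intro mult_mono vRM A M0) auto
            then have "\<bar>vR R x\<bar> * \<bar>F x\<bar> * norm (G x) \<le> M * A * norm (G x)" by (intro mult_right_mono) auto
            moreover have "x \<in> cball 0 (R * L)" using True by simp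
            ultimately show ?thesis using M0 A0 by (simp add: abs_mult)
          qed (simp add: vRout[OF R])
        qed
      qed (rule Hm)
      have "(LINT x|lebesgue. (\<eta> (x /\<^sub>R R) * f x) *\<^sub>R G x) = (LINT x|lebesgue. ?H x)"
        by (rule integral_cong_AE[symmetric]) (use ae Hm borel_measurable_AE[OF Hm ae] in auto)
      then have "(LINT x|lebesgue. (\<eta> (x /\<^sub>R R) * f x) *\<^sub>R G x) $ i = (LINT x|lebesgue. ?H x $ i)"
        using integral_bounded_linear[OF bounded_linear_vec_nth Hi, of i] by simp
      also have "\<dots> = (LINT x|lebesgue. (F x * vR R x) * frac_grad \<alpha> i u x)"
      proof (rule integral_cong_AE)
        show "AE x in lebesgue. ?H x $ i = (F x * vR R x) * frac_grad \<alpha> i u x"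
          using Gi by eventually_elim simp
        show "(\<lambda>x. ?H x $ i) \<in> borel_measurable lebesgue"
          using integrable_bounded_linear[OF bounded_linear_vec_nth Hi] by (rule borel_measurable_integrable)
        show "(\<lambda>x. (F x * vR R x) * frac_grad \<alpha> i u x) \<in> borel_measurable lebesgue"
          by (intro measurable_completion) measurable
      qed
      also have "\<dots> = (LINT x|lborel. (F x * vR R x) * frac_grad \<alpha> i u x)"
        by (intro integral_completion) measurable
      also have "\<dots> = ?c * riesz_form \<alpha> i (\<lambda>z. F (fst z) * vR R (fst z)) u"
        by (rule integral_frac_grad(2)[OF \<alpha>(1) u _ B lg, where M="A * M" and L="R * L"])
           (auto simp: abs_mult vRout[OF R] intro!: mult_mono A vRM A0)
      also have "\<dots> = - S R - ?c * e R"
      proof -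
        have "S R = - (?c * riesz_form \<alpha> i (\<lambda>z. F (fst z)) (\<lambda>x. u x * vR R x))"
          unfolding S_def by (rule signed_integral_precise_rep[OF \<alpha> D F A fm fF u B lg vRc vRM vRout[OF R] vRg[OF R]])
        moreover have "riesz_form \<alpha> i (\<lambda>z. F (fst z)) (\<lambda>x. u x * vR R x) = riesz_form \<alpha> i (\<lambda>z. F (fst z) * vR R (fst z)) u + e R"
          unfolding e_def by (rule riesz_form_mult[OF \<alpha>(1) u vRm _ B lg _ vRM vRout[OF R] vRg[OF R], where A=A]) (use A in auto)
        ultimately show ?thesis by (simp add: algebra_simps)
      qed
      finally show ?thesis .
    qed
    have eb: "\<bar>e R\<bar> \<le> B * (Af * R powr t * b)" if R: "0 < R" for R
    proof -
      have "ennreal \<bar>e R\<bar> \<le> ennreal B * (\<integral>\<^sup>+h. ennreal (riesz_kernel \<alpha> h) * (\<integral>\<^sup>+x. ennreal \<bar>F x\<bar> * ennreal \<bar>vR R (x + h) - vR R x\<bar> \<partial>lborel) \<partial>lborel)"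
        unfolding e_def by (rule riesz_form_weighted_bound[OF F u vRm A B vRg[OF R]])
      also have "\<dots> \<le> ennreal B * (ennreal (Af * R powr t) * besov_seminorm \<alpha> q v)"
        unfolding t_def vR_def by (intro mult_left_mono weighted_gagliardo_le_besov[OF p'(2) conj F vm Af R]) auto
      also have "\<dots> = ennreal (B * (Af * R powr t * b))"
        using B0 Af(1) b by (simp add: ennreal_mult')
      finally show ?thesis using B0 Af(1) b by (subst (asm) ennreal_le_iff) auto
    qed
    have "((\<lambda>R. B * (Af * R powr t * b)) \<longlongrightarrow> B * (Af * 0 * b)) at_top"
      using \<theta> by (intro tendsto_mult tendsto_const tendsto_neg_powr) (auto simp: t_def filterlim_ident)
    then have "((\<lambda>R. B * (Af * R powr t * b)) \<longlongrightarrow> 0) at_top" by simp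
    then have e0: "(e \<longlongrightarrow> 0) at_top"
      by (rule Lim_null_comparison[rotated]) (use eb in \<open>auto intro!: eventually_mono[OF eventually_gt_at_top[of 0]]\<close>)
    have vm': "vector_measure ?m" by (rule vector_measure_component[OF \<nu>])
    interpret P: finite_measure "positive_part ?m" by (rule finite_positive_part[OF vm'])
    interpret N: finite_measure "negative_part ?m" by (rule finite_negative_part[OF vm'])
    note [measurable] = precise_rep_measurable_bounded[OF u B]
    \<comment> \<open>At every fixed \<open>x\<close> the values \<open>vR R x\<close> tend to
      \<open>v 0\<close> by continuity; both Jordan parts are finite, so the constant
      \<open>B * M\<close> is an integrable bound.\<close>
    have S0: "(S \<longlongrightarrow> v 0 * signed_integral ?m (precise_rep u)) at_top"
    proof (rule tendsto_at_topI_sequentially)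
      fix X :: "nat \<Rightarrow> real" assume X: "filterlim X at_top sequentially"
      have pt: "(\<lambda>k. precise_rep u x * vR (X k) x) \<longlonglongrightarrow> precise_rep u x * v 0" for x
      proof (intro tendsto_mult tendsto_const)
        have "(\<lambda>k. inverse (X k)) \<longlonglongrightarrow> 0"
          by (rule filterlim_compose[OF tendsto_inverse_0_at_top[OF filterlim_ident] X])
        then have "(\<lambda>k. x /\<^sub>R X k) \<longlonglongrightarrow> 0 *\<^sub>R x" by (intro tendsto_scaleR tendsto_const)
        moreover have "isCont v 0" using v(1) by (simp add: continuous_on_eq_continuous_at)
        ultimately show "(\<lambda>k. vR (X k) x) \<longlonglongrightarrow> v 0" unfolding vR_def by (auto intro: isCont_tendsto_compose)
      qed
      have bd: "\<bar>precise_rep u x * vR (X k) x\<bar> \<le> B * M" for x k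
        unfolding abs_mult by (intro mult_mono abs_precise_rep_le[OF u B] vRM B0) auto
      have "(\<lambda>k. LINT x|positive_part ?m. precise_rep u x * vR (X k) x) \<longlonglongrightarrow> (LINT x|positive_part ?m. precise_rep u x * v 0)"
        by (rule integral_dominated_convergence[where w="\<lambda>_. B * M"]) (use pt bd in auto)
      moreover have "(\<lambda>k. LINT x|negative_part ?m. precise_rep u x * vR (X k) x) \<longlonglongrightarrow> (LINT x|negative_part ?m. precise_rep u x * v 0)"
        by (rule integral_dominated_convergence[where w="\<lambda>_. B * M"]) (use pt bd in auto)
      ultimately have "(\<lambda>k. S (X k)) \<longlonglongrightarrow> (LINT x|positive_part ?m. precise_rep u x * v 0) - (LINT x|negative_part ?m. precise_rep u x * v 0)"
        unfolding S_def signed_integral_def by (rule tendsto_diff)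
      then show "(\<lambda>k. S (X k)) \<longlonglongrightarrow> v 0 * signed_integral ?m (precise_rep u)"
        by (simp add: signed_integral_def right_diff_distrib mult.commute)
    qed
    have "((\<lambda>R. - S R - ?c * e R) \<longlongrightarrow> - (v 0 * signed_integral ?m (precise_rep u)) - ?c * 0) at_top"
      by (intro tendsto_diff tendsto_minus tendsto_mult tendsto_const S0 e0)
    then have "((\<lambda>R. (LINT x|lebesgue. (\<eta> (x /\<^sub>R R) * f x) *\<^sub>R G x) $ i) \<longlongrightarrow> - (v 0 * signed_integral ?m (precise_rep u)) - ?c * 0) at_top"
      by (rule Lim_transform_eventually) (use main in \<open>auto intro!: eventually_mono[OF eventually_gt_at_top[of 0]]\<close>)
    then show "((\<lambda>R. (LINT x|lebesgue. (\<eta> (x /\<^sub>R R) * f x) *\<^sub>R G x) $ i) \<longlongrightarrow>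
            (- (continuous_rep \<eta> 0 *\<^sub>R vector_integral D (precise_rep g))) $ i) at_top"
      by (simp add: v(2) pr vector_integral_def)
  qed
  ultimately show ?thesis ..
qed

end
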